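(* There are absolute constants $c,c'>0$ such that the following holds. For every $\epsilon\in(0,\tfrac12)$ there exists a constant $\delta(\epsilon)>0$, depending only on $\epsilon$, with $\delta(\epsilon)\ge c'\,e^{-e^{c\epsilon^{-3}}}$, such that for every $N\ge 1$ and every measurable set $E\subseteq[0,N^2]\times[0,N^3]$ whose Lebesgue measure is greater than $\epsilon N^5$, there exist $x=(x_1,x_2)\in\mathbb{R}^2$ and $t=(t_1,t_2)\in\mathbb{R}^2$ with $t_1,t_2>\delta(\epsilon)N$ such that $$x,\quad x+t,\quad x+P(t)\ \in E .$$
   Context: For $t=(t_1,t_2)\in\mathbb{R}^2$, $P(t)=(P_1(t),P_2(t))=(t_1^2+t_2^2,\;t_1^3+t_2^3)$. *)

theory Defs
  imports "HOL-Analysis.Analysis"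
begin

definition P :: "real \<times> real \<Rightarrow> real \<times> real" where
  "P t = ((fst t)^2 + (snd t)^2, (fst t)^3 + (snd t)^3)"

end

theory Submission
  imports Defs "HOL-Probability.Probability_Measure"
begin

text \<open>
  At scale \<open>T\<close> take \<open>t = T (\<tau>, \<sigma>)\<close> with \<open>\<tau>, \<sigma>\<close> of order 1, and count configurations in a continuous
  density \<open>f\<close> by \<open>\<Lambda> = \<integral>\<integral> f(x) f(x + t) f(x + P t) dx dt\<close>. The main point is a smoothing inequality:
  translating the last factor by a small multiple of \<open>(T\<^sup>2, T\<^sup>3)\<close> hardly changes \<open>\<Lambda>\<close>, uniformly in \<open>T\<close>.
  One Cauchy-Schwarz step removes the middle factor and doubles only the variable \<open>\<tau>\<close>; for \<open>v = \<tau> - \<tau>'\<close>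
  fixed the linear shift is then the constant \<open>(T v, 0)\<close>, so that the relation between \<open>T\<close>, \<open>T\<^sup>2\<close>, \<open>T\<^sup>3\<close> no
  longer matters. What remains are averages along the curve \<open>\<sigma> \<mapsto> (\<sigma>\<^sup>2, \<sigma>\<^sup>3)\<close> and along the parabola
  \<open>\<tau> \<mapsto> (\<tau>\<^sup>2, \<tau>\<^sup>3) - ((\<tau> - v)\<^sup>2, (\<tau> - v)\<^sup>3)\<close>. Averaging along a curved arc \<open>c\<close> is regularizing: the square
  of its \<open>L\<^sup>2\<close> norm involves only the differences \<open>c(t) - c(t')\<close>, whose distribution in the plane is
  nearly invariant under small translations.

  Consequently the last factor may be replaced by a local average of \<open>f\<close>, and (more easily) so may the
  middle one. An energy argument over geometrically decreasing scales, needing polynomially many in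
  \<open>1/\<epsilon>\<close>, yields a scale at which these averages may be taken over windows much longer than the shifts;
  there \<open>\<Lambda>\<close> is close to \<open>\<integral> f \<cdot> A f \<cdot> A' f\<close>, which is bounded below by \<open>\<epsilon>\<^sup>2 \<integral> f\<close> up to a constant. This even gives
  \<open>\<delta>(\<epsilon>)\<close> of the form \<open>exp (- \<epsilon>\<^sup>-\<^sup>C)\<close>. Sets are reduced to continuous densities by compactness.
\<close>

section \<open>Uniform averages and dominated families\<close>

text \<open>After Cauchy-Schwarz three factors still depend on the two remaining parameters, so the
  two curve averages must be made to act on different factors. The average in \<open>s\<close> acts
  only on a product of two copies of \<open>f\<close> and makes it insensitive to the motion of the
  curve \<open>gam\<close> while the fine part of \<open>\<tau>\<close> runs over an interval of
  length \<open>l\<close>. With that product frozen, the fine average falls on a single difference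
  of \<open>f\<close>. So \<open>l\<close> has to be small; but the parabola is then run only over
  length \<open>l\<close> and has curvature of order \<open>\<eta> * l\<^sup>2\<close>, which limits
  how far the last factor may be translated. This is the origin of the chain of parameters:
  \<open>\<kappa>\<close> determines \<open>\<eta>\<close>, this determines \<open>l\<close>, and
  both determine the short window \<open>\<rho>\<close>. Continuity enters without any modulus,
  which makes the bounds uniform in \<open>T\<close> and in the densities that approximate a set.
  All errors are multiples of the integral of \<open>f\<close>, as is the main term, so
  \<open>\<kappa>\<close> of order \<open>\<epsilon>\<^sup>2\<close> suffices.\<close>

definition unif :: "real measure" where
  "unif = density lborel (indicator {0..1})"

lemma sets_unif [simp, measurable_cong]: "sets unif = sets borel"
  and space_unif [simp]: "space unif = UNIV"
  by (simp_all add: unif_def)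

lemma prob_space_unif: "prob_space unif"
  by (rule prob_spaceI) (simp add: unif_def emeasure_density)

interpretation unif: prob_space unif
  by (rule prob_space_unif)

lemma integral_unif:
  fixes \<phi> :: "real \<Rightarrow> real"
  assumes [measurable]: "\<phi> \<in> borel_measurable borel"
  shows "(\<integral>t. \<phi> t \<partial>unif) = (\<integral>t. indicator {0..1} t * \<phi> t \<partial>lborel)"
proof -
  have "unif = density lborel (\<lambda>t. ennreal (indicator {0..1} t))"
    unfolding unif_def by (metis ennreal_indicator)
  then have "(\<integral>t. \<phi> t \<partial>unif) = (\<integral>t. \<phi> t \<partial>density lborel (\<lambda>t. ennreal (indicator {0..1} t)))"
    by (rule arg_cong)
  also have "\<dots> = (\<integral>t. indicator {0..1} t *\<^sub>R \<phi> t \<partial>lborel)"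
    by (rule integral_density) auto
  finally show ?thesis
    by simp
qed

lemma integral_unif_continuous:
  fixes \<phi> :: "real \<Rightarrow> real"
  assumes "continuous_on UNIV \<phi>"
  shows "(\<integral>t. \<phi> t \<partial>unif) = integral {0..1} \<phi>"
proof -
  have [measurable]: "\<phi> \<in> borel_measurable borel"
    using assms by (rule borel_measurable_continuous_onI)
  have "continuous_on {0..1} \<phi>"
    using assms continuous_on_subset by blast
  then have "set_integrable lborel {0..1} \<phi>"
    by (intro borel_integrable_compact[unfolded set_integrable_def[symmetric]]) auto
  then have "set_lebesgue_integral lborel {0..1} \<phi> = integral {0..1} \<phi>"
    by (rule set_borel_integral_eq_integral)
  then show ?thesis
    by (simp add: integral_unif set_lebesgue_integral_def)
qed

lemma AE_unif: "AE t in unif. t \<in> {0..1}"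
  unfolding unif_def by (subst AE_density) (auto simp: indicator_def)

lemma (in prob_space) abs_integral_le_AE:
  fixes \<phi> :: "'a \<Rightarrow> real"
  assumes "AE t in M. \<bar>\<phi> t\<bar> \<le> B" "0 \<le> B"
  shows "\<bar>\<integral>t. \<phi> t \<partial>M\<bar> \<le> B"
proof (cases "integrable M \<phi>")
  case True
  have "\<bar>\<integral>t. \<phi> t \<partial>M\<bar> \<le> (\<integral>t. \<bar>\<phi> t\<bar> \<partial>M)"
    by (rule integral_abs_bound)
  also have "\<dots> \<le> (\<integral>t. B \<partial>M)"
    by (intro integral_mono_AE) (use True assms in auto)
  finally show ?thesis
    by (simp add: prob_space)
next
  case False
  then show ?thesis
    using assms by (simp add: not_integrable_integral_eq)
qed

lemma (in prob_space) abs_integral_le: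
  fixes \<phi> :: "'a \<Rightarrow> real"
  assumes "\<And>t. t \<in> space M \<Longrightarrow> \<bar>\<phi> t\<bar> \<le> B" "0 \<le> B"
  shows "\<bar>\<integral>t. \<phi> t \<partial>M\<bar> \<le> B"
  using assms by (intro abs_integral_le_AE) auto

lemma abs_integral_le_unif:
  fixes \<phi> :: "real \<Rightarrow> real"
  assumes "\<And>t. t \<in> {0..1} \<Longrightarrow> \<bar>\<phi> t\<bar> \<le> B" "0 \<le> B"
  shows "\<bar>\<integral>t. \<phi> t \<partial>unif\<bar> \<le> B"
proof (rule unif.abs_integral_le_AE)
  show "AE t in unif. \<bar>\<phi> t\<bar> \<le> B"
    using AE_unif by eventually_elim (use assms in auto)
qed fact

lemma (in prob_space) integrable_bounded:
  fixes \<phi> :: "'a \<Rightarrow> real"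
  assumes "\<phi> \<in> borel_measurable M" "\<And>t. t \<in> space M \<Longrightarrow> \<bar>\<phi> t\<bar> \<le> B"
  shows "integrable M \<phi>"
  using assms by (intro integrable_const_bound[where B = B]) auto

lemmas integrable_unif = unif.integrable_bounded[simplified]

lemma integrable_indicator_Icc [simp]: "integrable lborel (indicator {a..b::real} :: real \<Rightarrow> real)"
  by (rule integrable_real_indicator) (auto simp: emeasure_lborel_Icc_eq)

text \<open>The symmetric difference of the unit interval and its translate is covered by two end
  intervals of length \<open>\<bar>h\<bar>\<close>, also for large \<open>h\<close>. This is the
  price of absorbing a translation into a parameter.\<close>

lemma integral_unif_shift:
  fixes \<phi> :: "real \<Rightarrow> real"
  assumes [measurable]: "\<phi> \<in> borel_measurable borel" and bnd: "\<And>t. \<bar>\<phi> t\<bar> \<le> B"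
  shows "\<bar>(\<integral>t. \<phi> (t + h) \<partial>unif) - (\<integral>t. \<phi> t \<partial>unif)\<bar> \<le> 2 * B * \<bar>h\<bar>"
proof -
  have B: "0 \<le> B" using bnd[of 0] by linarith
  obtain a b c d where abcd: "a = min 0 h" "b = max 0 h" "c = min 1 (1 + h)" "d = max 1 (1 + h)"
    by blast
  have le: "a \<le> b" "c \<le> d" and len: "b - a = \<bar>h\<bar>" "d - c = \<bar>h\<bar>"
    unfolding abcd by auto
  have int: "integrable lborel (\<lambda>t. indicator {a..b} t * \<phi> t)" for a b :: real
  proof (rule Bochner_Integration.integrable_bound)
    show "integrable lborel (\<lambda>t. B * indicator {a..b} t)"
      by simp
    show "AE t in lborel. norm (indicator {a..b} t * \<phi> t) \<le> norm (B * indicator {a..b} t)"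
      using bnd B by (intro AE_I2) (simp add: indicator_def)
  qed simp
  have "(\<integral>t. \<phi> (t + h) \<partial>unif) = (\<integral>t. indicator {0..1} t * \<phi> (t + h) \<partial>lborel)"
    by (subst integral_unif) auto
  also have "\<dots> = (\<integral>t. indicator {0..1} (t - h) * \<phi> t \<partial>lborel)"
    by (subst lborel_integral_real_affine[where c = 1 and t = "-h"]) (auto simp: algebra_simps)
  also have "\<dots> = (\<integral>t. indicator {h..1+h} t * \<phi> t \<partial>lborel)"
    by (intro Bochner_Integration.integral_cong) (auto simp: indicator_def)
  finally have eq: "(\<integral>t. \<phi> (t + h) \<partial>unif) - (\<integral>t. \<phi> t \<partial>unif)
     = (\<integral>t. indicator {h..1+h} t * \<phi> t - indicator {0..1} t * \<phi> t \<partial>lborel)"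
    using int by (simp add: integral_unif)
  have dint: "integrable lborel (\<lambda>t. indicator {h..1+h} t * \<phi> t - indicator {0..1} t * \<phi> t)"
    using int[of h "1 + h"] int[of 0 1] by (rule Bochner_Integration.integrable_diff)
  have "(\<integral>t. \<bar>indicator {h..1+h} t * \<phi> t - indicator {0..1} t * \<phi> t\<bar> \<partial>lborel)
      \<le> (\<integral>t. B * indicator {a..b} t + B * indicator {c..d} t \<partial>lborel)"
  proof (rule integral_mono)
    show "integrable lborel (\<lambda>t. \<bar>indicator {h..1+h} t * \<phi> t - indicator {0..1} t * \<phi> t\<bar>)"
      using dint by (rule Bochner_Integration.integrable_abs)
    show "integrable lborel (\<lambda>t. B * indicator {a..b} t + B * indicator {c..d} t)"
      by simp
    show "\<bar>indicator {h..1+h} t * \<phi> t - indicator {0..1} t * \<phi> t\<bar>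
        \<le> B * indicator {a..b} t + B * indicator {c..d} t" for t
    proof -
      let ?d = "indicator {a..b} t + indicator {c..d} t :: real"
      consider "t \<in> {h..1+h} \<longleftrightarrow> t \<in> {0..1}" | "t \<in> {a..b}" | "t \<in> {c..d}"
        unfolding abcd by force
      then have "\<bar>indicator {h..1+h} t - indicator {0..1} t :: real\<bar> \<le> ?d"
        by cases (simp_all add: indicator_def)
      then have "\<bar>indicator {h..1+h} t - indicator {0..1} t\<bar> * \<bar>\<phi> t\<bar> \<le> ?d * B"
        using bnd[of t] by (intro mult_mono) auto
      then show ?thesis
        unfolding abs_mult[symmetric] by (simp only: algebra_simps)
    qed
  qed
  moreover have "(\<integral>t. B * indicator {a..b} t + B * indicator {c..d} t \<partial>lborel) = B * (b - a) + B * (d - c)"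
    using le by simp
  ultimately show ?thesis
    unfolding eq len
    using integral_abs_bound[of lborel "\<lambda>t. indicator {h..1+h} t * \<phi> t - indicator {0..1} t * \<phi> t"]
    by linarith
qed

text \<open>Splits off the parameters within \<open>\<eta>\<close> of \<open>s\<close>, where only
  the trivial bound \<open>C\<close> is available. It serves for doubled parameters, whose
  difference is useful only away from the diagonal.\<close>

lemma integral_unif_off_diag:
  fixes \<phi> :: "real \<Rightarrow> real"
  assumes C: "\<And>t. t \<in> {0..1} \<Longrightarrow> \<bar>\<phi> t\<bar> \<le> C" and B: "\<And>t. t \<in> {0..1} \<Longrightarrow> \<eta> \<le> \<bar>t - s\<bar> \<Longrightarrow> \<bar>\<phi> t\<bar> \<le> B"
    and "0 \<le> B" "0 \<le> C" "0 \<le> \<eta>"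
  shows "\<bar>\<integral>t. \<phi> t \<partial>unif\<bar> \<le> B + 2 * \<eta> * C"
proof (cases "integrable unif \<phi>")
  case True
  have ind: "integrable unif (indicator {s-\<eta>..s+\<eta>} :: real \<Rightarrow> real)"
    by (rule integrable_real_indicator) (auto simp: less_top[symmetric])
  have "\<bar>\<integral>t. \<phi> t \<partial>unif\<bar> \<le> (\<integral>t. \<bar>\<phi> t\<bar> \<partial>unif)"
    by (rule integral_abs_bound)
  also have "\<dots> \<le> (\<integral>t. B + C * indicator {s-\<eta>..s+\<eta>} t \<partial>unif)"
  proof (intro integral_mono_AE)
    show "AE t in unif. \<bar>\<phi> t\<bar> \<le> B + C * indicator {s-\<eta>..s+\<eta>} t"
      using AE_unif
    proof eventually_elim
      case (elim t)
      then show ?case using C[of t] B[of t] assms(3,4) by (cases "t \<in> {s-\<eta>..s+\<eta>}") (auto simp: abs_if split: if_splits)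
    qed
    show "integrable unif (\<lambda>t. B + C * indicator {s-\<eta>..s+\<eta>} t)"
      by (intro Bochner_Integration.integrable_add integrable_mult_right ind) simp
  qed (use True in auto)
  also have "\<dots> = (\<integral>t. B \<partial>unif) + (\<integral>t. C * indicator {s-\<eta>..s+\<eta>} t \<partial>unif)"
    by (intro Bochner_Integration.integral_add integrable_mult_right ind) simp
  also have "(\<integral>t. B \<partial>unif) = B"
    using unif.prob_space by simp
  also have "(\<integral>t. C * indicator {s-\<eta>..s+\<eta>} t \<partial>unif) = C * unif.prob {s-\<eta>..s+\<eta>}"
    by simp
  finally have le: "\<bar>\<integral>t. \<phi> t \<partial>unif\<bar> \<le> B + C * unif.prob {s-\<eta>..s+\<eta>}" .
  have "unif.prob {s-\<eta>..s+\<eta>} \<le> 2 * \<eta>"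
  proof -
    have "unif.prob {s-\<eta>..s+\<eta>} = (\<integral>t. indicator {s-\<eta>..s+\<eta>} t \<partial>unif)"
      by simp
    also have "\<dots> = (\<integral>t. indicator {0..1} t * indicator {s-\<eta>..s+\<eta>} t \<partial>lborel)"
      by (subst integral_unif) auto
    also have "\<dots> \<le> (\<integral>t. indicator {s-\<eta>..s+\<eta>} t \<partial>lborel)"
    proof (rule integral_mono_AE)
      have e: "indicator {0..1} t * indicator {s-\<eta>..s+\<eta>} t = (indicator ({0..1} \<inter> {s-\<eta>..s+\<eta>}) t :: real)" for t
        by (auto simp: indicator_def)
      show "integrable lborel (\<lambda>t. indicator {0..1} t * indicator {s-\<eta>..s+\<eta>} t :: real)"
        unfolding e Int_atLeastAtMost by simp
      show "integrable lborel (indicator {s-\<eta>..s+\<eta>} :: real \<Rightarrow> real)"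
        by simp
    qed (auto simp: indicator_def)
    also have "\<dots> = 2 * \<eta>" using assms by simp
    finally show ?thesis .
  qed
  from mult_left_mono[OF this, of C] le show ?thesis
    using assms by (simp add: mult_ac)
next
  case False
  then show ?thesis
    using assms by (simp add: not_integrable_integral_eq)
qed

lemma prob_swap:
  fixes \<phi> :: "'a \<Rightarrow> 'b \<Rightarrow> real"
  assumes "prob_space M" "prob_space N"
    and [measurable]: "(\<lambda>(s, t). \<phi> s t) \<in> borel_measurable (M \<Otimes>\<^sub>M N)"
    and "\<And>s t. \<bar>\<phi> s t\<bar> \<le> B"
  shows "(\<integral>s. \<integral>t. \<phi> s t \<partial>N \<partial>M) = (\<integral>t. \<integral>s. \<phi> s t \<partial>M \<partial>N)"
proof -
  interpret pair_prob_space M N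
    using assms(1,2) by (simp add: pair_prob_space_def pair_sigma_finite_def prob_space_imp_sigma_finite)
  have "integrable (M \<Otimes>\<^sub>M N) (\<lambda>(s, t). \<phi> s t)"
    by (intro integrable_bounded[where B = B]) (use assms in auto)
  then show ?thesis
    by (rule Fubini_integral[symmetric])
qed

lemma integrable_translate:
  fixes h :: "'a::euclidean_space \<Rightarrow> real"
  assumes "integrable lborel h"
  shows "integrable lborel (\<lambda>x. h (x + a))"
    and "(\<integral>x. h (x + a) \<partial>lborel) = (\<integral>x. h x \<partial>lborel)"
proof -
  have e: "(lborel :: 'a measure) = distr lborel borel (\<lambda>x. x + a)"
    using lborel_affine[of 1 a] by (simp add: add.commute density_1)
  have [measurable]: "h \<in> borel_measurable borel" using assms by auto
  from assms show "integrable lborel (\<lambda>x. h (x + a))"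
    by (subst (asm) e, subst (asm) integrable_distr_eq) auto
  show "(\<integral>x. h (x + a) \<partial>lborel) = (\<integral>x. h x \<partial>lborel)"
    by (subst (2) e, subst integral_distr) auto
qed

text \<open>Domination of a family of functions by translates of one integrable function is preserved
  by all the substitutions below, so it serves as the uniform integrability condition.\<close>

lemma dominated_fubini:
  fixes H :: "'p \<Rightarrow> 'a::euclidean_space \<Rightarrow> real" and h :: "'a \<Rightarrow> real" and a :: "'p \<Rightarrow> 'a"
  assumes M: "prob_space M"
    and [measurable]: "(\<lambda>(w, x). H w x) \<in> borel_measurable (M \<Otimes>\<^sub>M borel)"
    and h: "integrable lborel h"
    and le: "\<And>w x. \<bar>H w x\<bar> \<le> h (x + a w)"
  shows "w \<in> space M \<Longrightarrow> integrable lborel (H w)"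
    and "integrable lborel (\<lambda>x. \<integral>w. H w x \<partial>M)"
    and "(\<integral>x. \<integral>w. H w x \<partial>M \<partial>lborel) = (\<integral>w. \<integral>x. H w x \<partial>lborel \<partial>M)"
    and "w \<in> space M \<Longrightarrow> \<bar>\<integral>x. H w x \<partial>lborel\<bar> \<le> (\<integral>x. h x \<partial>lborel)"
    and "integrable M (\<lambda>w. \<integral>x. H w x \<partial>lborel)"
proof -
  interpret M: prob_space M by fact
  interpret pair_sigma_finite M "lborel :: 'a measure" ..
  have int: "integrable lborel (H w)" if "w \<in> space M" for w
    by (rule Bochner_Integration.integrable_bound[OF integrable_translate(1)[OF h, of "a w"]])
       (use that in \<open>auto intro!: AE_I2 order_trans[OF le abs_ge_self]\<close>)
  have le': "(\<integral>x. \<bar>H w x\<bar> \<partial>lborel) \<le> (\<integral>x. h x \<partial>lborel)" if "w \<in> space M" for w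
  proof -
    have "(\<integral>x. \<bar>H w x\<bar> \<partial>lborel) \<le> (\<integral>x. h (x + a w) \<partial>lborel)"
      using int[OF that] le integrable_translate(1)[OF h] by (intro integral_mono) auto
    then show ?thesis
      using integrable_translate(2)[OF h] by simp
  qed
  have prod: "integrable (M \<Otimes>\<^sub>M lborel) (\<lambda>(w, x). H w x)"
  proof (rule Fubini_integrable)
    show "integrable M (\<lambda>w. \<integral>x. norm (case (w, x) of (w, x) \<Rightarrow> H w x) \<partial>lborel)"
    proof (rule M.integrable_bounded[where B = "\<integral>x. h x \<partial>lborel"])
      show "\<bar>\<integral>x. norm (case (w, x) of (w, x) \<Rightarrow> H w x) \<partial>lborel\<bar> \<le> (\<integral>x. h x \<partial>lborel)"
        if "w \<in> space M" for w
        using le'[OF that] by (simp add: integral_nonneg_AE)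
    qed simp
    show "AE w in M. integrable lborel (\<lambda>x. case (w, x) of (w, x) \<Rightarrow> H w x)"
      using int by (auto intro: AE_I2)
  qed simp
  show "w \<in> space M \<Longrightarrow> integrable lborel (H w)"
    by (rule int)
  show "integrable lborel (\<lambda>x. \<integral>w. H w x \<partial>M)"
    using integrable_snd[OF prod] by simp
  show "(\<integral>x. \<integral>w. H w x \<partial>M \<partial>lborel) = (\<integral>w. \<integral>x. H w x \<partial>lborel \<partial>M)"
    using Fubini_integral[OF prod] by simp
  show "w \<in> space M \<Longrightarrow> \<bar>\<integral>x. H w x \<partial>lborel\<bar> \<le> (\<integral>x. h x \<partial>lborel)"
    using le'[of w] integral_abs_bound[of lborel "H w"] by linarith
  show "integrable M (\<lambda>w. \<integral>x. H w x \<partial>lborel)"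
    using integrable_fst[OF prod] by simp
qed

section \<open>Differences of points on a curve\<close>

text \<open>Integration by parts in place of continuity of \<open>F\<close>: with \<open>G\<close>
  an antiderivative of \<open>F\<close>, the quotient
  \<open>(G (\<psi> s) - G (\<theta> s)) / \<theta>' s\<close> has derivative
  \<open>F (\<psi> s) - F (\<theta> s)\<close> up to terms controlled by the distance of
  \<open>\<psi>\<close> from \<open>\<theta>\<close> in position and velocity. Only the 1-Lipschitz
  bound for \<open>G\<close> enters, so the estimate is blind to how fast \<open>F\<close>
  oscillates.\<close>

lemma integral_comp_perturb:
  fixes F \<psi> \<psi>' \<theta> \<theta>' \<theta>'' :: "real \<Rightarrow> real"
  assumes F: "continuous_on UNIV F" "\<And>k. \<bar>F k\<bar> \<le> 1"
    and \<psi>: "\<And>s. s \<in> {0..1} \<Longrightarrow> (\<psi> has_real_derivative \<psi>' s) (at s)"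
    and \<theta>: "\<And>s. s \<in> {0..1} \<Longrightarrow> (\<theta> has_real_derivative \<theta>' s) (at s)"
    and \<theta>': "\<And>s. s \<in> {0..1} \<Longrightarrow> (\<theta>' has_real_derivative \<theta>'' s) (at s)"
    and m: "0 < m" "\<And>s. s \<in> {0..1} \<Longrightarrow> m \<le> \<bar>\<theta>' s\<bar>"
    and M: "\<And>s. s \<in> {0..1} \<Longrightarrow> \<bar>\<theta>'' s\<bar> \<le> M"
    and d0: "\<And>s. s \<in> {0..1} \<Longrightarrow> \<bar>\<psi> s - \<theta> s\<bar> \<le> d0"
    and d1: "\<And>s. s \<in> {0..1} \<Longrightarrow> \<bar>\<psi>' s - \<theta>' s\<bar> \<le> d1"
  shows "\<bar>integral {0..1} (\<lambda>s. F (\<psi> s)) - integral {0..1} (\<lambda>s. F (\<theta> s))\<bar>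
    \<le> d0 * (2 / m + M / m\<^sup>2) + d1 / m" (is "?I \<le> _")
proof -
  have cont: "continuous_on {0..1} \<psi>" "continuous_on {0..1} \<theta>"
    using \<psi> \<theta> by (meson DERIV_continuous_on has_field_derivative_at_within)+
  have "bounded (\<psi> ` {0..1} \<union> \<theta> ` {0..1})"
    using cont by (intro compact_imp_bounded compact_Un compact_continuous_image) auto
  then obtain R where "\<And>y. y \<in> \<psi> ` {0..1} \<union> \<theta> ` {0..1} \<Longrightarrow> \<bar>y\<bar> < R"
    by (auto simp: bounded_pos_less)
  then have R: "\<bar>\<psi> s\<bar> < R \<and> \<bar>\<theta> s\<bar> < R" if "s \<in> {0..1}" for s
    using that by blast
  obtain G where G: "\<And>k. k \<in> {-R..R} \<Longrightarrow> (G has_vector_derivative F k) (at k within {-R..R})"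
    using antiderivative_continuous[of "-R" R F] F(1) continuous_on_subset by blast
  have G': "(G has_real_derivative F k) (at k)" if "\<bar>k\<bar> < R" for k
  proof -
    have "-R < k" "k < R" using that by auto
    then show ?thesis
      using G[of k] at_within_Icc_at[of "-R" k R]
      by (auto simp: has_real_derivative_iff_has_vector_derivative)
  qed
  have lip: "\<bar>G a - G b\<bar> \<le> \<bar>a - b\<bar>" if "\<bar>a\<bar> < R" "\<bar>b\<bar> < R" for a b
  proof -
    have "norm (G a - G b) \<le> 1 * norm (a - b)"
      using that F(2)
      by (intro field_differentiable_bound[of "{-R<..<R}" G F 1])
         (auto intro!: has_field_derivative_at_within[OF G'])
    then show ?thesis by simp
  qed
  define D where "D s = G (\<psi> s) - G (\<theta> s)" for s
  have D: "\<bar>D s\<bar> \<le> d0" if "s \<in> {0..1}" for s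
    using lip[of "\<psi> s" "\<theta> s"] R[OF that] d0[OF that] by (simp add: D_def)
  have nz: "\<theta>' s \<noteq> 0" if "s \<in> {0..1}" for s
    using m(1) m(2)[OF that] by auto
  have d0_nonneg: "0 \<le> d0" and d1_nonneg: "0 \<le> d1" and M_nonneg: "0 \<le> M"
    using d0[of 0] d1[of 0] M[of 0] by auto
  define R1 where "R1 s = F (\<psi> s) * (1 - \<psi>' s / \<theta>' s) + D s * \<theta>'' s / (\<theta>' s)\<^sup>2" for s
  have der: "((\<lambda>s. D s / \<theta>' s) has_real_derivative (F (\<psi> s) - F (\<theta> s) - R1 s)) (at s)"
    if "s \<in> {0..1}" for s
  proof -
    have "((\<lambda>s. G (\<psi> s)) has_real_derivative F (\<psi> s) * \<psi>' s) (at s)"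
      using R[OF that] \<psi>[OF that] by (intro DERIV_chain2[OF G']) auto
    moreover have "((\<lambda>s. G (\<theta> s)) has_real_derivative F (\<theta> s) * \<theta>' s) (at s)"
      using R[OF that] \<theta>[OF that] by (intro DERIV_chain2[OF G']) auto
    ultimately have "(D has_real_derivative F (\<psi> s) * \<psi>' s - F (\<theta> s) * \<theta>' s) (at s)"
      unfolding D_def by (rule DERIV_diff)
    from DERIV_divide[OF this \<theta>'[OF that] nz[OF that]]
    show ?thesis
      using nz[OF that] by (auto simp: R1_def field_simps power2_eq_square elim!: DERIV_cong)
  qed
  have int: "(\<lambda>s. F (\<psi> s)) integrable_on {0..1}" "(\<lambda>s. F (\<theta> s)) integrable_on {0..1}"
    using cont by (auto intro!: integrable_continuous_real continuous_on_compose2[OF F(1)])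
  have FTC: "((\<lambda>s. F (\<psi> s) - F (\<theta> s) - R1 s) has_integral (D 1 / \<theta>' 1 - D 0 / \<theta>' 0)) {0..1}"
    using der by (intro fundamental_theorem_of_calculus)
      (auto simp: has_real_derivative_iff_has_vector_derivative[symmetric] intro: has_field_derivative_at_within)
  have "((\<lambda>s. (F (\<psi> s) - F (\<theta> s)) - (F (\<psi> s) - F (\<theta> s) - R1 s)) has_integral
      (integral {0..1} (\<lambda>s. F (\<psi> s)) - integral {0..1} (\<lambda>s. F (\<theta> s))) - (D 1 / \<theta>' 1 - D 0 / \<theta>' 0)) {0..1}"
    by (intro has_integral_diff FTC integrable_integral int)
  then have R1: "(R1 has_integral
      (integral {0..1} (\<lambda>s. F (\<psi> s)) - integral {0..1} (\<lambda>s. F (\<theta> s))) - (D 1 / \<theta>' 1 - D 0 / \<theta>' 0)) {0..1}"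
    by simp
  have R1b: "\<bar>R1 s\<bar> \<le> d1 / m + d0 * M / m\<^sup>2" if "s \<in> {0..1}" for s
  proof -
    have "F (\<psi> s) * (1 - \<psi>' s / \<theta>' s) = F (\<psi> s) * ((\<theta>' s - \<psi>' s) / \<theta>' s)"
      using nz[OF that] by (simp add: field_simps)
    also have "\<bar>\<dots>\<bar> \<le> 1 * (d1 / m)"
      unfolding abs_mult abs_divide
      using d1[OF that] m(1) m(2)[OF that] F(2) by (intro mult_mono frac_le) (auto simp: abs_minus_commute)
    finally have 1: "\<bar>F (\<psi> s) * (1 - \<psi>' s / \<theta>' s)\<bar> \<le> d1 / m" by simp
    have "m\<^sup>2 \<le> \<bar>\<theta>' s\<bar>\<^sup>2"
      using m(1) m(2)[OF that] by (intro power_mono) auto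
    then have "\<bar>D s * \<theta>'' s / (\<theta>' s)\<^sup>2\<bar> \<le> d0 * M / m\<^sup>2"
      unfolding abs_mult abs_divide
      using D[OF that] M[OF that] m(1) d0_nonneg M_nonneg by (intro frac_le mult_mono) auto
    with 1 show ?thesis
      unfolding R1_def by linarith
  qed
  have main: "\<bar>(integral {0..1} (\<lambda>s. F (\<psi> s)) - integral {0..1} (\<lambda>s. F (\<theta> s))) - (D 1 / \<theta>' 1 - D 0 / \<theta>' 0)\<bar>
      \<le> d1 / m + d0 * M / m\<^sup>2"
    using has_integral_bound_real[OF _ finite.emptyI R1, of "d1 / m + d0 * M / m\<^sup>2"] R1b m(1) d0_nonneg d1_nonneg M_nonneg
    by simp
  have "\<bar>D s / \<theta>' s\<bar> \<le> d0 / m" if "s \<in> {0..1}" for s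
    unfolding abs_divide using D[OF that] m(1) m(2)[OF that] d0_nonneg by (intro frac_le) auto
  note bd = this
  have "\<bar>D 1 / \<theta>' 1 - D 0 / \<theta>' 0\<bar> \<le> 2 * (d0 / m)"
    using bd[of 0, unfolded atLeastAtMost_iff] bd[of 1, unfolded atLeastAtMost_iff] by linarith
  then have "?I \<le> 2 * (d0 / m) + (d1 / m + d0 * M / m\<^sup>2)"
    using main by linarith
  then show ?thesis
    by (simp add: algebra_simps)
qed

text \<open>
  The shift in the first coordinate is absorbed by translating \<open>t\<close> by \<open>w1 / \<mu>\<close>. Translating \<open>t\<close> and \<open>t'\<close>
  simultaneously by a small \<open>s\<close> leaves the first coordinate unchanged, while off the diagonal the second
  one moves with speed \<open>\<phi>' t - \<phi>' t'\<close> bounded away from zero; averaging over \<open>s\<close> then absorbs the rest.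
\<close>

lemma curve_difference_shift:
  fixes F :: "real \<times> real \<Rightarrow> real" and \<phi> \<phi>' \<phi>'' :: "real \<Rightarrow> real"
  assumes F: "continuous_on UNIV F" "\<And>x. \<bar>F x\<bar> \<le> 1"
    and \<phi>: "continuous_on UNIV \<phi>"
    and d\<phi>: "\<And>t. t \<in> {-1/2..2} \<Longrightarrow> (\<phi> has_real_derivative \<phi>' t) (at t)"
    and d\<phi>': "\<And>t. t \<in> {-1/2..2} \<Longrightarrow> (\<phi>' has_real_derivative \<phi>'' t) (at t)"
    and M: "\<And>t. t \<in> {-1/2..2} \<Longrightarrow> \<bar>\<phi>' t\<bar> \<le> M" "\<And>t. t \<in> {-1/2..2} \<Longrightarrow> \<bar>\<phi>'' t\<bar> \<le> M"
    and m: "\<And>t t'. t \<in> {-1/2..2} \<Longrightarrow> t' \<in> {-1/2..2} \<Longrightarrow> m * \<bar>t - t'\<bar> \<le> \<bar>\<phi>' t - \<phi>' t'\<bar>"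
    and \<mu>: "m \<le> \<bar>\<mu>\<bar>" and "0 < m" "m \<le> 1" "1 \<le> M" "0 < \<kappa>" "\<kappa> \<le> 1"
    and w: "\<bar>w1\<bar> \<le> \<kappa>^3 * m^3 / (100000 * M\<^sup>2)" "\<bar>w2\<bar> \<le> \<kappa>^3 * m^3 / (100000 * M\<^sup>2)"
  shows "\<bar>\<integral>t. \<integral>t'. F (\<mu> * (t - t') + w1, \<phi> t - \<phi> t' + w2) - F (\<mu> * (t - t'), \<phi> t - \<phi> t') \<partial>unif \<partial>unif\<bar> \<le> \<kappa>"
proof -
  have [measurable]: "F \<in> borel_measurable borel" "\<phi> \<in> borel_measurable borel"
    using F(1) \<phi> by (auto intro: borel_measurable_continuous_onI)
  define \<rho> where "\<rho> = \<kappa>^3 * m^3 / (100000 * M\<^sup>2)"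
  define \<omega> where "\<omega> = w1 / \<mu>"
  \<comment> \<open>Length of the simultaneous translation and width of the discarded diagonal. The
    costs are \<open>8 * e\<close> for translating, \<open>4 * e\<close> for the diagonal and
    \<open>\<kappa> / 4\<close> off it, together \<open>5/8 * \<kappa>\<close>; the rest leaves room
    for \<open>2 * \<bar>\<omega>\<bar>\<close>.\<close>
  define e where "e = \<kappa> / 32"
  have e: "0 < e" "e \<le> 1/32" using assms by (auto simp: e_def)
  have "\<mu> \<noteq> 0" using \<mu> \<open>0 < m\<close> by auto
  have \<rho>0: "0 \<le> \<rho>" using assms by (auto simp: \<rho>_def)
  have MM: "M \<le> M\<^sup>2" using \<open>1 \<le> M\<close> by (simp add: power2_eq_square)
  have \<rho>M: "M\<^sup>2 * \<rho> = \<kappa>^3 * m^3 / 100000"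
    using assms by (simp add: \<rho>_def)
  have M\<rho>: "M * \<rho> \<le> \<kappa>^3 * m^3 / 100000"
    using mult_right_mono[OF MM \<rho>0] \<rho>M by simp
  have \<rho>1: "\<rho> \<le> \<kappa>^3 * m^3 / 100000"
    using M\<rho> mult_right_mono[OF \<open>1 \<le> M\<close> \<rho>0] by simp
  have \<omega>: "\<bar>\<omega>\<bar> * m \<le> \<rho>"
  proof -
    have "\<bar>\<omega>\<bar> * m \<le> \<bar>\<omega>\<bar> * \<bar>\<mu>\<bar>" using \<mu> by (intro mult_left_mono) auto
    also have "\<dots> = \<bar>w1\<bar>" using \<open>\<mu> \<noteq> 0\<close> by (simp add: \<omega>_def abs_divide)
    finally show ?thesis using w by (simp add: \<rho>_def)
  qed
  have \<omega>': "\<bar>\<omega>\<bar> \<le> \<kappa>^3 * m^2 / 100000"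
  proof -
    have "\<bar>\<omega>\<bar> * m \<le> (\<kappa>^3 * m^2 / 100000) * m" using \<omega> \<rho>1 by (simp add: power2_eq_square power3_eq_cube)
    then show ?thesis using \<open>0 < m\<close> by (rule mult_right_le_imp_le)
  qed
  have \<kappa>m: "\<kappa>^3 * m^2 \<le> \<kappa> * m"
    using assms by (intro mult_mono) (auto simp: power3_eq_cube power2_eq_square mult_le_one intro: mult_left_le)
  have "\<kappa> * m \<le> \<kappa>" using assms by (simp add: mult_left_le)
  define K1 where "K1 t t' = F (\<mu> * (t - t') + w1, \<phi> t - \<phi> t' + w2)" for t t'
  \<comment> \<open>\<open>K2\<close> carries the shift \<open>w1\<close> inside the parameter: its
    first coordinate agrees with that of \<open>K\<close>, and only the second one is perturbed, by
    \<open>\<omega>\<close> and \<open>w2\<close>.\<close>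
  define K2 where "K2 t t' = F (\<mu> * (t - t'), \<phi> (t - \<omega>) - \<phi> t' + w2)" for t t'
  define K where "K t t' = F (\<mu> * (t - t'), \<phi> t - \<phi> t')" for t t'
  have K12: "K1 t t' = K2 (t + \<omega>) t'" for t t'
  proof -
    have "\<mu> * (t + \<omega> - t') = \<mu> * (t - t') + w1"
      using \<open>\<mu> \<noteq> 0\<close> by (simp add: \<omega>_def algebra_simps)
    then show ?thesis by (simp add: K1_def K2_def)
  qed
  have [measurable]: "(\<lambda>(t, t'). K t t') \<in> borel_measurable (borel \<Otimes>\<^sub>M borel)"
     "(\<lambda>(t, t'). K1 t t') \<in> borel_measurable (borel \<Otimes>\<^sub>M borel)"
     "(\<lambda>(t, t'). K2 t t') \<in> borel_measurable (borel \<Otimes>\<^sub>M borel)"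
    unfolding K_def K1_def K2_def by measurable
  have bd: "\<bar>K t t'\<bar> \<le> 1" "\<bar>K1 t t'\<bar> \<le> 1" "\<bar>K2 t t'\<bar> \<le> 1" for t t'
    unfolding K_def K1_def K2_def by (rule F(2))+
  have int: "integrable unif (\<lambda>t'. K t t')" "integrable unif (\<lambda>t'. K1 t t')" "integrable unif (\<lambda>t'. K2 t t')" for t
    by (rule integrable_unif[where B = 1]; use bd in measurable)+
  have bd': "\<bar>\<integral>t'. K t t' \<partial>unif\<bar> \<le> 1" "\<bar>\<integral>t'. K1 t t' \<partial>unif\<bar> \<le> 1" "\<bar>\<integral>t'. K2 t t' \<partial>unif\<bar> \<le> 1" for t
    using bd by (auto intro: abs_integral_le_unif)
  have int': "integrable unif (\<lambda>t. \<integral>t'. K t t' \<partial>unif)" "integrable unif (\<lambda>t. \<integral>t'. K1 t t' \<partial>unif)"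
      "integrable unif (\<lambda>t. \<integral>t'. K2 t t' \<partial>unif)"
    by (rule integrable_unif[where B = 1]; use bd' in measurable)+
  define H where "H t t' = K2 t t' - K t t'" for t t'
  have [measurable]: "(\<lambda>(t, t'). H t t') \<in> borel_measurable (borel \<Otimes>\<^sub>M borel)"
    unfolding H_def by measurable
  have bdH: "\<bar>H t t'\<bar> \<le> 2" for t t' unfolding H_def using bd[of t t'] by linarith
  have I12: "\<bar>(\<integral>t. \<integral>t'. K1 t t' \<partial>unif \<partial>unif) - (\<integral>t. \<integral>t'. K2 t t' \<partial>unif \<partial>unif)\<bar> \<le> 2 * \<bar>\<omega>\<bar>"
    unfolding K12 using integral_unif_shift[of "\<lambda>t. \<integral>t'. K2 t t' \<partial>unif" 1 \<omega>] bd' by simp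
  have diag: "\<bar>(\<integral>t. \<integral>t'. H t t' \<partial>unif \<partial>unif) - (\<integral>t. \<integral>t'. H (t + e * s) (t' + e * s) \<partial>unif \<partial>unif)\<bar> \<le> 8 * e"
    if s: "s \<in> {0..1}" for s
  proof -
    define h where "h = e * s"
    have h: "\<bar>h\<bar> \<le> e" using s e by (auto simp: h_def mult_left_le)
    have "\<bar>(\<integral>t. \<integral>t'. H (t + h) t' \<partial>unif \<partial>unif) - (\<integral>t. \<integral>t'. H t t' \<partial>unif \<partial>unif)\<bar> \<le> 2 * 2 * \<bar>h\<bar>"
      using bdH by (intro integral_unif_shift[of "\<lambda>t. \<integral>t'. H t t' \<partial>unif"] abs_integral_le_unif) auto
    moreover have "\<bar>\<integral>t. (\<integral>t'. H (t + h) (t' + h) \<partial>unif) - (\<integral>t'. H (t + h) t' \<partial>unif) \<partial>unif\<bar> \<le> 2 * 2 * \<bar>h\<bar>"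
      using bdH by (intro abs_integral_le_unif integral_unif_shift[of "\<lambda>t'. H (_ + h) t'"]) auto
    moreover have "integrable unif (\<lambda>t. \<integral>t'. H (t + h) (t' + h) \<partial>unif)" "integrable unif (\<lambda>t. \<integral>t'. H (t + h) t' \<partial>unif)"
      by (rule integrable_unif[where B = 2]; (intro abs_integral_le_unif bdH)?; simp)+
    ultimately show ?thesis
      unfolding h_def[symmetric] using h by (simp add: abs_if split: if_splits)
  qed
  have swap: "(\<integral>s. \<integral>t. \<integral>t'. H (t + e * s) (t' + e * s) \<partial>unif \<partial>unif \<partial>unif)
      = (\<integral>t. \<integral>t'. \<integral>s. H (t + e * s) (t' + e * s) \<partial>unif \<partial>unif \<partial>unif)"
  proof -
    have "(\<integral>s. \<integral>t. \<integral>t'. H (t + e * s) (t' + e * s) \<partial>unif \<partial>unif \<partial>unif)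
      = (\<integral>t. \<integral>s. \<integral>t'. H (t + e * s) (t' + e * s) \<partial>unif \<partial>unif \<partial>unif)"
      using bdH by (intro prob_swap[where B = 2] prob_space_unif abs_integral_le_unif) auto
    also have "\<dots> = (\<integral>t. \<integral>t'. \<integral>s. H (t + e * s) (t' + e * s) \<partial>unif \<partial>unif \<partial>unif)"
      using bdH by (intro Bochner_Integration.integral_cong prob_swap[where B = 2] prob_space_unif) auto
    finally show ?thesis .
  qed
  \<comment> \<open>The speed of the second coordinate in \<open>s\<close> is at least
    \<open>e * (m * e)\<close>: one factor \<open>e\<close> comes from the chain rule, the other
    from the separation of \<open>t\<close> and \<open>t'\<close>.\<close>
  have inner: "\<bar>\<integral>s. H (t + e * s) (t' + e * s) \<partial>unif\<bar> \<le> \<kappa> / 4"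
    if t: "t \<in> {0..1}" "t' \<in> {0..1}" "e \<le> \<bar>t' - t\<bar>" for t t'
  proof -
    define \<theta> \<psi> \<theta>' \<psi>' \<theta>'' where "\<theta> s = \<phi> (t + e * s) - \<phi> (t' + e * s)"
      and "\<psi> s = \<phi> (t - \<omega> + e * s) - \<phi> (t' + e * s) + w2"
      and "\<theta>' s = e * (\<phi>' (t + e * s) - \<phi>' (t' + e * s))"
      and "\<psi>' s = e * (\<phi>' (t - \<omega> + e * s) - \<phi>' (t' + e * s))"
      and "\<theta>'' s = e\<^sup>2 * (\<phi>'' (t + e * s) - \<phi>'' (t' + e * s))" for s
    have rng: "t + e * s \<in> {-1/2..2}" "t' + e * s \<in> {-1/2..2}" "t - \<omega> + e * s \<in> {-1/2..2}" if "s \<in> {0..1}" for s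
    proof -
      have "0 \<le> e * s" "e * s \<le> e" using that e by (auto simp: mult_left_le)
      moreover have "\<bar>\<omega>\<bar> \<le> 1/32" using \<omega>' \<kappa>m \<open>\<kappa> * m \<le> \<kappa>\<close> \<open>\<kappa> \<le> 1\<close> by linarith
      moreover have "0 \<le> t" "t \<le> 1" "0 \<le> t'" "t' \<le> 1" using t by auto
      ultimately show "t + e * s \<in> {-1/2..2}" "t' + e * s \<in> {-1/2..2}" "t - \<omega> + e * s \<in> {-1/2..2}"
        using e unfolding atLeastAtMost_iff by linarith+
    qed
    have lip: "\<bar>\<phi> a - \<phi> b\<bar> \<le> M * \<bar>a - b\<bar>" "\<bar>\<phi>' a - \<phi>' b\<bar> \<le> M * \<bar>a - b\<bar>"
      if "a \<in> {-1/2..2}" "b \<in> {-1/2..2}" for a b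
    proof -
      have "norm (\<phi> a - \<phi> b) \<le> M * norm (a - b)"
        by (rule field_differentiable_bound[of "{-1/2..2}" _ \<phi>'])
           (use that M in \<open>auto intro!: has_field_derivative_at_within[OF d\<phi>]\<close>)
      moreover have "norm (\<phi>' a - \<phi>' b) \<le> M * norm (a - b)"
        by (rule field_differentiable_bound[of "{-1/2..2}" _ \<phi>''])
           (use that M in \<open>auto intro!: has_field_derivative_at_within[OF d\<phi>']\<close>)
      ultimately show "\<bar>\<phi> a - \<phi> b\<bar> \<le> M * \<bar>a - b\<bar>" "\<bar>\<phi>' a - \<phi>' b\<bar> \<le> M * \<bar>a - b\<bar>"
        by auto
    qed
    define d0 where "d0 = M * \<bar>\<omega>\<bar> + \<bar>w2\<bar>"
    define F1 where "F1 k = F (\<mu> * (t - t'), k)" for k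
    have F1: "continuous_on UNIV F1"
      unfolding F1_def by (intro continuous_on_compose2[OF F(1)] continuous_intros) auto
    have cF: "continuous_on UNIV (\<lambda>s. F1 (\<theta> s))" "continuous_on UNIV (\<lambda>s. F1 (\<psi> s))"
      unfolding \<theta>_def \<psi>_def
      by (intro continuous_on_compose2[OF F1] continuous_intros continuous_on_compose2[OF \<phi>]; simp)+
    have "\<bar>integral {0..1} (\<lambda>s. F1 (\<psi> s)) - integral {0..1} (\<lambda>s. F1 (\<theta> s))\<bar>
      \<le> d0 * (2 / (e * (m * e)) + 2 * M * e\<^sup>2 / (e * (m * e))\<^sup>2) + (e * (M * \<bar>\<omega>\<bar>)) / (e * (m * e))"
    proof (rule integral_comp_perturb[where F = F1 and \<psi> = \<psi> and \<theta> = \<theta> and \<theta>' = \<theta>' and \<psi>' = \<psi>' and \<theta>'' = \<theta>''])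
      fix s :: real assume s: "s \<in> {0..1}"
      note rng = rng[OF s]
      have ch: "((\<lambda>s. \<phi> (c + e * s)) has_real_derivative \<phi>' (c + e * s) * e) (at s)"
        "((\<lambda>s. \<phi>' (c + e * s)) has_real_derivative \<phi>'' (c + e * s) * e) (at s)"
        if "c + e * s \<in> {-1/2..2}" for c
      proof -
        have g: "((\<lambda>s. c + e * s) has_real_derivative e) (at s)"
          by (auto intro!: derivative_eq_intros)
        show "((\<lambda>s. \<phi> (c + e * s)) has_real_derivative \<phi>' (c + e * s) * e) (at s)"
          by (rule DERIV_chain2[where f = \<phi> and g = "\<lambda>s. c + e * s", OF d\<phi>[OF that] g])
        show "((\<lambda>s. \<phi>' (c + e * s)) has_real_derivative \<phi>'' (c + e * s) * e) (at s)"
          by (rule DERIV_chain2[where f = \<phi>' and g = "\<lambda>s. c + e * s", OF d\<phi>'[OF that] g])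
      qed
      show "(\<psi> has_real_derivative \<psi>' s) (at s)"
        unfolding \<psi>_def \<psi>'_def
        by (rule DERIV_cong[OF DERIV_add[OF DERIV_diff[OF ch(1)[OF rng(3)] ch(1)[OF rng(2)]] DERIV_const]])
           (simp add: algebra_simps)
      show "(\<theta> has_real_derivative \<theta>' s) (at s)"
        unfolding \<theta>_def \<theta>'_def
        by (rule DERIV_cong[OF DERIV_diff[OF ch(1)[OF rng(1)] ch(1)[OF rng(2)]]]) (simp add: algebra_simps)
      show "(\<theta>' has_real_derivative \<theta>'' s) (at s)"
        unfolding \<theta>'_def \<theta>''_def
        by (rule DERIV_cong[OF DERIV_cmult[OF DERIV_diff[OF ch(2)[OF rng(1)] ch(2)[OF rng(2)]]]])
           (simp add: algebra_simps power2_eq_square)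
      have "m * e \<le> m * \<bar>t - t'\<bar>" using t \<open>0 < m\<close> by (intro mult_left_mono) auto
      also have "\<dots> \<le> \<bar>\<phi>' (t + e * s) - \<phi>' (t' + e * s)\<bar>" using m[OF rng(1,2)] by simp
      finally show "e * (m * e) \<le> \<bar>\<theta>' s\<bar>" using e by (simp add: \<theta>'_def abs_mult)
      have "\<bar>\<phi>'' (t + e * s) - \<phi>'' (t' + e * s)\<bar> \<le> 2 * M" using M(2)[OF rng(1)] M(2)[OF rng(2)] by linarith
      then have "e\<^sup>2 * \<bar>\<phi>'' (t + e * s) - \<phi>'' (t' + e * s)\<bar> \<le> e\<^sup>2 * (2 * M)"
        by (intro mult_left_mono) auto
      then show "\<bar>\<theta>'' s\<bar> \<le> 2 * M * e\<^sup>2" by (simp add: \<theta>''_def abs_mult mult_ac)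
      show "\<bar>\<psi> s - \<theta> s\<bar> \<le> d0"
        unfolding \<psi>_def \<theta>_def d0_def using lip(1)[OF rng(3,1)] by simp
      have "\<bar>e * (\<phi>' (t - \<omega> + e * s) - \<phi>' (t + e * s))\<bar> \<le> e * (M * \<bar>\<omega>\<bar>)"
        using lip(2)[OF rng(3,1)] e by (simp add: abs_mult)
      then show "\<bar>\<psi>' s - \<theta>' s\<bar> \<le> e * (M * \<bar>\<omega>\<bar>)"
        unfolding \<psi>'_def \<theta>'_def by (simp add: algebra_simps)
    qed (use F1 F e \<open>0 < m\<close> in \<open>auto simp: F1_def\<close>)
    \<comment> \<open>The second-derivative term decides: it is
      \<open>2 * d0 * M / (m * e)\<^sup>2\<close> with \<open>d0 * m\<close> at most
      \<open>2 * M * \<rho>\<close>, so with \<open>e\<close> of order \<open>\<kappa>\<close> it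
      needs \<open>\<rho>\<close> of order \<open>\<kappa>^3 * m^3 / M\<^sup>2\<close>. That is
      where the hypothesis on \<open>w1\<close> and \<open>w2\<close> comes from.\<close>
    also have "\<dots> \<le> \<kappa> / 4"
    proof -
      have M\<omega>: "M * \<bar>\<omega>\<bar> * m \<le> M * \<rho>"
        using mult_left_mono[OF \<omega>, of M] \<open>1 \<le> M\<close> by (simp add: mult_ac)
      have w2: "\<bar>w2\<bar> \<le> \<rho>" using w by (simp add: \<rho>_def)
      have "\<bar>w2\<bar> * m \<le> \<rho>" using mult_left_le[of m "\<bar>w2\<bar>"] w2 \<open>m \<le> 1\<close> by linarith
      also have "\<dots> \<le> M * \<rho>" using mult_right_mono[OF \<open>1 \<le> M\<close> \<rho>0] by simp
      finally have d0m: "d0 * m \<le> 2 * (M * \<rho>)"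
        using M\<omega> by (simp add: d0_def algebra_simps)
      have d0: "0 \<le> d0" using \<open>1 \<le> M\<close> by (simp add: d0_def)
      have d0M: "d0 * M * m \<le> 2 * (M\<^sup>2 * \<rho>)"
        using mult_right_mono[OF d0m, of M] \<open>1 \<le> M\<close> by (simp add: mult_ac power2_eq_square)
      have A: "d0 * (2 / (e * (m * e))) \<le> \<kappa> / 20"
      proof -
        have "d0 * 2 * m \<le> 4 * (\<kappa>^3 * m^3 / 100000)" using d0m M\<rho> by linarith
        also have "\<dots> \<le> 4 * (\<kappa>^3 * m^2 / 100000)" using assms by (simp add: power_decreasing)
        also have "\<dots> \<le> \<kappa> / 20 * (e * (m * e)) * m"
          using assms by (simp add: e_def power2_eq_square power3_eq_cube)
        finally have "d0 * 2 \<le> \<kappa> / 20 * (e * (m * e))" using \<open>0 < m\<close> by (rule mult_right_le_imp_le)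
        then show ?thesis using e \<open>0 < m\<close> by (simp add: pos_divide_le_eq)
      qed
      have B: "d0 * (2 * M * e\<^sup>2 / (e * (m * e))\<^sup>2) \<le> \<kappa> / 20"
      proof -
        have "d0 * (2 * M) * m \<le> 4 * (\<kappa>^3 * m^3 / 100000)" using d0M \<rho>M by linarith
        also have "\<dots> \<le> \<kappa> / 20 * (m * e)\<^sup>2 * m"
          using assms by (simp add: e_def power2_eq_square power3_eq_cube)
        finally have "d0 * (2 * M) \<le> \<kappa> / 20 * (m * e)\<^sup>2" using \<open>0 < m\<close> by (rule mult_right_le_imp_le)
        then have "d0 * (2 * M / (m * e)\<^sup>2) \<le> \<kappa> / 20" using e \<open>0 < m\<close> by (simp add: pos_divide_le_eq)
        moreover have "2 * M * e\<^sup>2 / (e * (m * e))\<^sup>2 = 2 * M / (m * e)\<^sup>2"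
          using e by (simp add: power_mult_distrib)
        ultimately show ?thesis by simp
      qed
      have C: "(e * (M * \<bar>\<omega>\<bar>)) / (e * (m * e)) \<le> \<kappa> / 20"
      proof -
        have "M * \<bar>\<omega>\<bar> * m \<le> \<kappa>^3 * m^3 / 100000" using M\<omega> M\<rho> by linarith
        also have "\<dots> \<le> \<kappa>^2 * m^2 / 100000" using assms by (intro divide_right_mono mult_mono power_decreasing) auto
        also have "\<dots> \<le> \<kappa> / 20 * (m * e) * m"
          using assms by (simp add: e_def power2_eq_square)
        finally have "M * \<bar>\<omega>\<bar> \<le> \<kappa> / 20 * (m * e)" using \<open>0 < m\<close> by (rule mult_right_le_imp_le)
        then have "M * \<bar>\<omega>\<bar> / (m * e) \<le> \<kappa> / 20" using e \<open>0 < m\<close> by (simp add: pos_divide_le_eq)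
        then show ?thesis using e by simp
      qed
      show ?thesis
        unfolding distrib_left using A B C \<open>0 < \<kappa>\<close> by linarith
    qed
    finally have "\<bar>integral {0..1} (\<lambda>s. F1 (\<psi> s)) - integral {0..1} (\<lambda>s. F1 (\<theta> s))\<bar> \<le> \<kappa> / 4" .
    moreover have "(\<integral>s. F1 (\<psi> s) - F1 (\<theta> s) \<partial>unif) = integral {0..1} (\<lambda>s. F1 (\<psi> s) - F1 (\<theta> s))"
      using cF by (intro integral_unif_continuous continuous_intros)
    moreover have "\<dots> = integral {0..1} (\<lambda>s. F1 (\<psi> s)) - integral {0..1} (\<lambda>s. F1 (\<theta> s))"
      by (intro Henstock_Kurzweil_Integration.integral_diff integrable_continuous_real continuous_on_subset[OF cF(1)] continuous_on_subset[OF cF(2)]) auto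
    moreover have "H (t + e * s) (t' + e * s) = F1 (\<psi> s) - F1 (\<theta> s)" for s
      by (simp add: H_def K2_def K_def F1_def \<psi>_def \<theta>_def algebra_simps)
    ultimately show ?thesis by simp
  qed
  have bulk: "\<bar>\<integral>t. \<integral>t'. \<integral>s. H (t + e * s) (t' + e * s) \<partial>unif \<partial>unif \<partial>unif\<bar> \<le> \<kappa> / 4 + 2 * e * 2"
  proof (rule abs_integral_le_unif)
    fix t :: real assume t: "t \<in> {0..1}"
    show "\<bar>\<integral>t'. \<integral>s. H (t + e * s) (t' + e * s) \<partial>unif \<partial>unif\<bar> \<le> \<kappa> / 4 + 2 * e * 2"
      by (rule integral_unif_off_diag[where s = t])
         (use inner t e \<open>0 < \<kappa>\<close> bdH in \<open>auto intro!: abs_integral_le_unif\<close>)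
  qed (use e \<open>0 < \<kappa>\<close> in simp)
  have "\<bar>\<integral>s. (\<integral>t. \<integral>t'. H t t' \<partial>unif \<partial>unif) - (\<integral>t. \<integral>t'. H (t + e * s) (t' + e * s) \<partial>unif \<partial>unif) \<partial>unif\<bar> \<le> 8 * e"
    using diag e by (intro abs_integral_le_unif) auto
  moreover have "integrable unif (\<lambda>s. \<integral>t. \<integral>t'. H (t + e * s) (t' + e * s) \<partial>unif \<partial>unif)"
    by (rule integrable_unif[where B = 2]; (intro abs_integral_le_unif bdH)?; simp)
  ultimately have "\<bar>\<integral>t. \<integral>t'. H t t' \<partial>unif \<partial>unif\<bar> \<le> 8 * e + (\<kappa> / 4 + 2 * e * 2)"
    using bulk unif.prob_space by (simp add: swap)
  moreover have "(\<integral>t. \<integral>t'. H t t' \<partial>unif \<partial>unif) = (\<integral>t. \<integral>t'. K2 t t' \<partial>unif \<partial>unif) - (\<integral>t. \<integral>t'. K t t' \<partial>unif \<partial>unif)"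
    unfolding H_def using int int' by simp
  moreover have "(\<integral>t. \<integral>t'. K1 t t' - K t t' \<partial>unif \<partial>unif) = (\<integral>t. \<integral>t'. K1 t t' \<partial>unif \<partial>unif) - (\<integral>t. \<integral>t'. K t t' \<partial>unif \<partial>unif)"
    using int int' by simp
  ultimately have "\<bar>\<integral>t. \<integral>t'. K1 t t' - K t t' \<partial>unif \<partial>unif\<bar> \<le> 2 * \<bar>\<omega>\<bar> + 8 * e + (\<kappa> / 4 + 2 * e * 2)"
    using I12 by linarith
  also have "\<dots> \<le> \<kappa>"
    using \<omega>' \<kappa>m \<open>\<kappa> * m \<le> \<kappa>\<close> \<open>0 < \<kappa>\<close> unfolding e_def by linarith
  finally show ?thesis
    by (simp add: K1_def K_def)
qed

section \<open>Square means of averages along a curve\<close>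

lemma prob_space_pair:
  assumes "prob_space M" "prob_space N"
  shows "prob_space (M \<Otimes>\<^sub>M N)"
proof -
  interpret pair_prob_space M N
    using assms by (simp add: pair_prob_space_def pair_sigma_finite_def prob_space_imp_sigma_finite)
  show ?thesis by (rule P.prob_space_axioms)
qed

lemma prob_iterated:
  fixes \<phi> :: "'a \<Rightarrow> 'b \<Rightarrow> real"
  assumes "prob_space M" "prob_space N"
    and [measurable]: "(\<lambda>(s, t). \<phi> s t) \<in> borel_measurable (M \<Otimes>\<^sub>M N)"
    and "\<And>s t. \<bar>\<phi> s t\<bar> \<le> B"
  shows "(\<integral>z. \<phi> (fst z) (snd z) \<partial>(M \<Otimes>\<^sub>M N)) = (\<integral>s. \<integral>t. \<phi> s t \<partial>N \<partial>M)"
proof -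
  interpret pair_prob_space M N
    using assms(1,2) by (simp add: pair_prob_space_def pair_sigma_finite_def prob_space_imp_sigma_finite)
  have "integrable (M \<Otimes>\<^sub>M N) (\<lambda>(s, t). \<phi> s t)"
    by (intro P.integrable_bounded[where B = B]) (use assms in auto)
  from integral_fst[OF this] show ?thesis
    by (simp add: case_prod_unfold)
qed

text \<open>Expanding the square and translating \<open>x\<close> leaves \<open>G x\<close> times
  the double average of \<open>G (x + (c t - c t'))\<close>. Since \<open>G\<close> is a difference
  of translates of \<open>h\<close>, that double average is the one bounded in
  \<open>curve_difference_shift\<close>, for \<open>F k = h (x + (S1 * fst k, S2 * snd k))\<close>.
  The offsets \<open>p\<close>, \<open>q\<close> cancel, and the scales \<open>S1\<close>,
  \<open>S2\<close> are hidden in \<open>F\<close>, so the bound does not see them.\<close>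

lemma curve_average_regular:
  fixes h :: "real \<times> real \<Rightarrow> real" and \<phi> \<phi>' \<phi>'' :: "real \<Rightarrow> real"
  assumes h: "continuous_on UNIV h" "\<And>x. \<bar>h x\<bar> \<le> 1" "integrable lborel h"
    and \<phi>: "continuous_on UNIV \<phi>"
    and d\<phi>: "\<And>t. t \<in> {-1/2..2} \<Longrightarrow> (\<phi> has_real_derivative \<phi>' t) (at t)"
    and d\<phi>': "\<And>t. t \<in> {-1/2..2} \<Longrightarrow> (\<phi>' has_real_derivative \<phi>'' t) (at t)"
    and M: "\<And>t. t \<in> {-1/2..2} \<Longrightarrow> \<bar>\<phi>' t\<bar> \<le> M" "\<And>t. t \<in> {-1/2..2} \<Longrightarrow> \<bar>\<phi>'' t\<bar> \<le> M"
    and m: "\<And>t t'. t \<in> {-1/2..2} \<Longrightarrow> t' \<in> {-1/2..2} \<Longrightarrow> m * \<bar>t - t'\<bar> \<le> \<bar>\<phi>' t - \<phi>' t'\<bar>"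
    and const: "m \<le> \<bar>\<mu>\<bar>" "0 < m" "m \<le> 1" "1 \<le> M" "0 < \<kappa>" "\<kappa> \<le> 1"
    and w: "\<bar>w1\<bar> \<le> \<kappa>^3 * m^3 / (100000 * M\<^sup>2)" "\<bar>w2\<bar> \<le> \<kappa>^3 * m^3 / (100000 * M\<^sup>2)"
    and G: "\<And>x. G x = h x - h (x + (S1 * w1, S2 * w2))"
    and c: "\<And>t. c t = (p + S1 * (\<mu> * t), q + S2 * \<phi> t)"
  shows "integrable lborel (\<lambda>x. (\<integral>t. G (x + c t) \<partial>unif)\<^sup>2)"
    and "(\<integral>x. (\<integral>t. G (x + c t) \<partial>unif)\<^sup>2 \<partial>lborel) \<le> 2 * \<kappa> * (\<integral>x. \<bar>h x\<bar> \<partial>lborel)"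
proof -
  have [measurable]: "h \<in> borel_measurable borel" "\<phi> \<in> borel_measurable borel"
    using h(1) \<phi> by (auto intro: borel_measurable_continuous_onI)
  have [measurable]: "G \<in> borel_measurable borel"
    unfolding G[abs_def] by measurable
  have [measurable]: "c \<in> borel_measurable borel"
    unfolding c[abs_def] by measurable
  have ihw: "integrable lborel (\<lambda>x. h (x + (S1 * w1, S2 * w2)))"
    "(\<integral>x. \<bar>h (x + (S1 * w1, S2 * w2))\<bar> \<partial>lborel) = (\<integral>x. \<bar>h x\<bar> \<partial>lborel)"
    using integrable_translate(1)[OF h(3)] integrable_translate(2)[OF integrable_abs[OF h(3)]] by auto
  have iG: "integrable lborel G"
    unfolding G[abs_def] using h(3) ihw by simp
  have G2: "\<bar>G x\<bar> \<le> 2" for x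
    unfolding G using h(2)[of x] h(2)[of "x + (S1 * w1, S2 * w2)"] by linarith
  have G1: "(\<integral>x. \<bar>G x\<bar> \<partial>lborel) \<le> 2 * (\<integral>x. \<bar>h x\<bar> \<partial>lborel)"
  proof -
    have "(\<integral>x. \<bar>G x\<bar> \<partial>lborel) \<le> (\<integral>x. \<bar>h x\<bar> + \<bar>h (x + (S1 * w1, S2 * w2))\<bar> \<partial>lborel)"
      using iG h(3) ihw by (intro integral_mono) (auto simp: G)
    then show ?thesis using h(3) ihw by simp
  qed
  let ?P = "unif \<Otimes>\<^sub>M unif"
  have P: "prob_space ?P" by (intro prob_space_pair prob_space_unif)
  have GG: "\<bar>G x * G y\<bar> \<le> 2 * \<bar>G x\<bar>" "\<bar>G y * G x\<bar> \<le> 2 * \<bar>G x\<bar>" for x y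
    using mult_left_mono[OF G2[of y], of "\<bar>G x\<bar>"] by (simp_all add: abs_mult mult.commute)
  have GG4: "\<bar>G x * G y\<bar> \<le> 4" for x y
    using GG[of x y] G2[of x] by linarith
  have ih: "integrable lborel (\<lambda>x. 2 * \<bar>G x\<bar>)" using iG by simp
  define H where "H z x = G (x + c (fst z)) * G (x + c (snd z))" for z x
  define K where "K z x = G x * G (x + (c (fst z) - c (snd z)))" for z :: "real \<times> real" and x
  have sq: "(\<integral>t. G (x + c t) \<partial>unif)\<^sup>2 = (\<integral>z. H z x \<partial>?P)" for x
  proof -
    have "(\<integral>z. H z x \<partial>?P) = (\<integral>t. \<integral>t'. G (x + c t) * G (x + c t') \<partial>unif \<partial>unif)"
      unfolding H_def using GG4
      by (intro prob_iterated[where \<phi> = "\<lambda>t t'. G (x + c t) * G (x + c t')" and B = 4] prob_space_unif) auto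
    then show ?thesis by (simp add: power2_eq_square)
  qed
  have HF: "integrable lborel (\<lambda>x. \<integral>z. H z x \<partial>?P)"
    "(\<integral>x. \<integral>z. H z x \<partial>?P \<partial>lborel) = (\<integral>z. \<integral>x. H z x \<partial>lborel \<partial>?P)"
    by (rule dominated_fubini[where h = "\<lambda>x. 2 * \<bar>G x\<bar>" and a = "\<lambda>z. c (snd z)", OF P _ ih];
        use GG in \<open>simp add: H_def\<close>)+
  have KF: "\<And>z. integrable lborel (K z)" "integrable lborel (\<lambda>x. \<integral>z. K z x \<partial>?P)"
    "(\<integral>x. \<integral>z. K z x \<partial>?P \<partial>lborel) = (\<integral>z. \<integral>x. K z x \<partial>lborel \<partial>?P)"
    by (rule dominated_fubini[where h = "\<lambda>x. 2 * \<bar>G x\<bar>" and a = "\<lambda>z. 0", OF P _ ih];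
        use GG in \<open>simp add: K_def space_pair_measure\<close>)+
  have HK: "(\<integral>x. H z x \<partial>lborel) = (\<integral>x. K z x \<partial>lborel)" for z
  proof -
    have "H z x = K z (x + c (snd z))" for x
      by (simp add: H_def K_def algebra_simps)
    then show ?thesis
      using integrable_translate(2)[OF KF(1)[of z], of "c (snd z)"] by simp
  qed
  have TV: "\<bar>\<integral>z. K z x \<partial>?P\<bar> \<le> \<kappa> * \<bar>G x\<bar>" for x
  proof -
    define F where "F k = h (x + (S1 * fst k, S2 * snd k))" for k
    have "continuous_on UNIV F"
      unfolding F_def by (intro continuous_on_compose2[OF h(1)] continuous_intros) auto
    moreover have "\<bar>F k\<bar> \<le> 1" for k unfolding F_def by (rule h(2))
    ultimately have *: "\<bar>\<integral>t. \<integral>t'. F (\<mu> * (t - t') + w1, \<phi> t - \<phi> t' + w2) - F (\<mu> * (t - t'), \<phi> t - \<phi> t') \<partial>unif \<partial>unif\<bar> \<le> \<kappa>"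
      by (rule curve_difference_shift[OF _ _ \<phi> d\<phi> d\<phi>' M m const w])
    define D where "D t t' = F (\<mu> * (t - t') + w1, \<phi> t - \<phi> t' + w2) - F (\<mu> * (t - t'), \<phi> t - \<phi> t')" for t t'
    have "(\<integral>z. K z x \<partial>?P) = (\<integral>t. \<integral>t'. G x * G (x + (c t - c t')) \<partial>unif \<partial>unif)"
      unfolding K_def using GG4
      by (intro prob_iterated[where \<phi> = "\<lambda>t t'. G x * G (x + (c t - c t'))" and B = 4] prob_space_unif) auto
    also have "\<dots> = - G x * (\<integral>t. \<integral>t'. D t t' \<partial>unif \<partial>unif)"
    proof -
      have "G (x + (c t - c t')) = - D t t'" for t t'
        by (simp add: G F_def D_def c algebra_simps)
      then show ?thesis by simp
    qed
    finally show ?thesis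
      using mult_left_mono[OF *[folded D_def], of "\<bar>G x\<bar>"] by (simp add: abs_mult mult.commute)
  qed
  show "integrable lborel (\<lambda>x. (\<integral>t. G (x + c t) \<partial>unif)\<^sup>2)"
    unfolding sq by (rule HF)
  have "(\<integral>x. (\<integral>t. G (x + c t) \<partial>unif)\<^sup>2 \<partial>lborel) = (\<integral>x. \<integral>z. K z x \<partial>?P \<partial>lborel)"
    unfolding sq HF(2) KF(3) HK ..
  also have "\<dots> \<le> (\<integral>x. \<kappa> * \<bar>G x\<bar> \<partial>lborel)"
    using KF(2) iG TV by (intro integral_mono) (auto intro: order_trans[OF abs_ge_self])
  also have "\<dots> \<le> \<kappa> * (2 * (\<integral>x. \<bar>h x\<bar> \<partial>lborel))"
    using G1 const by simp
  finally show "(\<integral>x. (\<integral>t. G (x + c t) \<partial>unif)\<^sup>2 \<partial>lborel) \<le> 2 * \<kappa> * (\<integral>x. \<bar>h x\<bar> \<partial>lborel)"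
    by simp
qed

section \<open>The smoothing inequality\<close>

text \<open>The second component of \<open>t\<close> is taken as \<open>T * sqrt (1 + s)\<close> so
  that the first coordinate of \<open>sig\<close> is affine in \<open>s\<close>. Then the first
  coordinate of a difference of two points of that curve depends on \<open>s - s'\<close> alone, as
  the argument for \<open>curve_difference_shift\<close> requires.\<close>

definition lin :: "real \<Rightarrow> real \<Rightarrow> real \<Rightarrow> real \<times> real" where
  "lin T \<tau> s = (T * \<tau>, T * sqrt (1 + s))"

definition gam :: "real \<Rightarrow> real \<Rightarrow> real \<times> real" where
  "gam T \<tau> = (T^2 * \<tau>^2, T^3 * \<tau>^3)"

definition sig :: "real \<Rightarrow> real \<Rightarrow> real \<times> real" where
  "sig T s = (T^2 * (1 + s), T^3 * ((1 + s) * sqrt (1 + s)))"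

lemma measurable_curves [measurable (raw)]:
  assumes [measurable]: "a \<in> borel_measurable M" "b \<in> borel_measurable M"
  shows "(\<lambda>x. lin T (a x) (b x)) \<in> borel_measurable M"
    and "(\<lambda>x. gam T (a x)) \<in> borel_measurable M"
    and "(\<lambda>x. sig T (b x)) \<in> borel_measurable M"
  unfolding lin_def gam_def sig_def by measurable

text \<open>Hypotheses of \<open>curve_average_regular\<close> for the curve
  \<open>- sig T s\<close>, with \<open>M = 3\<close> and \<open>m = 1/4\<close>. The interval
  exceeds the unit interval to leave room for the small translations, while \<open>1 + t\<close>
  stays at least \<open>1/2\<close>.\<close>

lemma sqrt_curve:
  fixes t t' :: real
  assumes t: "t \<in> {-1/2..2}"
  defines "\<phi> \<equiv> \<lambda>t. - ((1 + t) * sqrt (1 + t))" and "\<phi>' \<equiv> \<lambda>t. - (3 / 2 * sqrt (1 + t))"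
    and "\<phi>'' \<equiv> \<lambda>t. - (3 / 4 / sqrt (1 + t))"
  shows "(\<phi> has_real_derivative \<phi>' t) (at t)" "(\<phi>' has_real_derivative \<phi>'' t) (at t)"
    and "\<bar>\<phi>' t\<bar> \<le> 3" "\<bar>\<phi>'' t\<bar> \<le> 3"
    and "t' \<in> {-1/2..2} \<Longrightarrow> 1 / 4 * \<bar>t - t'\<bar> \<le> \<bar>\<phi>' t - \<phi>' t'\<bar>"
proof -
  have pos: "0 < 1 + t" using t by auto
  have up: "sqrt (1 + u) \<le> 2" if "u \<in> {-1/2..2}" for u
    using that by (intro real_le_lsqrt) auto
  have lo: "1/2 \<le> sqrt (1 + t)"
    using t by (intro real_le_rsqrt) (auto simp: power2_eq_square)
  have sq: "sqrt (1 + t) * sqrt (1 + t) = 1 + t" using pos by simp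
  have "((\<lambda>t. sqrt (1 + t)) has_real_derivative 1 / (2 * sqrt (1 + t))) (at t)"
    using pos by (auto intro!: derivative_eq_intros simp: field_simps)
  note D = this
  have "((\<lambda>t. (1 + t) * sqrt (1 + t)) has_real_derivative 3 / 2 * sqrt (1 + t)) (at t)"
  proof (rule DERIV_cong)
    show "((\<lambda>t. (1 + t) * sqrt (1 + t)) has_real_derivative
        1 * sqrt (1 + t) + 1 / (2 * sqrt (1 + t)) * (1 + t)) (at t)"
      by (rule DERIV_mult[OF _ D]) (auto intro!: derivative_eq_intros)
    show "1 * sqrt (1 + t) + 1 / (2 * sqrt (1 + t)) * (1 + t) = 3 / 2 * sqrt (1 + t)"
    proof -
      have "1 / (2 * sqrt (1 + t)) * (1 + t) = ((1 + t) / sqrt (1 + t)) / 2" by simp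
      also have "(1 + t) / sqrt (1 + t) = sqrt (1 + t)" using pos by (intro real_div_sqrt) auto
      finally show ?thesis by simp
    qed
  qed
  then show "(\<phi> has_real_derivative \<phi>' t) (at t)"
    unfolding \<phi>_def \<phi>'_def by (rule DERIV_minus)
  have "((\<lambda>t. 3 / 2 * sqrt (1 + t)) has_real_derivative 3 / 4 / sqrt (1 + t)) (at t)"
    by (rule DERIV_cong[OF DERIV_cmult[OF D]]) simp
  then show "(\<phi>' has_real_derivative \<phi>'' t) (at t)"
    unfolding \<phi>'_def \<phi>''_def by (rule DERIV_minus)
  show "\<bar>\<phi>' t\<bar> \<le> 3" using up[OF t] lo by (simp add: \<phi>'_def)
  show "\<bar>\<phi>'' t\<bar> \<le> 3" proof -
    have "3 / 4 / sqrt (1 + t) \<le> 3 / 4 / (1/2)" using lo pos by (intro divide_left_mono) auto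
    then show ?thesis using lo by (simp add: \<phi>''_def)
  qed
  show "1 / 4 * \<bar>t - t'\<bar> \<le> \<bar>\<phi>' t - \<phi>' t'\<bar>" if t': "t' \<in> {-1/2..2}"
  proof -
    define a b where "a = sqrt (1 + t)" and "b = sqrt (1 + t')"
    have ab: "t - t' = (a - b) * (a + b)"
      using pos t' by (simp add: a_def b_def algebra_simps)
    have "0 \<le> a + b" "a + b \<le> 4" using up[OF t] up[OF t'] pos t' by (auto simp: a_def b_def)
    then have le: "\<bar>t - t'\<bar> \<le> \<bar>a - b\<bar> * 4" unfolding ab abs_mult by (intro mult_left_mono) auto
    have "\<phi>' t - \<phi>' t' = 3 / 2 * (b - a)" by (simp add: \<phi>'_def a_def b_def algebra_simps)
    then have eq: "\<bar>\<phi>' t - \<phi>' t'\<bar> = 3 / 2 * \<bar>a - b\<bar>"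
      by (simp only: abs_mult abs_minus_commute abs_divide abs_numeral)
    have "1 / 4 * \<bar>t - t'\<bar> \<le> \<bar>a - b\<bar>" using le by simp
    also have "\<dots> \<le> \<bar>\<phi>' t - \<phi>' t'\<bar>" unfolding eq by simp
    finally show ?thesis .
  qed
qed

text \<open>Continuity gives antiderivatives along curves, but no modulus of continuity occurs in
  any bound; hence the results apply equally to bumps that shrink to a set.\<close>

locale density_profile =
  fixes f :: "real \<times> real \<Rightarrow> real"
  assumes cont: "continuous_on UNIV f" and nonneg: "0 \<le> f x" and le1: "f x \<le> 1"
    and int: "integrable lborel f"
begin

definition mass :: real where "mass = (\<integral>x. f x \<partial>lborel)"

lemma mass_nonneg: "0 \<le> mass"
  unfolding mass_def using nonneg by (simp add: integral_nonneg_AE)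

lemma f_measurable [measurable]: "f \<in> borel_measurable borel"
  using cont by (rule borel_measurable_continuous_onI)

lemma f_abs: "\<bar>f x\<bar> \<le> 1"
  using nonneg le1 by simp

lemma f_translate: "integrable lborel (\<lambda>x. f (x + a))" "(\<integral>x. f (x + a) \<partial>lborel) = mass"
  using integrable_translate[OF int] by (simp_all add: mass_def)

lemma prod_translate:
  defines "F v \<equiv> \<lambda>x. f x * f (x + v)"
  shows "continuous_on UNIV (F v)" "\<bar>F v x\<bar> \<le> 1" "integrable lborel (F v)" "(\<integral>x. \<bar>F v x\<bar> \<partial>lborel) \<le> mass"
    "0 \<le> F v x"
proof -
  show "continuous_on UNIV (F v)"
    unfolding F_def by (intro continuous_intros cont continuous_on_compose2[OF cont]) auto
  then have [measurable]: "F v \<in> borel_measurable borel" by (rule borel_measurable_continuous_onI)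
  have le: "0 \<le> F v x" "F v x \<le> f x" for x
    unfolding F_def using nonneg le1 by (auto simp: mult_left_le)
  then show "\<bar>F v x\<bar> \<le> 1" "0 \<le> F v x" using le1[of x] order_trans[OF le(2)[of x]] by auto
  show i: "integrable lborel (F v)"
    by (rule Bochner_Integration.integrable_bound[OF int]) (use le nonneg in auto)
  show "(\<integral>x. \<bar>F v x\<bar> \<partial>lborel) \<le> mass"
    unfolding mass_def using i int le by (intro integral_mono) auto
qed

lemma diff_translate:
  defines "g w \<equiv> \<lambda>x. f x - f (x + w)"
  shows "continuous_on UNIV (g w)" "\<bar>g w x\<bar> \<le> 1" "integrable lborel (g w)" "(\<integral>x. \<bar>g w x\<bar> \<partial>lborel) \<le> 2 * mass"
    "integrable lborel (\<lambda>x. (g w x)\<^sup>2)" "(\<integral>x. (g w x)\<^sup>2 \<partial>lborel) \<le> 2 * mass"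
proof -
  show "continuous_on UNIV (g w)"
    unfolding g_def by (intro continuous_intros cont continuous_on_compose2[OF cont]) auto
  then have [measurable]: "g w \<in> borel_measurable borel" by (rule borel_measurable_continuous_onI)
  show le: "\<bar>g w x\<bar> \<le> 1" for x
    unfolding g_def using nonneg[of x] le1[of x] nonneg[of "x + w"] le1[of "x + w"] by linarith
  show i: "integrable lborel (g w)"
    unfolding g_def using int f_translate by simp
  have "(\<integral>x. \<bar>g w x\<bar> \<partial>lborel) \<le> (\<integral>x. f x + f (x + w) \<partial>lborel)"
  proof (rule integral_mono)
    show "\<bar>g w x\<bar> \<le> f x + f (x + w)" for x
      unfolding g_def using nonneg[of x] nonneg[of "x + w"] by linarith
    show "integrable lborel (\<lambda>x. \<bar>g w x\<bar>)" using i by (rule Bochner_Integration.integrable_abs)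
    show "integrable lborel (\<lambda>x. f x + f (x + w))"
      using int f_translate(1) by (rule Bochner_Integration.integrable_add)
  qed
  also have "\<dots> = 2 * mass" using int f_translate by (simp add: mass_def)
  finally show m: "(\<integral>x. \<bar>g w x\<bar> \<partial>lborel) \<le> 2 * mass" .
  have sq: "(g w x)\<^sup>2 \<le> \<bar>g w x\<bar>" for x
  proof -
    have "(g w x)\<^sup>2 = \<bar>g w x\<bar> * \<bar>g w x\<bar>" by (simp add: power2_eq_square)
    also have "\<dots> \<le> \<bar>g w x\<bar>" using le[of x] by (intro mult_left_le) auto
    finally show ?thesis .
  qed
  show i2: "integrable lborel (\<lambda>x. (g w x)\<^sup>2)"
    by (rule Bochner_Integration.integrable_bound[OF i]) (use sq in auto)
  have "(\<integral>x. (g w x)\<^sup>2 \<partial>lborel) \<le> (\<integral>x. \<bar>g w x\<bar> \<partial>lborel)"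
    using i i2 sq by (intro integral_mono) auto
  with m show "(\<integral>x. (g w x)\<^sup>2 \<partial>lborel) \<le> 2 * mass" by linarith
qed

end

text \<open>Cauchy-Schwarz with an explicit weight \<open>c\<close> instead of square roots. The
  right-hand side is linear in \<open>A\<close> and \<open>B\<close>, so it can be averaged over a
  parameter before \<open>B\<close> is estimated.\<close>

lemma integral_mult_le_amgm:
  fixes p q :: "'a \<Rightarrow> real"
  assumes p: "integrable M (\<lambda>x. (p x)\<^sup>2)" "(\<integral>x. (p x)\<^sup>2 \<partial>M) \<le> A"
    and q: "integrable M (\<lambda>x. (q x)\<^sup>2)" "(\<integral>x. (q x)\<^sup>2 \<partial>M) \<le> B"
    and r: "\<And>x. \<bar>r x\<bar> \<le> \<bar>p x\<bar> * \<bar>q x\<bar>" and "0 < c"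
  shows "\<bar>\<integral>x. r x \<partial>M\<bar> \<le> (c * A + B / c) / 2"
proof (cases "integrable M r")
  case True
  have pw: "\<bar>r x\<bar> \<le> (c * (p x)\<^sup>2 + (q x)\<^sup>2 / c) / 2" for x
  proof -
    define S where "S = c * (p x)\<^sup>2 + (q x)\<^sup>2 / c"
    have "0 \<le> (c * \<bar>p x\<bar> - \<bar>q x\<bar>)\<^sup>2 / c" using \<open>0 < c\<close> by simp
    also have "\<dots> = S - 2 * (\<bar>p x\<bar> * \<bar>q x\<bar>)"
      using \<open>0 < c\<close> by (simp add: S_def power2_diff field_simps power2_eq_square)
    finally have "\<bar>r x\<bar> \<le> S / 2" using r[of x] by linarith
    then show ?thesis by (simp only: S_def)
  qed
  have "\<bar>\<integral>x. r x \<partial>M\<bar> \<le> (\<integral>x. \<bar>r x\<bar> \<partial>M)" by (rule integral_abs_bound)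
  also have "\<dots> \<le> (\<integral>x. (c * (p x)\<^sup>2 + (q x)\<^sup>2 / c) / 2 \<partial>M)"
    using True p(1) q(1) pw by (intro integral_mono) auto
  also have "\<dots> = (c * (\<integral>x. (p x)\<^sup>2 \<partial>M) + (\<integral>x. (q x)\<^sup>2 \<partial>M) / c) / 2"
    using p(1) q(1) by simp
  also have "\<dots> \<le> (c * A + B / c) / 2"
    using p(2) q(2) \<open>0 < c\<close> by (intro divide_right_mono add_mono mult_left_mono) auto
  finally show ?thesis .
next
  case False
  have "0 \<le> A" "0 \<le> B" 
    by (rule order_trans[OF integral_nonneg_AE p(2)] order_trans[OF integral_nonneg_AE q(2)]; simp)+
  then show ?thesis using False \<open>0 < c\<close> by (simp add: not_integrable_integral_eq)
qed

context density_profile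
begin

text \<open>\<open>curve_average_regular\<close> with error \<open>\<eta>\<^sup>2\<close>,
  \<open>m = 1/4\<close> and \<open>M = 3\<close>; the denominator is
  \<open>64 * 9 * 100000\<close>. It lets the product of two copies of \<open>f\<close> be frozen
  while the other curve moves.\<close>

lemma sqrt_average_regular:
  fixes T \<eta> h1 h2 :: real
  assumes \<eta>: "0 < \<eta>" "\<eta> \<le> 1" and h: "\<bar>h1\<bar> \<le> \<eta>^6 / 57600000" "\<bar>h2\<bar> \<le> \<eta>^6 / 57600000"
  defines "F \<equiv> \<lambda>v x. f x * f (x + v)"
  shows "integrable lborel (\<lambda>u. (\<integral>s. F v (u - sig T s) - F v (u + (T^2 * h1, T^3 * h2) - sig T s) \<partial>unif)\<^sup>2)"
    and "(\<integral>u. (\<integral>s. F v (u - sig T s) - F v (u + (T^2 * h1, T^3 * h2) - sig T s) \<partial>unif)\<^sup>2 \<partial>lborel) \<le> 2 * \<eta>\<^sup>2 * mass"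
proof -
  have Fv: "continuous_on UNIV (F v)" "\<And>x. \<bar>F v x\<bar> \<le> 1" "integrable lborel (F v)" "(\<integral>x. \<bar>F v x\<bar> \<partial>lborel) \<le> mass"
    unfolding F_def by (rule prod_translate)+
  define \<phi> where "\<phi> t = - ((1 + t) * sqrt (1 + t))" for t :: real
  define G where "G x = F v x - F v (x + (T^2 * h1, T^3 * h2))" for x
  have e: "(\<eta>\<^sup>2)^3 * (1/4)^3 / (100000 * 3\<^sup>2) = \<eta>^6 / 57600000"
    by (simp add: power_mult[symmetric] power_divide)
  have \<phi>: "continuous_on UNIV \<phi>" unfolding \<phi>_def by (intro continuous_intros)
  have \<eta>2: "0 < \<eta>\<^sup>2" "\<eta>\<^sup>2 \<le> 1" using \<eta> by (auto simp: power_le_one)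
  have c: "- sig T t = (- T\<^sup>2 + T\<^sup>2 * (- 1 * t), 0 + T^3 * \<phi> t)" for t
    by (simp add: sig_def \<phi>_def algebra_simps)
  note R = curve_average_regular[where h = "F v" and \<phi> = \<phi> and \<kappa> = "\<eta>\<^sup>2" and m = "1/4" and M = 3 and \<mu> = "-1"
      and ?w1.0 = h1 and ?w2.0 = h2 and ?S1.0 = "T\<^sup>2" and ?S2.0 = "T^3" and p = "-T\<^sup>2" and q = 0
      and G = G and c = "\<lambda>t. - sig T t", unfolded e, OF Fv(1,2,3) \<phi> sqrt_curve(1)[folded \<phi>_def] sqrt_curve(2) sqrt_curve(3) sqrt_curve(4)
      sqrt_curve(5) _ _ _ _ \<eta>2 h G_def c]
  have Ge: "G (u + - sig T s) = F v (u - sig T s) - F v (u + (T^2 * h1, T^3 * h2) - sig T s)" for u s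
    by (simp add: G_def algebra_simps)
  show "integrable lborel (\<lambda>u. (\<integral>s. F v (u - sig T s) - F v (u + (T^2 * h1, T^3 * h2) - sig T s) \<partial>unif)\<^sup>2)"
    using R(1) unfolding Ge by simp
  have "(\<integral>u. (\<integral>s. F v (u - sig T s) - F v (u + (T^2 * h1, T^3 * h2) - sig T s) \<partial>unif)\<^sup>2 \<partial>lborel) \<le> 2 * \<eta>\<^sup>2 * (\<integral>x. \<bar>F v x\<bar> \<partial>lborel)"
    using R(2) unfolding Ge by simp
  also have "\<dots> \<le> 2 * \<eta>\<^sup>2 * mass"
    using Fv(4) by (intro mult_left_mono) auto
  finally show "(\<integral>u. (\<integral>s. F v (u - sig T s) - F v (u + (T^2 * h1, T^3 * h2) - sig T s) \<partial>unif)\<^sup>2 \<partial>lborel) \<le> 2 * \<eta>\<^sup>2 * mass" .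
qed

text \<open>With \<open>\<tau> = 1 + \<beta> + l * \<alpha>\<close>, the difference of squares is
  affine in \<open>\<alpha>\<close> with slope \<open>- 2 * v * l\<close>, and that of cubes is
  quadratic with second derivative \<open>- 6 * v * l\<^sup>2\<close>. Since
  \<open>\<eta> \<le> \<bar>v\<bar>\<close>, the value \<open>m = \<eta> * l\<^sup>2\<close> bounds
  both from below; the parabola degenerates as \<open>v\<close> tends to 0.\<close>

lemma parabola_average_regular:
  fixes T \<eta> l w1 w2 \<beta> v :: real and a :: "real \<times> real"
  assumes \<eta>: "0 < \<eta>" "\<eta> \<le> 1" and l: "0 < l" "l \<le> 1/10" and \<beta>: "\<beta> \<in> {0..1}" and v: "\<eta> \<le> \<bar>v\<bar>" "\<bar>v\<bar> \<le> 1"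
    and w: "\<bar>w1\<bar> \<le> \<eta>^9 * l^6 / 900000" "\<bar>w2\<bar> \<le> \<eta>^9 * l^6 / 900000"
  defines "G \<equiv> \<lambda>x. f (x + a) - f (x + (T^2 * w1, T^3 * w2) + a)"
    and "c \<equiv> \<lambda>\<alpha>. gam T (1 + \<beta> + l * \<alpha> - v) - gam T (1 + \<beta> + l * \<alpha>)"
  shows "integrable lborel (\<lambda>x. (\<integral>\<alpha>. G (x + c \<alpha>) \<partial>unif)\<^sup>2)"
    and "(\<integral>x. (\<integral>\<alpha>. G (x + c \<alpha>) \<partial>unif)\<^sup>2 \<partial>lborel) \<le> 2 * \<eta>\<^sup>2 * mass"
proof -
  define h where "h x = f (x + a)" for x
  define \<phi> \<phi>' \<phi>'' where "\<phi> \<alpha> = - 3 * v * (1 + \<beta> + l * \<alpha>)^2 + 3 * v^2 * (1 + \<beta> + l * \<alpha>) - v^3"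
    and "\<phi>' \<alpha> = l * (3 * v^2 - 6 * v * (1 + \<beta> + l * \<alpha>))" and "\<phi>'' \<alpha> = - 6 * v * l^2" for \<alpha>
  have hc: "continuous_on UNIV h" unfolding h_def by (intro continuous_on_compose2[OF cont] continuous_intros) auto
  have h1: "\<bar>h x\<bar> \<le> 1" for x unfolding h_def by (rule f_abs)
  have hi: "integrable lborel h" unfolding h_def by (rule f_translate)
  have hm: "(\<integral>x. \<bar>h x\<bar> \<partial>lborel) = mass" unfolding h_def using f_translate(2) nonneg by simp
  have \<phi>c: "continuous_on UNIV \<phi>" unfolding \<phi>_def by (intro continuous_intros)
  have d1: "(\<phi> has_real_derivative \<phi>' \<alpha>) (at \<alpha>)" for \<alpha>
    unfolding \<phi>_def \<phi>'_def by (auto intro!: derivative_eq_intros simp: algebra_simps power2_eq_square)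
  have d2: "(\<phi>' has_real_derivative \<phi>'' \<alpha>) (at \<alpha>)" for \<alpha>
    unfolding \<phi>'_def \<phi>''_def by (auto intro!: derivative_eq_intros simp: algebra_simps power2_eq_square)
  have v2: "v\<^sup>2 \<le> 1" using v by (simp add: abs_square_le_1)
  have l2: "l\<^sup>2 \<le> 1" using l by (intro power_le_one) auto
  have M1: "\<bar>\<phi>' \<alpha>\<bar> \<le> 3" if \<alpha>: "\<alpha> \<in> {-1/2..2}" for \<alpha>
  proof -
    have "\<bar>l * \<alpha>\<bar> \<le> 1/10 * 2" unfolding abs_mult using l \<alpha> by (intro mult_mono) auto
    then have "\<bar>1 + \<beta> + l * \<alpha>\<bar> \<le> 3" using \<beta> by (simp only: atLeastAtMost_iff) linarith
    then have "\<bar>v\<bar> * \<bar>1 + \<beta> + l * \<alpha>\<bar> \<le> 1 * 3" using v by (intro mult_mono) auto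
    then have "\<bar>v * (1 + \<beta> + l * \<alpha>)\<bar> \<le> 3" by (simp add: abs_mult)
    moreover have "0 \<le> v\<^sup>2" by simp
    ultimately have "\<bar>3 * v^2 - 6 * (v * (1 + \<beta> + l * \<alpha>))\<bar> \<le> 21" using v2 by linarith
    then have "l * \<bar>3 * v^2 - 6 * (v * (1 + \<beta> + l * \<alpha>))\<bar> \<le> 1/10 * 21" using l by (intro mult_mono) auto
    then show ?thesis using l by (simp add: \<phi>'_def abs_mult mult.assoc)
  qed
  have M2: "\<bar>\<phi>'' \<alpha>\<bar> \<le> 3" for \<alpha>
  proof -
    have "\<bar>v\<bar> * l\<^sup>2 \<le> 1 * (1/10)\<^sup>2" using v l by (intro mult_mono power_mono) auto
    then show ?thesis by (simp add: \<phi>''_def abs_mult power2_eq_square mult_ac)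
  qed
  have mm: "\<eta> * l\<^sup>2 * \<bar>t - t'\<bar> \<le> \<bar>\<phi>' t - \<phi>' t'\<bar>" for t t'
  proof -
    have "\<phi>' t - \<phi>' t' = - (6 * v * l\<^sup>2 * (t - t'))" by (simp add: \<phi>'_def power2_eq_square algebra_simps)
    moreover have "\<eta> * l\<^sup>2 * \<bar>t - t'\<bar> \<le> 6 * \<bar>v\<bar> * l\<^sup>2 * \<bar>t - t'\<bar>"
      using v \<eta> by (intro mult_right_mono) auto
    ultimately show ?thesis by (simp add: abs_mult)
  qed
  have m1: "\<eta> * l\<^sup>2 \<le> \<bar>- 2 * v * l\<bar>"
  proof -
    have "\<eta> * l\<^sup>2 \<le> (2 * \<bar>v\<bar>) * l"
      using v \<eta> l by (intro mult_mono) (auto simp: power2_eq_square mult_left_le)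
    then show ?thesis using l by (simp add: abs_mult)
  qed
  have m0: "0 < \<eta> * l\<^sup>2" "\<eta> * l\<^sup>2 \<le> 1" using \<eta> l l2 by (auto intro: mult_le_one)
  have \<eta>2: "0 < \<eta>\<^sup>2" "\<eta>\<^sup>2 \<le> 1" using \<eta> by (auto simp: power_le_one)
  have e: "(\<eta>\<^sup>2)^3 * (\<eta> * l\<^sup>2)^3 / (100000 * 3\<^sup>2) = \<eta>^9 * l^6 / 900000"
    by (simp add: power_mult[symmetric] power_mult_distrib power_add[symmetric])
  have G: "G x = h x - h (x + (T^2 * w1, T^3 * w2))" for x
    by (simp add: G_def h_def)
  have c: "c \<alpha> = (T^2 * (v^2 - 2 * v * (1 + \<beta>)) + T^2 * (- 2 * v * l * \<alpha>), 0 + T^3 * \<phi> \<alpha>)" for \<alpha>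
    by (simp add: c_def gam_def \<phi>_def algebra_simps power2_eq_square power3_eq_cube)
  note R = curve_average_regular[where h = h and \<phi> = \<phi> and \<kappa> = "\<eta>\<^sup>2" and m = "\<eta> * l\<^sup>2" and M = 3 and \<mu> = "- 2 * v * l"
      and ?w1.0 = w1 and ?w2.0 = w2 and ?S1.0 = "T\<^sup>2" and ?S2.0 = "T^3"
      and G = G and c = c, unfolded e, OF hc h1 hi \<phi>c d1 d2 M1 M2 mm m1 m0 _ \<eta>2 w G c]
  show "integrable lborel (\<lambda>x. (\<integral>\<alpha>. G (x + c \<alpha>) \<partial>unif)\<^sup>2)"
    using R(1) by simp
  show "(\<integral>x. (\<integral>\<alpha>. G (x + c \<alpha>) \<partial>unif)\<^sup>2 \<partial>lborel) \<le> 2 * \<eta>\<^sup>2 * mass"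
    using R(2) hm by simp
qed


lemma diff_translate_mult:
  assumes [measurable]: "k \<in> borel_measurable borel" and k: "\<And>x. \<bar>k x\<bar> \<le> 1"
  shows "integrable lborel (\<lambda>x. (f x - f (x + w)) * k x)"
    and "\<bar>\<integral>x. (f x - f (x + w)) * k x \<partial>lborel\<bar> \<le> 2 * mass"
proof -
  note D = diff_translate(3,4)[where w = w]
  have le: "\<bar>(f x - f (x + w)) * k x\<bar> \<le> \<bar>f x - f (x + w)\<bar>" for x
    using mult_left_mono[OF k, of "\<bar>f x - f (x + w)\<bar>"] by (simp add: abs_mult)
  show i: "integrable lborel (\<lambda>x. (f x - f (x + w)) * k x)"
    by (rule Bochner_Integration.integrable_bound[OF D(1)]) (use le in \<open>auto simp: real_norm_def\<close>)
  have "\<bar>\<integral>x. (f x - f (x + w)) * k x \<partial>lborel\<bar> \<le> (\<integral>x. \<bar>(f x - f (x + w)) * k x\<bar> \<partial>lborel)"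
    by (rule integral_abs_bound)
  also have "\<dots> \<le> (\<integral>x. \<bar>f x - f (x + w)\<bar> \<partial>lborel)"
    by (rule integral_mono[OF integrable_abs[OF i] integrable_abs[OF D(1)] le])
  finally show "\<bar>\<integral>x. (f x - f (x + w)) * k x \<partial>lborel\<bar> \<le> 2 * mass"
    using D(2) by linarith
qed

text \<open>The form left after doubling, for coarse parameters at least \<open>\<eta>\<close>
  apart. The average in \<open>s\<close> regularizes \<open>F\<close>, so its argument may be taken
  at \<open>\<alpha> = 0\<close>; then \<open>\<alpha>\<close> occurs in one factor \<open>g\<close>
  only and its average is small in square mean. Each of the two steps costs
  \<open>2 * \<eta> * mass\<close>.\<close>

lemma box_bound:
  fixes T \<eta> l w1 w2 \<beta> \<beta>' :: real
  assumes \<eta>: "0 < \<eta>" "\<eta> \<le> 1" and l: "l = \<eta>^6 / 10^10" and \<beta>: "\<beta> \<in> {0..1}" "\<beta>' \<in> {0..1}" and v: "\<eta> \<le> \<bar>\<beta> - \<beta>'\<bar>"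
    and w: "\<bar>w1\<bar> \<le> \<eta>^9 * l^6 / 900000" "\<bar>w2\<bar> \<le> \<eta>^9 * l^6 / 900000"
  defines "g \<equiv> \<lambda>x. f x - f (x + (T^2 * w1, T^3 * w2))"
    and "F \<equiv> \<lambda>x. f x * f (x + (T * (\<beta> - \<beta>'), 0))"
  shows "\<bar>\<integral>z. \<integral>u. F (u - sig T (snd z)) * g (u + gam T (1 + \<beta> + l * fst z))
      * g (u + (T * (\<beta> - \<beta>'), 0) + gam T (1 + \<beta>' + l * fst z)) \<partial>lborel \<partial>(unif \<Otimes>\<^sub>M unif)\<bar> \<le> 4 * \<eta> * mass"
proof -
  define a :: "real \<times> real" where "a = (T * (\<beta> - \<beta>'), 0)"
  define Sw where "Sw = (T^2 * w1, T^3 * w2)"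
  define \<tau> \<tau>' where "\<tau> \<alpha> = 1 + \<beta> + l * \<alpha>" and "\<tau>' \<alpha> = 1 + \<beta>' + l * \<alpha>" for \<alpha>
  define c where "c \<alpha> = gam T (\<tau>' \<alpha>) - gam T (\<tau> \<alpha>)" for \<alpha>
  define Ft where "Ft u = (\<integral>s. F (u - sig T s) \<partial>unif)" for u
  have g: "g x = f x - f (x + Sw)" for x by (simp add: g_def Sw_def)
  have F: "F x = f x * f (x + a)" for x by (simp add: F_def a_def)
  have l0: "0 < l" "l \<le> 1/10" "l \<le> 1"
  proof -
    have "\<eta>^6 \<le> 1" using \<eta> by (intro power_le_one) auto
    then show "0 < l" "l \<le> 1/10" "l \<le> 1" using \<eta> unfolding l by auto
  qed
  note gfacts = diff_translate[where w = Sw, folded g]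
  have Fm [measurable]: "F \<in> borel_measurable borel" unfolding F[abs_def] by measurable
  have gm [measurable]: "g \<in> borel_measurable borel" unfolding g[abs_def] by measurable
  have [measurable]: "\<tau> \<in> borel_measurable borel" "\<tau>' \<in> borel_measurable borel"
    unfolding \<tau>_def[abs_def] \<tau>'_def[abs_def] by measurable
  have [measurable]: "c \<in> borel_measurable borel" unfolding c_def[abs_def] by measurable
  have Ftm [measurable]: "Ft \<in> borel_measurable borel" unfolding Ft_def[abs_def] by measurable
  have F1: "0 \<le> F x" "\<bar>F x\<bar> \<le> 1" "F x \<le> 1" for x
    unfolding F using prod_translate(5)[of x a] prod_translate(2)[of x a] by auto
  have g1: "\<bar>g x\<bar> \<le> 1" for x using gfacts(2)[of x] by simp
  have Ft1: "\<bar>Ft u\<bar> \<le> 1" for u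
    unfolding Ft_def using F1 by (intro abs_integral_le_unif) auto
  have mult1: "\<bar>p * q\<bar> \<le> 1" if "\<bar>p\<bar> \<le> 1" "\<bar>q\<bar> \<le> 1" for p q :: real
    using that by (simp add: abs_mult mult_le_one)
  have gk: "integrable lborel (\<lambda>x. g x * k x)" "\<bar>\<integral>x. g x * k x \<partial>lborel\<bar> \<le> 2 * mass"
    if "k \<in> borel_measurable borel" "\<And>x. \<bar>k x\<bar> \<le> 1" for k
    unfolding g using diff_translate_mult[OF that] by auto
  define I where "I \<alpha> s = (\<integral>u. F (u - sig T s) * g (u + gam T (\<tau> \<alpha>)) * g (u + a + gam T (\<tau>' \<alpha>)) \<partial>lborel)" for \<alpha> s
  \<comment> \<open>Centring at the argument of the first \<open>g\<close> frees that factor from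
    all parameters and turns the argument of the second into a point moving along the parabola
    \<open>c\<close>.\<close>
  have I': "I \<alpha> s = (\<integral>z. g z * (F (z - gam T (\<tau> \<alpha>) - sig T s) * g (z + c \<alpha> + a)) \<partial>lborel)" for \<alpha> s
  proof -
    have "integrable lborel (\<lambda>z. g z * (F (z - gam T (\<tau> \<alpha>) - sig T s) * g (z + c \<alpha> + a)))"
      using F1 g1 by (intro gk mult1) auto
    from integrable_translate(2)[OF this, of "gam T (\<tau> \<alpha>)"] show ?thesis
      by (simp add: I_def c_def algebra_simps)
  qed
  have I2: "\<bar>I \<alpha> s\<bar> \<le> 2 * mass" for \<alpha> s
    unfolding I' using F1 g1 by (intro gk mult1) auto
  have [measurable]: "(\<lambda>(\<alpha>, s). I \<alpha> s) \<in> borel_measurable (unif \<Otimes>\<^sub>M unif)"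
    unfolding I_def by measurable
  have "(\<integral>z. I (fst z) (snd z) \<partial>(unif \<Otimes>\<^sub>M unif)) = (\<integral>\<alpha>. \<integral>s. I \<alpha> s \<partial>unif \<partial>unif)"
    by (rule prob_iterated[OF prob_space_unif prob_space_unif _ I2]) simp
  moreover define J where "J \<alpha> = (\<integral>z. g z * (Ft (z - gam T (\<tau> \<alpha>)) * g (z + c \<alpha> + a)) \<partial>lborel)" for \<alpha>
  have "(\<integral>s. I \<alpha> s \<partial>unif) = J \<alpha>" for \<alpha>
  proof -
    have "(\<integral>z. \<integral>s. g z * (F (z - gam T (\<tau> \<alpha>) - sig T s) * g (z + c \<alpha> + a)) \<partial>unif \<partial>lborel) = (\<integral>s. I \<alpha> s \<partial>unif)"
      unfolding I'
    proof (rule dominated_fubini(3)[where h = "\<lambda>x. \<bar>g x\<bar>" and a = "\<lambda>_. 0", OF prob_space_unif])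
      show "\<bar>g z * (F (z - gam T (\<tau> \<alpha>) - sig T s) * g (z + c \<alpha> + a))\<bar> \<le> \<bar>g (z + 0)\<bar>" for s z
        using mult_left_mono[OF mult1[OF F1(2) g1], of "\<bar>g z\<bar>"] by (simp add: abs_mult)
      show "integrable lborel (\<lambda>x. \<bar>g x\<bar>)" using gfacts(3) by simp
    qed measurable
    then show ?thesis by (simp add: J_def Ft_def)
  qed
  ultimately have IJ: "(\<integral>z. I (fst z) (snd z) \<partial>(unif \<Otimes>\<^sub>M unif)) = (\<integral>\<alpha>. J \<alpha> \<partial>unif)" by simp
  \<comment> \<open>\<open>J1\<close> is \<open>J\<close> with the argument of \<open>Ft\<close>
    frozen at \<open>\<alpha> = 0\<close>.\<close>
  define J1 where "J1 \<alpha> = (\<integral>z. g z * (Ft (z - gam T (1 + \<beta>)) * g (z + c \<alpha> + a)) \<partial>lborel)" for \<alpha>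
  have [measurable]: "J \<in> borel_measurable borel" "J1 \<in> borel_measurable borel"
    unfolding J_def[abs_def] J1_def[abs_def] by measurable
  have JB: "\<bar>J \<alpha>\<bar> \<le> 2 * mass" "\<bar>J1 \<alpha>\<bar> \<le> 2 * mass" for \<alpha>
    unfolding J_def J1_def using Ft1 g1 by (intro gk mult1; simp)+
  have Ji: "integrable unif J" "integrable unif J1"
    by (rule integrable_unif[where B = "2 * mass"]; use JB in simp)+
  have J2: "\<bar>J \<alpha> - J1 \<alpha>\<bar> \<le> 2 * \<eta> * mass" if \<alpha>: "\<alpha> \<in> {0..1}" for \<alpha>
  proof -
    define h1 h2 where "h1 = (\<tau> \<alpha>)^2 - (1 + \<beta>)^2" and "h2 = (\<tau> \<alpha>)^3 - (1 + \<beta>)^3"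
    have b2: "0 \<le> \<beta>" "\<beta> \<le> 1" "0 \<le> l * \<alpha>" "l * \<alpha> \<le> l" using \<beta> \<alpha> l0 by (auto intro: mult_left_le)
    have tau: "0 \<le> \<tau> \<alpha>" "\<tau> \<alpha> \<le> 5/2" unfolding \<tau>_def using b2 l0 by linarith+
    have "\<bar>h1\<bar> \<le> 14 * l"
    proof -
      have "h1 = (l * \<alpha>) * (\<tau> \<alpha> + (1 + \<beta>))" by (simp add: h1_def \<tau>_def power2_eq_square algebra_simps)
      also have "\<bar>\<dots>\<bar> \<le> l * 14" unfolding abs_mult using b2 tau by (intro mult_mono) auto
      finally show ?thesis by simp
    qed
    moreover have "\<bar>h2\<bar> \<le> 20 * l"
    proof -
      have "h2 = (l * \<alpha>) * ((\<tau> \<alpha>)^2 + \<tau> \<alpha> * (1 + \<beta>) + (1 + \<beta>)^2)"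
        by (simp add: h2_def \<tau>_def power2_eq_square power3_eq_cube algebra_simps)
      moreover have "(\<tau> \<alpha>)^2 \<le> (5/2)^2" "\<tau> \<alpha> * (1 + \<beta>) \<le> 5/2 * 2" "(1 + \<beta>)^2 \<le> 2^2"
        using b2 tau by (intro power_mono mult_mono; simp)+
      moreover have "0 \<le> (\<tau> \<alpha>)^2 + \<tau> \<alpha> * (1 + \<beta>) + (1 + \<beta>)^2" using b2 tau by simp
      ultimately have "\<bar>h2\<bar> \<le> l * 20"
        unfolding abs_mult using b2 by (auto simp: abs_mult power2_eq_square intro!: mult_mono)
      then show ?thesis by simp
    qed
    \<comment> \<open>This fixes \<open>l\<close>: as \<open>\<alpha>\<close> runs,
      \<open>gam T (\<tau> \<alpha>)\<close> moves by at most \<open>20 * l\<close> relative to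
      \<open>(T\<^sup>2, T\<^sup>3)\<close>, and the average along \<open>sig\<close> must tolerate
      that displacement.\<close>
    moreover have "20 * l \<le> \<eta>^6 / 57600000" using \<eta> by (simp add: l)
    ultimately have h: "\<bar>h1\<bar> \<le> \<eta>^6 / 57600000" "\<bar>h2\<bar> \<le> \<eta>^6 / 57600000" using l0 by linarith+
    note R = sqrt_average_regular[OF \<eta> h, where v = a and T = T, folded F]
    define Q where "Q u = (\<integral>s. F (u - sig T s) - F (u + (T^2 * h1, T^3 * h2) - sig T s) \<partial>unif)" for u
    have Q: "integrable lborel (\<lambda>u. (Q u)\<^sup>2)" "(\<integral>u. (Q u)\<^sup>2 \<partial>lborel) \<le> 2 * \<eta>\<^sup>2 * mass"
      using R unfolding Q_def by auto
    have QF: "Q (z - gam T (\<tau> \<alpha>)) = Ft (z - gam T (\<tau> \<alpha>)) - Ft (z - gam T (1 + \<beta>))" for z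
    proof -
      have e: "z - gam T (\<tau> \<alpha>) + (T^2 * h1, T^3 * h2) = z - gam T (1 + \<beta>)"
        by (simp add: gam_def h1_def h2_def algebra_simps)
      have "Q u = Ft u - Ft (u + (T^2 * h1, T^3 * h2))" for u
        unfolding Q_def Ft_def using F1
        by (intro Bochner_Integration.integral_diff integrable_unif[where B = 1]) auto
      from this[of "z - gam T (\<tau> \<alpha>)"] show ?thesis unfolding e .
    qed
    have "J \<alpha> - J1 \<alpha> = (\<integral>z. g z * (Ft (z - gam T (\<tau> \<alpha>)) * g (z + c \<alpha> + a))
        - g z * (Ft (z - gam T (1 + \<beta>)) * g (z + c \<alpha> + a)) \<partial>lborel)"
      unfolding J_def J1_def
      using Ft1 g1 by (intro Bochner_Integration.integral_diff[symmetric] gk mult1) auto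
    also have "\<dots> = (\<integral>z. g z * (Q (z - gam T (\<tau> \<alpha>)) * g (z + c \<alpha> + a)) \<partial>lborel)"
      by (simp add: QF algebra_simps)
    \<comment> \<open>The weight \<open>\<eta>\<close> balances the square means
      \<open>2 * mass\<close> of \<open>g\<close> and \<open>2 * \<eta>\<^sup>2 * mass\<close> of
      \<open>Q\<close>.\<close>
    also have "\<bar>\<dots>\<bar> \<le> (\<eta> * (2 * mass) + (2 * \<eta>\<^sup>2 * mass) / \<eta>) / 2"
    proof (rule integral_mult_le_amgm)
      show "integrable lborel (\<lambda>x. (g x)\<^sup>2)" "(\<integral>x. (g x)\<^sup>2 \<partial>lborel) \<le> 2 * mass"
        using gfacts(5,6) by auto
      show "integrable lborel (\<lambda>x. (Q (x - gam T (\<tau> \<alpha>)))\<^sup>2)" "(\<integral>x. (Q (x - gam T (\<tau> \<alpha>)))\<^sup>2 \<partial>lborel) \<le> 2 * \<eta>\<^sup>2 * mass"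
        using integrable_translate[OF Q(1), of "- gam T (\<tau> \<alpha>)"] Q(2) by auto
      show "\<bar>g z * (Q (z - gam T (\<tau> \<alpha>)) * g (z + c \<alpha> + a))\<bar> \<le> \<bar>g z\<bar> * \<bar>Q (z - gam T (\<tau> \<alpha>))\<bar>" for z
        unfolding abs_mult using g1[of "z + c \<alpha> + a"] by (intro mult_left_mono mult_left_le) auto
    qed fact
    also have "\<dots> = 2 * \<eta> * mass" using \<eta> by (simp add: power2_eq_square)
    finally show ?thesis .
  qed
  have J1: "\<bar>\<integral>\<alpha>. J1 \<alpha> \<partial>unif\<bar> \<le> 2 * \<eta> * mass"
  proof -
    define A where "A z = (\<integral>\<alpha>. g (z + c \<alpha> + a) \<partial>unif)" for z
    have v1: "\<bar>\<beta> - \<beta>'\<bar> \<le> 1" using \<beta> by (simp add: abs_le_iff)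
    note R = parabola_average_regular[OF \<eta> l0(1,2) \<beta>(1) v v1 w, where a = a and T = T]
    have ce: "gam T (1 + \<beta> + l * \<alpha> - (\<beta> - \<beta>')) - gam T (1 + \<beta> + l * \<alpha>) = c \<alpha>" for \<alpha>
      unfolding c_def \<tau>_def \<tau>'_def by (rule arg_cong2[where f = minus]) (auto intro: arg_cong[where f = "gam T"])
    have ge: "f (z + c \<alpha> + a) - f (z + c \<alpha> + (T^2 * w1, T^3 * w2) + a) = g (z + c \<alpha> + a)" for z \<alpha>
      by (simp add: g Sw_def add_ac)
    have A: "integrable lborel (\<lambda>z. (A z)\<^sup>2)" "(\<integral>z. (A z)\<^sup>2 \<partial>lborel) \<le> 2 * \<eta>\<^sup>2 * mass"
      using R unfolding ce ge A_def by auto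
    have "(\<integral>\<alpha>. J1 \<alpha> \<partial>unif) = (\<integral>z. \<integral>\<alpha>. g z * (Ft (z - gam T (1 + \<beta>)) * g (z + c \<alpha> + a)) \<partial>unif \<partial>lborel)"
      unfolding J1_def
    proof (rule dominated_fubini(3)[where h = "\<lambda>x. \<bar>g x\<bar>" and a = "\<lambda>_. 0", OF prob_space_unif, symmetric])
      show "\<bar>g z * (Ft (z - gam T (1 + \<beta>)) * g (z + c \<alpha> + a))\<bar> \<le> \<bar>g (z + 0)\<bar>" for \<alpha> z
        using mult_left_mono[OF mult1[OF Ft1 g1], of "\<bar>g z\<bar>"] by (simp add: abs_mult)
      show "integrable lborel (\<lambda>x. \<bar>g x\<bar>)" using gfacts(3) by simp
    qed measurable
    also have "\<dots> = (\<integral>z. g z * (Ft (z - gam T (1 + \<beta>)) * A z) \<partial>lborel)"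
      by (simp add: A_def)
    also have "\<bar>\<dots>\<bar> \<le> (\<eta> * (2 * mass) + (2 * \<eta>\<^sup>2 * mass) / \<eta>) / 2"
    proof (rule integral_mult_le_amgm)
      show "integrable lborel (\<lambda>x. (g x)\<^sup>2)" "(\<integral>x. (g x)\<^sup>2 \<partial>lborel) \<le> 2 * mass"
        using gfacts(5,6) by auto
      show "\<bar>g z * (Ft (z - gam T (1 + \<beta>)) * A z)\<bar> \<le> \<bar>g z\<bar> * \<bar>A z\<bar>" for z
        unfolding abs_mult using Ft1[of "z - gam T (1 + \<beta>)"] by (intro mult_left_mono mult_left_le_one_le) auto
    qed (use A \<eta> in auto)
    also have "\<dots> = 2 * \<eta> * mass" using \<eta> by (simp add: power2_eq_square)
    finally show ?thesis .
  qed
  have "\<bar>\<integral>\<alpha>. J \<alpha> - J1 \<alpha> \<partial>unif\<bar> \<le> 2 * \<eta> * mass"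
    using J2 \<eta> mass_nonneg by (intro abs_integral_le_unif) auto
  then have "\<bar>\<integral>\<alpha>. J \<alpha> \<partial>unif\<bar> \<le> 4 * \<eta> * mass"
    using J1 Ji by simp
  then show ?thesis
    unfolding IJ[symmetric] I_def \<tau>_def \<tau>'_def a_def by simp
qed


text \<open>
  In \<open>lam T l g\<close> the parameter \<open>\<tau>\<close> is averaged in two steps, \<open>\<tau> = 1 + \<beta> + l * \<alpha>\<close>: Cauchy-Schwarz doubles
  only the coarse part \<open>\<beta>\<close>, and the fine part \<open>\<alpha>\<close> runs along the parabola for a fixed \<open>\<beta> - \<beta>'\<close>.
\<close>

definition lam :: "real \<Rightarrow> real \<Rightarrow> (real \<times> real \<Rightarrow> real) \<Rightarrow> real" where
  "lam T l g = (\<integral>y. \<integral>x. f x * f (x + lin T (1 + snd y + l * fst (fst y)) (snd (fst y)))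
      * g (x + (gam T (1 + snd y + l * fst (fst y)) + sig T (snd (fst y)))) \<partial>lborel \<partial>((unif \<Otimes>\<^sub>M unif) \<Otimes>\<^sub>M unif))"

text \<open>The smoothing inequality itself. In the doubled form the pairs with
  \<open>\<bar>\<beta> - \<beta>'\<bar> < \<eta>\<close> contribute at most
  \<open>4 * \<eta> * mass\<close> and \<open>box_bound\<close> gives the same for the others. The
  total \<open>8 * \<eta> * mass\<close> equals \<open>\<kappa>\<^sup>2 * mass\<close>, whence
  \<open>\<eta> = \<kappa>\<^sup>2 / 8\<close>.\<close>

lemma lam_diff_translate:
  fixes T \<kappa> \<eta> l w1 w2 :: real
  assumes \<kappa>: "0 < \<kappa>" "\<kappa> \<le> 1" and \<eta>: "\<eta> = \<kappa>\<^sup>2 / 8" and l: "l = \<eta>^6 / 10^10"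
    and w: "\<bar>w1\<bar> \<le> \<eta>^9 * l^6 / 900000" "\<bar>w2\<bar> \<le> \<eta>^9 * l^6 / 900000"
  shows "\<bar>lam T l (\<lambda>x. f x - f (x + (T^2 * w1, T^3 * w2)))\<bar> \<le> \<kappa> * mass"
proof -
  let ?W = "unif \<Otimes>\<^sub>M unif"
  have W: "prob_space ?W" by (intro prob_space_pair prob_space_unif)
  interpret W: prob_space ?W by (rule W)
  define g where "g x = f x - f (x + (T^2 * w1, T^3 * w2))" for x
  define Sw where "Sw = (T^2 * w1, T^3 * w2)"
  have g: "g x = f x - f (x + Sw)" for x by (simp add: g_def Sw_def)
  note gfacts = diff_translate[where w = Sw, folded g]
  have gm [measurable]: "g \<in> borel_measurable borel" unfolding g[abs_def] by measurable
  have g1: "\<bar>g x\<bar> \<le> 1" for x using gfacts(2)[of x] by simp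
  have "\<kappa>\<^sup>2 \<le> 1" using \<kappa> by (intro power_le_one) auto
  then have \<eta>0: "0 < \<eta>" "\<eta> \<le> 1" using \<kappa> by (auto simp: \<eta>)
  have fabs: "\<bar>f x\<bar> \<le> 1" for x by (rule f_abs)
  have mult1: "\<bar>p * q\<bar> \<le> 1" if "\<bar>p\<bar> \<le> 1" "\<bar>q\<bar> \<le> 1" for p q :: real
    using that by (simp add: abs_mult mult_le_one)
  have gk: "integrable lborel (\<lambda>x. g x * k x)" "\<bar>\<integral>x. g x * k x \<partial>lborel\<bar> \<le> 2 * mass"
    if "k \<in> borel_measurable borel" "\<And>x. \<bar>k x\<bar> \<le> 1" for k
    unfolding g using diff_translate_mult[OF that] by auto
  define a b where "a z \<beta> = lin T (1 + \<beta> + l * fst z) (snd z)" and "b z \<beta> = gam T (1 + \<beta> + l * fst z)"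
    for z :: "real \<times> real" and \<beta>
  have ab [measurable (raw)]: "(\<lambda>x. a (p x) (q x)) \<in> borel_measurable M" "(\<lambda>x. b (p x) (q x)) \<in> borel_measurable M"
    if [measurable]: "p \<in> M \<rightarrow>\<^sub>M ?W" "q \<in> borel_measurable M" for M :: "'z measure" and p q
  proof -
    have [measurable]: "(\<lambda>x. fst (p x)) \<in> borel_measurable M" "(\<lambda>x. snd (p x)) \<in> borel_measurable M"
      using measurable_compose[OF that(1) measurable_fst] measurable_compose[OF that(1) measurable_snd]
      by (simp_all add: measurable_cong_sets[OF refl sets_unif])
    show "(\<lambda>x. a (p x) (q x)) \<in> borel_measurable M" "(\<lambda>x. b (p x) (q x)) \<in> borel_measurable M"
      unfolding a_def b_def by measurable
  qed
  have Wconst [measurable (raw)]: "(\<lambda>x. z) \<in> M \<rightarrow>\<^sub>M ?W" for z and M :: "'z measure"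
    by (rule measurable_const) (simp add: space_pair_measure)
  \<comment> \<open>Here \<open>y\<close> is the middle point \<open>x + a z \<beta>\<close>, so the
    factor removed by Cauchy-Schwarz becomes \<open>f y\<close>, free of all parameters.\<close>
  define \<Phi>0 where "\<Phi>0 z \<beta> y = f (y - a z \<beta>) * g (y - a z \<beta> + (b z \<beta> + sig T (snd z)))" for z \<beta> y
  define \<Phi> where "\<Phi> z y = (\<integral>\<beta>. \<Phi>0 z \<beta> y \<partial>unif)" for z y
  have \<Phi>01: "\<bar>\<Phi>0 z \<beta> y\<bar> \<le> 1" for z \<beta> y unfolding \<Phi>0_def by (intro mult1 fabs g1)
  have \<Phi>0m [measurable (raw)]: "(\<lambda>x. \<Phi>0 (p x) (q x) (r x)) \<in> borel_measurable M"
    if [measurable]: "p \<in> M \<rightarrow>\<^sub>M ?W" "q \<in> borel_measurable M" "r \<in> borel_measurable M" for M :: "'z measure" and p q r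
  proof -
    have [measurable]: "(\<lambda>x. snd (p x)) \<in> borel_measurable M"
      using measurable_compose[OF that(1) measurable_snd] by (simp add: measurable_cong_sets[OF refl sets_unif])
    show ?thesis unfolding \<Phi>0_def by measurable
  qed
  define L where "L z = (\<integral>\<beta>. \<integral>x. f x * f (x + a z \<beta>) * g (x + (b z \<beta> + sig T (snd z))) \<partial>lborel \<partial>unif)" for z
  have L: "L z = (\<integral>y. f y * \<Phi> z y \<partial>lborel)" for z
  proof -
    have le: "\<bar>f y * \<Phi>0 z \<beta> y\<bar> \<le> f (y + 0)" for \<beta> y
      using mult_left_mono[OF \<Phi>01[of z \<beta> y], of "\<bar>f y\<bar>"] nonneg[of y] by (simp add: abs_mult)
    note DF = dominated_fubini[where H = "\<lambda>\<beta> y. f y * \<Phi>0 z \<beta> y" and h = f and a = "\<lambda>_. 0", OF prob_space_unif _ int le]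
    have D: "integrable lborel (\<lambda>y. f y * \<Phi>0 z \<beta> y)"
      "(\<integral>y. \<integral>\<beta>. f y * \<Phi>0 z \<beta> y \<partial>unif \<partial>lborel) = (\<integral>\<beta>. \<integral>y. f y * \<Phi>0 z \<beta> y \<partial>lborel \<partial>unif)" for \<beta>
      by (rule DF(1) DF(3); simp)+
    have "(\<integral>x. f x * f (x + a z \<beta>) * g (x + (b z \<beta> + sig T (snd z))) \<partial>lborel) = (\<integral>y. f y * \<Phi>0 z \<beta> y \<partial>lborel)" for \<beta>
      using integrable_translate(2)[OF D(1)[of \<beta>], of "a z \<beta>"] by (simp add: \<Phi>0_def mult_ac)
    then show ?thesis
      unfolding L_def \<Phi>_def using D(2) by simp
  qed
  define F where "F v x = f x * f (x + (T * v, 0))" for v x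
  have F1: "\<bar>F v x\<bar> \<le> 1" for v x unfolding F_def by (intro mult1 fabs)
  have [measurable]: "F v \<in> borel_measurable borel" for v unfolding F_def[abs_def] by measurable
  define Y where "Y z p = (\<integral>y. \<Phi>0 z (fst p) y * \<Phi>0 z (snd p) y \<partial>lborel)" for z and p :: "real \<times> real"
  have pi: "integrable lborel (\<lambda>y. \<bar>g (y + c)\<bar>)" for c
    using integrable_translate(1)[OF gfacts(3), of c] by simp
  have N: "integrable lborel (\<lambda>y. (\<Phi> z y)\<^sup>2)" "(\<integral>y. (\<Phi> z y)\<^sup>2 \<partial>lborel) = (\<integral>p. Y z p \<partial>?W)" for z
  proof -
    have sq: "(\<Phi> z y)\<^sup>2 = (\<integral>p. \<Phi>0 z (fst p) y * \<Phi>0 z (snd p) y \<partial>?W)" for y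
    proof -
      have "(\<integral>p. \<Phi>0 z (fst p) y * \<Phi>0 z (snd p) y \<partial>?W) = (\<integral>\<beta>. \<integral>\<beta>'. \<Phi>0 z \<beta> y * \<Phi>0 z \<beta>' y \<partial>unif \<partial>unif)"
        by (rule prob_iterated[where B = 1 and \<phi> = "\<lambda>\<beta> \<beta>'. \<Phi>0 z \<beta> y * \<Phi>0 z \<beta>' y"])
           (auto intro!: prob_space_unif mult1 \<Phi>01)
      then show ?thesis by (simp add: \<Phi>_def power2_eq_square)
    qed
    have le: "\<bar>\<Phi>0 z (fst p) y * \<Phi>0 z (snd p) y\<bar> \<le> \<bar>g (y + (b z (fst p) + sig T (snd z) - a z (fst p)))\<bar>" for p y
    proof -
      have "\<bar>\<Phi>0 z (fst p) y * \<Phi>0 z (snd p) y\<bar> = \<bar>g (y - a z (fst p) + (b z (fst p) + sig T (snd z)))\<bar> * \<bar>f (y - a z (fst p)) * \<Phi>0 z (snd p) y\<bar>"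
        by (simp add: \<Phi>0_def abs_mult mult_ac)
      also have "\<dots> \<le> \<bar>g (y - a z (fst p) + (b z (fst p) + sig T (snd z)))\<bar>"
        by (intro mult_left_le mult1 fabs \<Phi>01) auto
      finally show ?thesis by (simp add: algebra_simps)
    qed
    note DF = dominated_fubini[where H = "\<lambda>p y. \<Phi>0 z (fst p) y * \<Phi>0 z (snd p) y" and h = "\<lambda>x. \<bar>g x\<bar>", OF W _ integrable_abs[OF gfacts(3)] le]
    have D: "integrable lborel (\<lambda>y. \<integral>p. \<Phi>0 z (fst p) y * \<Phi>0 z (snd p) y \<partial>?W)"
      "(\<integral>y. \<integral>p. \<Phi>0 z (fst p) y * \<Phi>0 z (snd p) y \<partial>?W \<partial>lborel) = (\<integral>p. \<integral>y. \<Phi>0 z (fst p) y * \<Phi>0 z (snd p) y \<partial>lborel \<partial>?W)"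
      by (rule DF(2) DF(3); simp)+
    show "integrable lborel (\<lambda>y. (\<Phi> z y)\<^sup>2)" unfolding sq by (rule D)
    show "(\<integral>y. (\<Phi> z y)\<^sup>2 \<partial>lborel) = (\<integral>p. Y z p \<partial>?W)" unfolding sq Y_def by (rule D)
  qed
  have Y: "Y z p = (\<integral>u. F (fst p - snd p) (u - sig T (snd z)) * g (u + gam T (1 + fst p + l * fst z))
      * g (u + (T * (fst p - snd p), 0) + gam T (1 + snd p + l * fst z)) \<partial>lborel)" (is "_ = (\<integral>u. ?Y u \<partial>lborel)")
    and Y2: "\<bar>Y z p\<bar> \<le> 2 * mass" for z p
  proof -
    let ?G = "\<lambda>y. \<Phi>0 z (fst p) y * \<Phi>0 z (snd p) y"
    \<comment> \<open>This recentring puts a bare \<open>g\<close> in front, which yields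
      integrability and the trivial bound \<open>2 * mass\<close>; a different recentring below
      produces the shape treated in \<open>box_bound\<close>.\<close>
    let ?s = "a z (fst p) - b z (fst p) - sig T (snd z)"
    have eq: "\<Phi>0 z (fst p) (x + ?s) * \<Phi>0 z (snd p) (x + ?s) = g x * (f (x - b z (fst p) - sig T (snd z)) * \<Phi>0 z (snd p) (x + ?s))" for x
      by (simp add: \<Phi>0_def algebra_simps)
    have k: "integrable lborel (\<lambda>x. g x * (f (x - b z (fst p) - sig T (snd z)) * \<Phi>0 z (snd p) (x + ?s)))"
      "\<bar>\<integral>x. g x * (f (x - b z (fst p) - sig T (snd z)) * \<Phi>0 z (snd p) (x + ?s)) \<partial>lborel\<bar> \<le> 2 * mass"
      by (intro gk mult1 fabs \<Phi>01; measurable)+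
    have G: "integrable lborel (\<lambda>x. ?G (x + ?s))" "\<bar>\<integral>x. ?G (x + ?s) \<partial>lborel\<bar> \<le> 2 * mass"
      unfolding eq by (rule k)+
    have iG: "integrable lborel ?G" using integrable_translate(1)[OF G(1), of "- ?s"] by (simp add: algebra_simps)
    show "\<bar>Y z p\<bar> \<le> 2 * mass" unfolding Y_def using G(2) integrable_translate(2)[OF iG, of ?s] by simp
    have "?G (u + (a z (fst p) - sig T (snd z))) = ?Y u" for u
    proof -
      \<comment> \<open>Both linear shifts share the same \<open>\<alpha>\<close> and
        \<open>s\<close>, so their difference is the constant
        \<open>(T * (\<beta> - \<beta>'), 0)\<close>.\<close>
      have e: "u + (a z (fst p) - sig T (snd z)) - a z (snd p) = u - sig T (snd z) + (T * (fst p - snd p), 0)"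
        by (simp add: a_def lin_def algebra_simps)
      have e': "u + (a z (fst p) - sig T (snd z)) - a z (fst p) = u - sig T (snd z)" by simp
      show ?thesis
        unfolding \<Phi>0_def e e' F_def b_def by (simp add: algebra_simps)
    qed
    then show "Y z p = (\<integral>u. ?Y u \<partial>lborel)"
      unfolding Y_def using integrable_translate(2)[OF iG, of "a z (fst p) - sig T (snd z)"] by simp
  qed
  have Ym [measurable]: "(\<lambda>(z, p). Y z p) \<in> borel_measurable (?W \<Otimes>\<^sub>M ?W)"
    unfolding Y_def by measurable
  have Qm: "(\<lambda>p. \<integral>z. Y z p \<partial>?W) \<in> borel_measurable ?W" by measurable
  have pe: "(\<lambda>(\<beta>, \<beta>'). \<integral>z. Y z (\<beta>, \<beta>') \<partial>?W) = (\<lambda>p. \<integral>z. Y z p \<partial>?W)" by auto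
  have "(\<integral>z. \<integral>p. Y z p \<partial>?W \<partial>?W) = (\<integral>p. \<integral>z. Y z p \<partial>?W \<partial>?W)"
    by (rule prob_swap[OF W W _ Y2]) simp
  also have "\<dots> = (\<integral>p. (\<lambda>\<beta> \<beta>'. \<integral>z. Y z (\<beta>, \<beta>') \<partial>?W) (fst p) (snd p) \<partial>?W)" by simp
  also have "\<dots> = (\<integral>\<beta>. \<integral>\<beta>'. \<integral>z. Y z (\<beta>, \<beta>') \<partial>?W \<partial>unif \<partial>unif)"
    by (rule prob_iterated[where B = "2 * mass", OF prob_space_unif prob_space_unif])
       (use mass_nonneg Y2 Qm in \<open>auto simp only: pe intro!: W.abs_integral_le\<close>)
  also have "\<bar>\<dots>\<bar> \<le> 4 * \<eta> * mass + 2 * \<eta> * (2 * mass)"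
  proof (rule abs_integral_le_unif)
    fix \<beta> :: real assume \<beta>: "\<beta> \<in> {0..1}"
    show "\<bar>\<integral>\<beta>'. \<integral>z. Y z (\<beta>, \<beta>') \<partial>?W \<partial>unif\<bar> \<le> 4 * \<eta> * mass + 2 * \<eta> * (2 * mass)"
    proof (rule integral_unif_off_diag[where s = \<beta>])
      show "\<bar>\<integral>z. Y z (\<beta>, \<beta>') \<partial>?W\<bar> \<le> 2 * mass" for \<beta>'
        using mass_nonneg Y2 by (auto intro!: prob_space.abs_integral_le[OF W])
      show "\<bar>\<integral>z. Y z (\<beta>, \<beta>') \<partial>?W\<bar> \<le> 4 * \<eta> * mass" if "\<beta>' \<in> {0..1}" "\<eta> \<le> \<bar>\<beta>' - \<beta>\<bar>" for \<beta>'
      proof -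
        have "\<eta> \<le> \<bar>\<beta> - \<beta>'\<bar>" using that by linarith
        from box_bound[OF \<eta>0 l \<beta> that(1) this w, of T] show ?thesis
          unfolding Y F_def g_def by simp
      qed
    qed (use \<eta>0 mass_nonneg in auto)
  qed (use \<eta>0 mass_nonneg in auto)
  also have "\<dots> = \<kappa>\<^sup>2 * mass" by (simp add: \<eta>)
  finally have NN: "\<bar>\<integral>z. \<integral>p. Y z p \<partial>?W \<partial>?W\<bar> \<le> \<kappa>\<^sup>2 * mass" .
  have iN: "integrable ?W (\<lambda>z. \<integral>p. Y z p \<partial>?W)"
    by (rule prob_space.integrable_bounded[OF W, where B = "2 * mass"])
       (use mass_nonneg Y2 in \<open>auto intro!: prob_space.abs_integral_le[OF W]\<close>)
  have f2: "integrable lborel (\<lambda>x. (f x)\<^sup>2)" "(\<integral>x. (f x)\<^sup>2 \<partial>lborel) \<le> mass"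
  proof -
    have sq: "(f x)\<^sup>2 \<le> f x" for x using nonneg le1 by (simp add: power2_eq_square mult_left_le)
    show i: "integrable lborel (\<lambda>x. (f x)\<^sup>2)"
      by (rule Bochner_Integration.integrable_bound[OF int]) (use sq nonneg in auto)
    show "(\<integral>x. (f x)\<^sup>2 \<partial>lborel) \<le> mass"
      unfolding mass_def using i int sq by (rule integral_mono)
  qed
  \<comment> \<open>The weight \<open>\<kappa>\<close> is the same for all \<open>z\<close>, since
    the doubled form \<open>Y\<close> is known to be small only after averaging in
    \<open>z\<close>.\<close>
  have Lb: "\<bar>L z\<bar> \<le> (\<kappa> * mass + (\<integral>p. Y z p \<partial>?W) / \<kappa>) / 2" for z
    unfolding L N(2)[symmetric]
    by (rule integral_mult_le_amgm[OF f2 N(1) order.refl]) (use \<kappa> in \<open>simp_all add: abs_mult\<close>)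
  have "\<bar>\<integral>z. L z \<partial>?W\<bar> \<le> (\<integral>z. (\<kappa> * mass + (\<integral>p. Y z p \<partial>?W) / \<kappa>) / 2 \<partial>?W)"
  proof (rule integral_abs_bound_integral)
    have Lm: "L \<in> borel_measurable ?W" unfolding L_def[abs_def] by measurable
    have lb: "\<bar>L z\<bar> \<le> \<bar>(\<kappa> * mass + (\<integral>p. Y z p \<partial>?W) / \<kappa>) / 2\<bar>" for z
      using order_trans[OF Lb abs_ge_self] .
    show i: "integrable ?W (\<lambda>z. (\<kappa> * mass + (\<integral>p. Y z p \<partial>?W) / \<kappa>) / 2)"
      using iN prob_space.finite_measure[OF W] by (auto intro!: finite_measure.integrable_const)
    show "integrable ?W L"
      by (rule Bochner_Integration.integrable_bound[OF i Lm]) (use lb in \<open>auto simp only: real_norm_def intro!: AE_I2\<close>)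
  qed (use Lb in auto)
  also have "\<dots> = (\<kappa> * mass + (\<integral>z. \<integral>p. Y z p \<partial>?W \<partial>?W) / \<kappa>) / 2"
    using iN prob_space.prob_space[OF W] prob_space.finite_measure[OF W] by (simp add: finite_measure.integrable_const)
  also have "\<dots> \<le> (\<kappa> * mass + (\<kappa>\<^sup>2 * mass) / \<kappa>) / 2"
    using NN \<kappa> by (intro divide_right_mono add_left_mono) auto
  also have "\<dots> = \<kappa> * mass" using \<kappa> by (simp add: power2_eq_square)
  finally have main: "\<bar>\<integral>z. L z \<partial>?W\<bar> \<le> \<kappa> * mass" .
  let ?M = "\<lambda>z \<beta>. \<integral>x. f x * f (x + a z \<beta>) * g (x + (b z \<beta> + sig T (snd z))) \<partial>lborel"
  have Mb: "\<bar>?M z \<beta>\<bar> \<le> mass" for z \<beta>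
    unfolding mass_def
  proof (rule dominated_fubini(4)[where M = unif and h = f and a = "\<lambda>_. 0" and w = \<beta>
        and H = "\<lambda>\<beta> x. f x * f (x + a z \<beta>) * g (x + (b z \<beta> + sig T (snd z)))", OF prob_space_unif _ int])
    show "\<bar>f x * f (x + a z \<beta>) * g (x + (b z \<beta> + sig T (snd z)))\<bar> \<le> f (x + 0)" for \<beta> x
      using mult_left_mono[OF mult1[OF fabs g1], of "\<bar>f x\<bar>"] nonneg[of x] by (simp add: abs_mult mult.assoc)
  qed simp_all
  have "lam T l g = (\<integral>z. \<integral>\<beta>. ?M z \<beta> \<partial>unif \<partial>?W)"
    using prob_iterated[where \<phi> = ?M, OF W prob_space_unif _ Mb]
    unfolding lam_def a_def b_def by simp
  then show ?thesis
    using main unfolding L_def g_def[abs_def] by simp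
qed

end

section \<open>Local averages and their energy\<close>

lemma (in prob_space) square_integral_le:
  fixes \<phi> :: "'a \<Rightarrow> real"
  assumes [measurable]: "\<phi> \<in> borel_measurable M" and B: "\<And>t. t \<in> space M \<Longrightarrow> \<bar>\<phi> t\<bar> \<le> 1"
  shows "(\<integral>t. \<phi> t \<partial>M)\<^sup>2 \<le> (\<integral>t. (\<phi> t)\<^sup>2 \<partial>M)"
proof -
  have i: "integrable M \<phi>" by (rule integrable_bounded[where B = 1]) (use B in auto)
  have i2: "integrable M (\<lambda>t. (\<phi> t)\<^sup>2)"
    by (rule integrable_bounded[where B = 1]) (use B in \<open>auto simp: abs_square_le_1\<close>)
  have "0 \<le> variance \<phi>" by (rule variance_positive)
  then show ?thesis using variance_eq[OF i i2] by simp
qed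

lemma AE_prob_pair:
  assumes "prob_space M" "prob_space N" "AE x in M. R x" "AE y in N. S y"
    and [measurable]: "Measurable.pred M R" "Measurable.pred N S"
  shows "AE z in M \<Otimes>\<^sub>M N. R (fst z) \<and> S (snd z)"
proof -
  interpret pair_prob_space M N
    using assms(1,2) by (simp add: pair_prob_space_def pair_sigma_finite_def prob_space_imp_sigma_finite)
  show ?thesis
  proof (rule AE_pair_measure)
    show "AE x in M. AE y in N. R (fst (x, y)) \<and> S (snd (x, y))"
      using assms(3)
    proof eventually_elim
      case (elim x)
      show ?case using assms(4) by eventually_elim (use elim in simp)
    qed
  qed measurable
qed

abbreviation unif2 :: "(real \<times> real) measure" where
  "unif2 \<equiv> unif \<Otimes>\<^sub>M unif"

lemma prob_space_unif2: "prob_space unif2"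
  by (intro prob_space_pair prob_space_unif)

interpretation unif2: prob_space unif2
  by (rule prob_space_unif2)

lemma space_unif2 [simp]: "space unif2 = UNIV"
  by (simp add: space_pair_measure)

lemma AE_unif2: "AE w in unif2. fst w \<in> {0..1} \<and> snd w \<in> {0..1}"
  by (rule AE_prob_pair[OF prob_space_unif prob_space_unif AE_unif AE_unif]) measurable

definition scl :: "real \<Rightarrow> real \<Rightarrow> real \<times> real \<Rightarrow> real \<times> real" where
  "scl p q w = (p * fst w, q * snd w)"

lemma scl_simps: "scl p q (v + w) = scl p q v + scl p q w" "scl p q (v - w) = scl p q v - scl p q w"
  by (simp_all add: scl_def algebra_simps)

lemma measurable_unif2_fst_snd [measurable (raw)]:
  assumes "w \<in> M \<rightarrow>\<^sub>M unif2"
  shows "(\<lambda>x. fst (w x)) \<in> borel_measurable M" "(\<lambda>x. snd (w x)) \<in> borel_measurable M"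
  using measurable_compose[OF assms measurable_fst] measurable_compose[OF assms measurable_snd]
  by (simp_all add: measurable_cong_sets[OF refl sets_unif])

lemma measurable_scl [measurable (raw)]:
  assumes [measurable]: "w \<in> M \<rightarrow>\<^sub>M unif2"
  shows "(\<lambda>x. scl p q (w x)) \<in> borel_measurable M"
  unfolding scl_def by measurable

context density_profile
begin

definition bav :: "real \<Rightarrow> real \<Rightarrow> real \<times> real \<Rightarrow> real" where
  "bav p q x = (\<integral>w. f (x + scl p q w) \<partial>unif2)"

text \<open>The one-sided box average followed by its adjoint. The resulting operator is symmetric
  and positive, so its quadratic form \<open>energy\<close> is the square norm of \<open>bav\<close>
  and behaves well under a change of window.\<close>

definition tav :: "real \<Rightarrow> real \<Rightarrow> real \<times> real \<Rightarrow> real" where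
  "tav p q x = (\<integral>w. bav p q (x - scl p q w) \<partial>unif2)"

definition energy :: "real \<Rightarrow> real \<Rightarrow> real" where
  "energy p q = (\<integral>x. f x * tav p q x \<partial>lborel)"

lemma bav_measurable [measurable]: "bav p q \<in> borel_measurable borel"
  unfolding bav_def[abs_def] by measurable

lemma tav_measurable [measurable]: "tav p q \<in> borel_measurable borel"
  unfolding tav_def[abs_def] by measurable

lemma bav_bounds: "0 \<le> bav p q x" "bav p q x \<le> 1" "\<bar>bav p q x\<bar> \<le> 1"
proof -
  show 0: "0 \<le> bav p q x"
    unfolding bav_def using nonneg by (simp add: integral_nonneg_AE)
  show "\<bar>bav p q x\<bar> \<le> 1"
    unfolding bav_def using f_abs by (intro unif2.abs_integral_le) auto
  then show "bav p q x \<le> 1" by simp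
qed

lemma tav_bounds: "0 \<le> tav p q x" "tav p q x \<le> 1" "\<bar>tav p q x\<bar> \<le> 1"
proof -
  show 0: "0 \<le> tav p q x"
    unfolding tav_def using bav_bounds(1) by (simp add: integral_nonneg_AE)
  show "\<bar>tav p q x\<bar> \<le> 1"
    unfolding tav_def using bav_bounds by (intro unif2.abs_integral_le) auto
  then show "tav p q x \<le> 1" by simp
qed

lemma tav_eq: "tav p q x = (\<integral>\<omega>. f (x + scl p q (snd \<omega> - fst \<omega>)) \<partial>(unif2 \<Otimes>\<^sub>M unif2))"
proof -
  have "(\<integral>\<omega>. f (x - scl p q (fst \<omega>) + scl p q (snd \<omega>)) \<partial>(unif2 \<Otimes>\<^sub>M unif2)) = tav p q x"
    unfolding tav_def bav_def using f_abs
    by (intro prob_iterated[where \<phi> = "\<lambda>v w. f (x - scl p q v + scl p q w)" and B = 1] prob_space_unif2) auto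
  then show ?thesis by (simp add: scl_simps algebra_simps)
qed

text \<open>The displacement is measured in units of the window, and the two coordinates are
  translated one after the other.\<close>

lemma bav_shift: "\<bar>bav p q (x + scl p q h) - bav p q x\<bar> \<le> 2 * \<bar>fst h\<bar> + 2 * \<bar>snd h\<bar>"
proof -
  define k where "k s t = f (x + (p * s, q * t))" for s t
  have [measurable]: "(\<lambda>(s, t). k s t) \<in> borel_measurable (borel \<Otimes>\<^sub>M borel)" unfolding k_def by measurable
  have k1: "\<bar>k s t\<bar> \<le> 1" for s t unfolding k_def by (rule f_abs)
  have "bav p q (x + scl p q h) = (\<integral>w. k (fst w + fst h) (snd w + snd h) \<partial>unif2)"
    by (simp add: bav_def scl_def k_def algebra_simps)
  also have "\<dots> = (\<integral>s. \<integral>t. k (s + fst h) (t + snd h) \<partial>unif \<partial>unif)"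
    using k1 by (intro prob_iterated[where \<phi> = "\<lambda>s t. k (s + fst h) (t + snd h)" and B = 1] prob_space_unif) auto
  finally have 1: "bav p q (x + scl p q h) = (\<integral>s. \<integral>t. k (s + fst h) (t + snd h) \<partial>unif \<partial>unif)" .
  have "bav p q x = (\<integral>w. k (fst w) (snd w) \<partial>unif2)"
    by (simp add: bav_def scl_def k_def)
  also have "\<dots> = (\<integral>s. \<integral>t. k s t \<partial>unif \<partial>unif)"
    using k1 by (intro prob_iterated[where \<phi> = k and B = 1] prob_space_unif) auto
  finally have 2: "bav p q x = (\<integral>s. \<integral>t. k s t \<partial>unif \<partial>unif)" .
  have ik: "\<bar>\<integral>t. k s (t + b) \<partial>unif\<bar> \<le> 1" for s b using k1 by (intro abs_integral_le_unif) auto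
  have i: "integrable unif (\<lambda>s. \<integral>t. k (s + a) (t + b) \<partial>unif)" for a b
    by (rule integrable_unif[where B = 1]) (use ik in auto)
  have "\<bar>(\<integral>s. \<integral>t. k (s + fst h) (t + snd h) \<partial>unif \<partial>unif) - (\<integral>s. \<integral>t. k s (t + snd h) \<partial>unif \<partial>unif)\<bar> \<le> 2 * 1 * \<bar>fst h\<bar>"
    by (rule integral_unif_shift[of "\<lambda>s. \<integral>t. k s (t + snd h) \<partial>unif"]) (use ik in auto)
  moreover have "\<bar>\<integral>s. (\<integral>t. k s (t + snd h) \<partial>unif) - (\<integral>t. k s t \<partial>unif) \<partial>unif\<bar> \<le> 2 * 1 * \<bar>snd h\<bar>"
    using k1 by (intro abs_integral_le_unif integral_unif_shift) auto
  ultimately show ?thesis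
    unfolding 1 2 using i[of 0 "snd h"] i[of 0 0] by simp
qed

lemma tav_shift: "\<bar>tav p q (x + scl p q h) - tav p q x\<bar> \<le> 2 * \<bar>fst h\<bar> + 2 * \<bar>snd h\<bar>"
proof -
  have i: "integrable unif2 (\<lambda>w. bav p q (y - scl p q w))" for y
    using bav_bounds by (intro unif2.integrable_bounded[where B = 1]) auto
  have "tav p q (x + scl p q h) - tav p q x = (\<integral>w. bav p q (x + scl p q h - scl p q w) - bav p q (x - scl p q w) \<partial>unif2)"
    unfolding tav_def using i by simp
  also have "\<bar>\<dots>\<bar> \<le> 2 * \<bar>fst h\<bar> + 2 * \<bar>snd h\<bar>"
  proof (rule unif2.abs_integral_le)
    show "\<bar>bav p q (x + scl p q h - scl p q w) - bav p q (x - scl p q w)\<bar> \<le> 2 * \<bar>fst h\<bar> + 2 * \<bar>snd h\<bar>" for w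
      using bav_shift[of p q "x - scl p q w" h] by (simp add: algebra_simps)
  qed simp
  finally show ?thesis .
qed

lemma bav_integrable: "integrable lborel (bav p q)"
  unfolding bav_def[abs_def]
  by (rule dominated_fubini(2)[where h = f and a = "scl p q", OF prob_space_unif2 _ int]) (use nonneg in auto)

lemma bav_sq_integrable: "integrable lborel (\<lambda>x. (bav p q x)\<^sup>2)"
  by (rule Bochner_Integration.integrable_bound[OF bav_integrable[of p q]])
     (use bav_bounds in \<open>auto simp: power2_eq_square abs_mult mult_left_le\<close>)

text \<open>The adjoint in \<open>tav\<close> is moved onto \<open>f\<close>: for each
  \<open>w\<close>, translating by \<open>scl p q w\<close> takes the shift from \<open>bav\<close>
  to \<open>f\<close>, and averaging in \<open>w\<close> produces a second
  \<open>bav\<close>.\<close>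

lemma energy_eq: "energy p q = (\<integral>x. (bav p q x)\<^sup>2 \<partial>lborel)"
proof -
  note D1 = dominated_fubini[where M = unif2 and H = "\<lambda>w x. f x * bav p q (x - scl p q w)" and h = f and a = "\<lambda>_. 0", OF prob_space_unif2 _ int]
  note D2 = dominated_fubini[where M = unif2 and H = "\<lambda>w x. f (x + scl p q w) * bav p q x" and h = f and a = "scl p q", OF prob_space_unif2 _ int]
  have le1: "\<bar>f x * bav p q y\<bar> \<le> f x" for x y
    using nonneg[of x] bav_bounds[of p q y] by (simp add: abs_mult mult_left_le)
  have "energy p q = (\<integral>x. \<integral>w. f x * bav p q (x - scl p q w) \<partial>unif2 \<partial>lborel)"
    by (simp add: energy_def tav_def)
  also have "\<dots> = (\<integral>w. \<integral>x. f x * bav p q (x - scl p q w) \<partial>lborel \<partial>unif2)"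
    by (rule D1(3)) (use le1 in auto)
  also have "\<dots> = (\<integral>w. \<integral>x. f (x + scl p q w) * bav p q x \<partial>lborel \<partial>unif2)"
  proof (rule Bochner_Integration.integral_cong[OF refl])
    fix w
    have "integrable lborel (\<lambda>x. f x * bav p q (x - scl p q w))"
      by (rule D1(1)) (use le1 in auto)
    from integrable_translate(2)[OF this, of "scl p q w"]
    show "(\<integral>x. f x * bav p q (x - scl p q w) \<partial>lborel) = (\<integral>x. f (x + scl p q w) * bav p q x \<partial>lborel)" by simp
  qed
  also have "\<dots> = (\<integral>x. \<integral>w. f (x + scl p q w) * bav p q x \<partial>unif2 \<partial>lborel)"
    by (rule D2(3)[symmetric]) (use le1 in auto)
  also have "\<dots> = (\<integral>x. (bav p q x)\<^sup>2 \<partial>lborel)"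
    by (simp add: bav_def power2_eq_square)
  finally show ?thesis .
qed

lemma tav_sq: "integrable lborel (\<lambda>x. (tav p q x)\<^sup>2)" "(\<integral>x. (tav p q x)\<^sup>2 \<partial>lborel) \<le> energy p q"
proof -
  have ti: "integrable lborel (tav p q)"
    unfolding tav_def[abs_def]
    by (rule dominated_fubini(2)[where h = "bav p q" and a = "\<lambda>w. - scl p q w", OF prob_space_unif2 _ bav_integrable])
       (use bav_bounds in auto)
  show i: "integrable lborel (\<lambda>x. (tav p q x)\<^sup>2)"
    by (rule Bochner_Integration.integrable_bound[OF ti])
       (use tav_bounds in \<open>auto simp: power2_eq_square abs_mult mult_left_le\<close>)
  note D = dominated_fubini[where M = unif2 and H = "\<lambda>w x. (bav p q (x - scl p q w))\<^sup>2" and h = "\<lambda>x. (bav p q x)\<^sup>2" and a = "\<lambda>w. - scl p q w",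
      OF prob_space_unif2 _ bav_sq_integrable]
  have "(\<integral>x. (tav p q x)\<^sup>2 \<partial>lborel) \<le> (\<integral>x. \<integral>w. (bav p q (x - scl p q w))\<^sup>2 \<partial>unif2 \<partial>lborel)"
  proof (rule integral_mono[OF i])
    show "integrable lborel (\<lambda>x. \<integral>w. (bav p q (x - scl p q w))\<^sup>2 \<partial>unif2)"
      by (rule D(2)) auto
    show "(tav p q x)\<^sup>2 \<le> (\<integral>w. (bav p q (x - scl p q w))\<^sup>2 \<partial>unif2)" for x
      unfolding tav_def using bav_bounds by (intro unif2.square_integral_le) auto
  qed
  also have "\<dots> = (\<integral>w. \<integral>x. (bav p q (x - scl p q w))\<^sup>2 \<partial>lborel \<partial>unif2)"
    by (rule D(3)) auto
  also have "\<dots> = (\<integral>w. energy p q \<partial>unif2)"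
    using integrable_translate(2)[OF bav_sq_integrable, of p q "- scl p q _"] by (simp add: energy_eq)
  also have "\<dots> = energy p q" using unif2.prob_space by simp
  finally show "(\<integral>x. (tav p q x)\<^sup>2 \<partial>lborel) \<le> energy p q" .
qed

lemma energy_bounds: "0 \<le> energy p q" "energy p q \<le> mass"
proof -
  have le: "0 \<le> f x * tav p q x" "f x * tav p q x \<le> f x" for x
    using nonneg[of x] tav_bounds[of p q x] by (auto simp: mult_left_le)
  have i: "integrable lborel (\<lambda>x. f x * tav p q x)"
    by (rule Bochner_Integration.integrable_bound[OF int]) (use le nonneg in auto)
  show "0 \<le> energy p q" unfolding energy_def using le by (simp add: integral_nonneg_AE)
  show "energy p q \<le> mass" unfolding energy_def mass_def using i int le(2) by (rule integral_mono)
qed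

text \<open>Expand the square. Both square terms are bounded by energies. In the mixed term the fine
  average is moved onto the coarse \<open>tav p q\<close>, which hardly changes under displacements
  smaller than \<open>\<theta>\<close> windows, so the mixed term is at least
  \<open>energy p q - 4 * \<theta> * mass\<close>.\<close>

lemma tav_diff_energy:
  assumes \<theta>: "0 < \<theta>" and p: "0 < p" "0 \<le> p'" "p' \<le> \<theta> * p" and q: "0 < q" "0 \<le> q'" "q' \<le> \<theta> * q"
  shows "integrable lborel (\<lambda>x. (tav p' q' x - tav p q x)\<^sup>2)"
    and "(\<integral>x. (tav p' q' x - tav p q x)\<^sup>2 \<partial>lborel) \<le> energy p' q' - energy p q + 8 * \<theta> * mass"
proof -
  let ?W = "unif2 \<Otimes>\<^sub>M unif2"
  have W: "prob_space ?W" by (intro prob_space_pair prob_space_unif2)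
  interpret W: prob_space ?W by (rule W)
  define v where "v \<omega> = scl p' q' (snd \<omega> - fst \<omega>)" for \<omega> :: "(real \<times> real) \<times> (real \<times> real)"
  have [measurable]: "v \<in> borel_measurable ?W"
    unfolding v_def[abs_def] scl_simps by measurable
  have le: "\<bar>tav p q y * f x\<bar> \<le> f x" for x y
    using nonneg[of x] tav_bounds[of p q y] by (simp add: abs_mult mult_left_le_one_le)
  note D = dominated_fubini[where M = ?W and H = "\<lambda>\<omega> x. tav p q x * f (x + v \<omega>)" and h = f and a = v, OF W _ int]
  note D' = dominated_fubini[where M = ?W and H = "\<lambda>\<omega> x. tav p q (x - v \<omega>) * f x" and h = f and a = "\<lambda>_. 0", OF W _ int]
  have prod_eq: "tav p q x * tav p' q' x = (\<integral>\<omega>. tav p q x * f (x + v \<omega>) \<partial>?W)" for x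
    unfolding tav_eq[of p' q'] v_def by simp
  have pi: "integrable lborel (\<lambda>x. tav p q x * tav p' q' x)"
    unfolding prod_eq by (rule D(2)) (use le in auto)
  have "(\<integral>x. tav p q x * tav p' q' x \<partial>lborel) = (\<integral>\<omega>. \<integral>x. tav p q x * f (x + v \<omega>) \<partial>lborel \<partial>?W)"
    unfolding prod_eq by (rule D(3)) (use le in auto)
  also have "\<dots> = (\<integral>\<omega>. \<integral>x. tav p q (x - v \<omega>) * f x \<partial>lborel \<partial>?W)"
  proof (rule Bochner_Integration.integral_cong[OF refl])
    fix \<omega>
    have "integrable lborel (\<lambda>x. tav p q (x - v \<omega>) * f x)"
      by (rule D'(1)) (use le in \<open>auto simp: space_pair_measure\<close>)
    from integrable_translate(2)[OF this, of "v \<omega>"]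
    show "(\<integral>x. tav p q x * f (x + v \<omega>) \<partial>lborel) = (\<integral>x. tav p q (x - v \<omega>) * f x \<partial>lborel)" by simp
  qed
  finally have pe: "(\<integral>x. tav p q x * tav p' q' x \<partial>lborel) = (\<integral>\<omega>. \<integral>x. tav p q (x - v \<omega>) * f x \<partial>lborel \<partial>?W)" .
  have "\<bar>\<integral>\<omega>. (\<integral>x. tav p q (x - v \<omega>) * f x \<partial>lborel) - energy p q \<partial>?W\<bar> \<le> 4 * \<theta> * mass"
  proof (rule W.abs_integral_le_AE)
    have "AE \<omega> in ?W. (fst (fst \<omega>) \<in> {0..1} \<and> snd (fst \<omega>) \<in> {0..1}) \<and> (fst (snd \<omega>) \<in> {0..1} \<and> snd (snd \<omega>) \<in> {0..1})"
      by (rule AE_prob_pair[OF prob_space_unif2 prob_space_unif2 AE_unif2 AE_unif2]) measurable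
    then show "AE \<omega> in ?W. \<bar>(\<integral>x. tav p q (x - v \<omega>) * f x \<partial>lborel) - energy p q\<bar> \<le> 4 * \<theta> * mass"
    proof eventually_elim
      case (elim \<omega>)
      \<comment> \<open>The displacement by a fine window expressed in units of the coarse one; both
        of its coordinates are at most \<open>\<theta>\<close> in absolute value.\<close>
      define h where "h = (p' / p * (fst (fst \<omega>) - fst (snd \<omega>)), q' / q * (snd (fst \<omega>) - snd (snd \<omega>)))"
      have hv: "scl p q h = - v \<omega>" using p q by (simp add: h_def v_def scl_def algebra_simps)
      have ratio: "0 \<le> p' / p" "p' / p \<le> \<theta>" "0 \<le> q' / q" "q' / q \<le> \<theta>"
        using p q by (auto simp: pos_divide_le_eq)
      have "\<bar>fst h\<bar> \<le> \<theta> * 1" "\<bar>snd h\<bar> \<le> \<theta> * 1"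
        unfolding h_def fst_conv snd_conv abs_mult using elim ratio by (intro mult_mono; auto)+
      then have d: "\<bar>tav p q (x - v \<omega>) - tav p q x\<bar> \<le> 4 * \<theta>" for x
        using tav_shift[of p q x h] by (simp add: hv)
      have i1: "integrable lborel (\<lambda>x. tav p q (x - v \<omega>) * f x)"
        by (rule D'(1)) (use le in \<open>auto simp: space_pair_measure\<close>)
      have i2: "integrable lborel (\<lambda>x. f x * tav p q x)"
        by (rule Bochner_Integration.integrable_bound[OF int]) (use le nonneg in \<open>auto simp: mult.commute\<close>)
      have "(\<integral>x. tav p q (x - v \<omega>) * f x \<partial>lborel) - energy p q = (\<integral>x. tav p q (x - v \<omega>) * f x - f x * tav p q x \<partial>lborel)"
        unfolding energy_def using i1 i2 by simp
      also have "\<bar>\<dots>\<bar> \<le> (\<integral>x. 4 * \<theta> * f x \<partial>lborel)"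
      proof (rule integral_abs_bound_integral)
        show "\<bar>tav p q (x - v \<omega>) * f x - f x * tav p q x\<bar> \<le> 4 * \<theta> * f x" for x
        proof -
          have "tav p q (x - v \<omega>) * f x - f x * tav p q x = (tav p q (x - v \<omega>) - tav p q x) * f x"
            by (simp add: algebra_simps)
          then show ?thesis
            using mult_right_mono[OF d[of x] nonneg[of x]] nonneg[of x] by (simp add: abs_mult)
        qed
      qed (use i1 i2 int in auto)
      also have "\<dots> = 4 * \<theta> * mass" by (simp add: mass_def)
      finally show ?case .
    qed
  qed (use \<theta> mass_nonneg in auto)
  moreover have "integrable ?W (\<lambda>\<omega>. \<integral>x. tav p q (x - v \<omega>) * f x \<partial>lborel)"
    by (rule D'(5)) (use le in auto)
  ultimately have "energy p q - 4 * \<theta> * mass \<le> (\<integral>x. tav p q x * tav p' q' x \<partial>lborel)"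
    unfolding pe using W.prob_space by simp
  note lower = this
  have sq: "(tav p' q' x - tav p q x)\<^sup>2 = (tav p' q' x)\<^sup>2 + (tav p q x)\<^sup>2 - 2 * (tav p q x * tav p' q' x)" for x
    by (simp add: power2_diff)
  show "integrable lborel (\<lambda>x. (tav p' q' x - tav p q x)\<^sup>2)"
    unfolding sq using tav_sq(1) pi by simp
  have "(\<integral>x. (tav p' q' x - tav p q x)\<^sup>2 \<partial>lborel)
      = (\<integral>x. (tav p' q' x)\<^sup>2 \<partial>lborel) + (\<integral>x. (tav p q x)\<^sup>2 \<partial>lborel) - 2 * (\<integral>x. tav p q x * tav p' q' x \<partial>lborel)"
    unfolding sq using tav_sq(1) pi by simp
  then show "(\<integral>x. (tav p' q' x - tav p q x)\<^sup>2 \<partial>lborel) \<le> energy p' q' - energy p q + 8 * \<theta> * mass"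
    using lower tav_sq(2)[of p' q'] tav_sq(2)[of p q] by linarith
qed

end

section \<open>Replacing factors by local averages\<close>

abbreviation unif3 :: "((real \<times> real) \<times> real) measure" where
  "unif3 \<equiv> unif2 \<Otimes>\<^sub>M unif"

lemma prob_space_unif3: "prob_space unif3"
  by (intro prob_space_pair prob_space_unif prob_space_unif2)

interpretation unif3: prob_space unif3
  by (rule prob_space_unif3)

lemma space_unif3 [simp]: "space unif3 = UNIV"
  by (simp add: space_pair_measure)

lemma AE_unif3: "AE y in unif3. fst (fst y) \<in> {0..1} \<and> snd (fst y) \<in> {0..1} \<and> snd y \<in> {0..1}"
proof -
  have "AE y in unif3. (fst (fst y) \<in> {0..1} \<and> snd (fst y) \<in> {0..1}) \<and> snd y \<in> {0..1}"
    by (rule AE_prob_pair[OF prob_space_unif2 prob_space_unif AE_unif2 AE_unif]) measurable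
  then show ?thesis by simp
qed

text \<open>\<open>integral_comp_perturb\<close> for a constant perturbation of
  \<open>sqrt (1 + s)\<close>, with derivative at least \<open>1/4\<close> and second derivative at
  most 1: \<open>24 = 2 * 4 + 4\<^sup>2\<close>.\<close>

lemma sqrt_shift:
  fixes F :: "real \<Rightarrow> real"
  assumes F: "continuous_on UNIV F" "\<And>k. \<bar>F k\<bar> \<le> 1"
  shows "\<bar>\<integral>s. F (sqrt (1 + s) + w) - F (sqrt (1 + s)) \<partial>unif\<bar> \<le> 24 * \<bar>w\<bar>"
proof -
  have rng: "1 \<le> sqrt (1 + s)" "sqrt (1 + s) \<le> 2" if "s \<in> {0..1}" for s :: real
    using that by (auto intro: real_le_lsqrt)
  define \<theta>' \<theta>'' where "\<theta>' s = 1 / (2 * sqrt (1 + s))" and "\<theta>'' s = - 1 / (4 * (1 + s) * sqrt (1 + s))" for s :: real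
  have d: "((\<lambda>s. sqrt (1 + s)) has_real_derivative \<theta>' s) (at s)" if "s \<in> {0..1}" for s
    using that by (auto intro!: derivative_eq_intros simp: \<theta>'_def field_simps)
  have d2: "(\<theta>' has_real_derivative \<theta>'' s) (at s)" if "s \<in> {0..1}" for s
  proof -
    have pos: "0 < 1 + s" using that by auto
    have "((\<lambda>s. 1 / 2 * inverse (sqrt (1 + s))) has_real_derivative 1 / 2 * - (inverse (sqrt (1 + s)) * \<theta>' s * inverse (sqrt (1 + s)))) (at s)"
      using rng[OF that] by (intro DERIV_cmult DERIV_inverse' d that) auto
    moreover have "1 / 2 * - (inverse (sqrt (1 + s)) * \<theta>' s * inverse (sqrt (1 + s))) = \<theta>'' s"
      using pos by (simp add: \<theta>'_def \<theta>''_def divide_simps)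
    moreover have "\<theta>' = (\<lambda>s. 1 / 2 * inverse (sqrt (1 + s)))"
      by (simp add: \<theta>'_def fun_eq_iff divide_simps)
    ultimately show ?thesis by simp
  qed
  have b1: "1/4 \<le> \<bar>\<theta>' s\<bar>" if "s \<in> {0..1}" for s
    using rng[OF that] by (simp add: \<theta>'_def divide_simps)
  have b2: "\<bar>\<theta>'' s\<bar> \<le> 1" if "s \<in> {0..1}" for s
  proof -
    have "1 * 1 \<le> (4 * (1 + s)) * sqrt (1 + s)" using rng[OF that] that by (intro mult_mono) auto
    then show ?thesis using rng[OF that] that by (simp add: \<theta>''_def abs_mult divide_simps)
  qed
  have c: "continuous_on UNIV (\<lambda>s. F (sqrt (1 + s)))" "continuous_on UNIV (\<lambda>s. F (sqrt (1 + s) + w))"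
    by (intro continuous_on_compose2[OF F(1)] continuous_intros; simp)+
  have "\<bar>integral {0..1} (\<lambda>s. F (sqrt (1 + s) + w)) - integral {0..1} (\<lambda>s. F (sqrt (1 + s)))\<bar>
      \<le> \<bar>w\<bar> * (2 / (1/4) + 1 / (1/4)\<^sup>2) + 0 / (1/4)"
    by (rule integral_comp_perturb[where F = F and \<psi> = "\<lambda>s. sqrt (1 + s) + w" and \<theta> = "\<lambda>s. sqrt (1 + s)"
        and \<psi>' = \<theta>' and \<theta>' = \<theta>' and \<theta>'' = \<theta>''])
       (use F d2 b1 b2 in \<open>auto intro!: DERIV_cong[OF DERIV_add[OF d DERIV_const]] d\<close>)
  also have "\<dots> = 24 * \<bar>w\<bar>" by (simp add: power2_eq_square)
  finally have "\<bar>integral {0..1} (\<lambda>s. F (sqrt (1 + s) + w)) - integral {0..1} (\<lambda>s. F (sqrt (1 + s)))\<bar> \<le> 24 * \<bar>w\<bar>" .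
  moreover have "(\<integral>s. F (sqrt (1 + s) + w) - F (sqrt (1 + s)) \<partial>unif)
      = integral {0..1} (\<lambda>s. F (sqrt (1 + s) + w)) - integral {0..1} (\<lambda>s. F (sqrt (1 + s)))"
    using c by (subst integral_unif_continuous)
      (auto intro!: continuous_intros Henstock_Kurzweil_Integration.integral_diff integrable_continuous_real
        intro: continuous_on_subset)
  ultimately show ?thesis by simp
qed

context density_profile
begin

text \<open>The weight \<open>k\<close> stands for \<open>f\<close> times further factors with
  values in \<open>[0,1]\<close>; domination by \<open>f\<close> is what makes every error a
  multiple of \<open>mass\<close>.\<close>

lemma weight_bound:
  assumes [measurable]: "k \<in> borel_measurable borel" "h \<in> borel_measurable borel"
    and k: "\<And>x. 0 \<le> k x" "\<And>x. k x \<le> f x" and h: "\<And>x. \<bar>h x\<bar> \<le> C"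
  shows "integrable lborel (\<lambda>x. k x * h x)" "\<bar>\<integral>x. k x * h x \<partial>lborel\<bar> \<le> C * mass"
proof -
  have le: "\<bar>k x * h x\<bar> \<le> C * f x" for x
    using mult_mono[OF h[of x] k(2)[of x]] k(1)[of x] h[of x] by (simp add: abs_mult mult.commute)
  have iC: "integrable lborel (\<lambda>x. C * f x)" using int by simp
  show i: "integrable lborel (\<lambda>x. k x * h x)"
    by (rule Bochner_Integration.integrable_bound[OF iC]) (use le in \<open>auto intro: order_trans[OF le abs_ge_self]\<close>)
  have "\<bar>\<integral>x. k x * h x \<partial>lborel\<bar> \<le> (\<integral>x. C * f x \<partial>lborel)"
    by (rule integral_abs_bound_integral[OF i iC le])
  then show "\<bar>\<integral>x. k x * h x \<partial>lborel\<bar> \<le> C * mass" by (simp add: mass_def)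
qed

lemma functional_close:
  fixes K H1 H2 :: "(real \<times> real) \<times> real \<Rightarrow> real \<times> real \<Rightarrow> real"
  assumes [measurable]: "(\<lambda>(y, x). K y x) \<in> borel_measurable (unif3 \<Otimes>\<^sub>M borel)"
      "(\<lambda>(y, x). H1 y x) \<in> borel_measurable (unif3 \<Otimes>\<^sub>M borel)"
      "(\<lambda>(y, x). H2 y x) \<in> borel_measurable (unif3 \<Otimes>\<^sub>M borel)"
    and K: "\<And>y x. 0 \<le> K y x" "\<And>y x. K y x \<le> f x"
    and H: "\<And>y x. \<bar>H1 y x\<bar> \<le> 1" "\<And>y x. \<bar>H2 y x\<bar> \<le> 1"
    and E: "AE y in unif3. \<bar>\<integral>x. K y x * (H1 y x - H2 y x) \<partial>lborel\<bar> \<le> E" "0 \<le> E"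
  shows "\<bar>(\<integral>y. \<integral>x. K y x * H1 y x \<partial>lborel \<partial>unif3) - (\<integral>y. \<integral>x. K y x * H2 y x \<partial>lborel \<partial>unif3)\<bar> \<le> E"
proof -
  have b: "integrable lborel (\<lambda>x. K y x * H1 y x)" "\<bar>\<integral>x. K y x * H1 y x \<partial>lborel\<bar> \<le> 1 * mass"
     "integrable lborel (\<lambda>x. K y x * H2 y x)" "\<bar>\<integral>x. K y x * H2 y x \<partial>lborel\<bar> \<le> 1 * mass" for y
    by (rule weight_bound[where C = 1]; use K H in simp)+
  have i: "integrable unif3 (\<lambda>y. \<integral>x. K y x * H1 y x \<partial>lborel)" "integrable unif3 (\<lambda>y. \<integral>x. K y x * H2 y x \<partial>lborel)"
    by (rule unif3.integrable_bounded[where B = "1 * mass"]; use b in simp)+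
  have "(\<integral>y. \<integral>x. K y x * H1 y x \<partial>lborel \<partial>unif3) - (\<integral>y. \<integral>x. K y x * H2 y x \<partial>lborel \<partial>unif3)
      = (\<integral>y. \<integral>x. K y x * (H1 y x - H2 y x) \<partial>lborel \<partial>unif3)"
    using i b by (simp add: right_diff_distrib)
  also have "\<bar>\<dots>\<bar> \<le> E"
    by (rule unif3.abs_integral_le_AE[OF E])
  finally show ?thesis .
qed

text \<open>\<open>tav\<close> averages \<open>f\<close> over displacements that are differences of
  points of the unit square, hence in \<open>[-1,1]\<^sup>2\<close>. Fubini brings this average
  outside the integral over \<open>y\<close>, which is essential: the hypothesis controls a
  translation only after averaging in \<open>y\<close>, not for each \<open>y\<close>.\<close>

lemma functional_average:
  fixes K :: "(real \<times> real) \<times> real \<Rightarrow> real \<times> real \<Rightarrow> real"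
  assumes [measurable]: "(\<lambda>(y, x). K y x) \<in> borel_measurable (unif3 \<Otimes>\<^sub>M borel)" "c \<in> borel_measurable unif3"
    and K: "\<And>y x. 0 \<le> K y x" "\<And>y x. K y x \<le> f x"
    and E: "\<And>w. \<bar>fst w\<bar> \<le> 1 \<Longrightarrow> \<bar>snd w\<bar> \<le> 1 \<Longrightarrow>
      \<bar>\<integral>y. \<integral>x. K y x * (f (x + c y) - f (x + c y + scl p q w)) \<partial>lborel \<partial>unif3\<bar> \<le> E" "0 \<le> E"
  shows "\<bar>(\<integral>y. \<integral>x. K y x * f (x + c y) \<partial>lborel \<partial>unif3) - (\<integral>y. \<integral>x. K y x * tav p q (x + c y) \<partial>lborel \<partial>unif3)\<bar> \<le> E"
proof -
  let ?W = "unif2 \<Otimes>\<^sub>M unif2"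
  have W: "prob_space ?W" by (intro prob_space_pair prob_space_unif2)
  interpret W: prob_space ?W by (rule W)
  define v where "v \<omega> = scl p q (snd \<omega> - fst \<omega>)" for \<omega> :: "(real \<times> real) \<times> (real \<times> real)"
  have [measurable]: "v \<in> borel_measurable ?W"
    unfolding v_def[abs_def] scl_simps by measurable
  define D where "D y \<omega> = (\<integral>x. K y x * (f (x + c y) - f (x + c y + v \<omega>)) \<partial>lborel)" for y \<omega>
  have fd: "\<bar>f a - f b\<bar> \<le> 1" for a b
    using nonneg[of a] le1[of a] nonneg[of b] le1[of b] by linarith
  have Db: "\<bar>D y \<omega>\<bar> \<le> 1 * mass" for y \<omega>
    unfolding D_def by (rule weight_bound) (use K fd in auto)
  have [measurable]: "(\<lambda>(y, \<omega>). D y \<omega>) \<in> borel_measurable (unif3 \<Otimes>\<^sub>M ?W)"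
    unfolding D_def by measurable
  have b: "integrable lborel (\<lambda>x. K y x * f (x + c y))" "\<bar>\<integral>x. K y x * f (x + c y) \<partial>lborel\<bar> \<le> 1 * mass"
     "integrable lborel (\<lambda>x. K y x * tav p q (x + c y))" "\<bar>\<integral>x. K y x * tav p q (x + c y) \<partial>lborel\<bar> \<le> 1 * mass" for y
    by (rule weight_bound[where C = 1]; use K f_abs tav_bounds in simp)+
  have i: "integrable unif3 (\<lambda>y. \<integral>x. K y x * f (x + c y) \<partial>lborel)" "integrable unif3 (\<lambda>y. \<integral>x. K y x * tav p q (x + c y) \<partial>lborel)"
    by (rule unif3.integrable_bounded[where B = "1 * mass"]; use b in simp)+
  have inner: "(\<integral>x. K y x * f (x + c y) \<partial>lborel) - (\<integral>x. K y x * tav p q (x + c y) \<partial>lborel) = (\<integral>\<omega>. D y \<omega> \<partial>?W)" for y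
  proof -
    have e: "K y x * f (x + c y) - K y x * tav p q (x + c y) = (\<integral>\<omega>. K y x * (f (x + c y) - f (x + c y + v \<omega>)) \<partial>?W)" for x
    proof -
      have "integrable ?W (\<lambda>\<omega>. f (x + c y + v \<omega>))" using f_abs by (intro W.integrable_bounded[where B = 1]) auto
      then show ?thesis unfolding tav_eq v_def[symmetric] using W.prob_space by (simp add: right_diff_distrib)
    qed
    have "(\<integral>x. K y x * f (x + c y) \<partial>lborel) - (\<integral>x. K y x * tav p q (x + c y) \<partial>lborel)
        = (\<integral>x. \<integral>\<omega>. K y x * (f (x + c y) - f (x + c y + v \<omega>)) \<partial>?W \<partial>lborel)"
      unfolding e[symmetric] using b(1,3)[of y] by (rule Bochner_Integration.integral_diff[symmetric])
    also have "(\<integral>x. \<integral>\<omega>. K y x * (f (x + c y) - f (x + c y + v \<omega>)) \<partial>?W \<partial>lborel) = (\<integral>\<omega>. D y \<omega> \<partial>?W)"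
      unfolding D_def
    proof (rule dominated_fubini(3)[where h = f and a = "\<lambda>_. 0", OF W _ int])
      show "\<bar>K y x * (f (x + c y) - f (x + c y + v \<omega>))\<bar> \<le> f (x + 0)" for x \<omega>
        using mult_mono[OF K(2)[of y x] fd[of "x + c y" "x + c y + v \<omega>"]] K(1)[of y x] nonneg[of x] by (simp add: abs_mult)
    qed measurable
    finally show ?thesis .
  qed
  have "(\<integral>y. \<integral>x. K y x * f (x + c y) \<partial>lborel \<partial>unif3) - (\<integral>y. \<integral>x. K y x * tav p q (x + c y) \<partial>lborel \<partial>unif3)
      = (\<integral>y. \<integral>\<omega>. D y \<omega> \<partial>?W \<partial>unif3)"
    using i by (simp add: inner[symmetric])
  also have "\<dots> = (\<integral>\<omega>. \<integral>y. D y \<omega> \<partial>unif3 \<partial>?W)"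
    by (rule prob_swap[OF prob_space_unif3 W _ Db]) simp
  also have "\<bar>\<dots>\<bar> \<le> E"
  proof (rule W.abs_integral_le_AE)
    have "AE \<omega> in ?W. (fst (fst \<omega>) \<in> {0..1} \<and> snd (fst \<omega>) \<in> {0..1}) \<and> (fst (snd \<omega>) \<in> {0..1} \<and> snd (snd \<omega>) \<in> {0..1})"
      by (rule AE_prob_pair[OF prob_space_unif2 prob_space_unif2 AE_unif2 AE_unif2]) measurable
    then show "AE \<omega> in ?W. \<bar>\<integral>y. D y \<omega> \<partial>unif3\<bar> \<le> E"
    proof eventually_elim
      case (elim \<omega>)
      then have "\<bar>fst (snd \<omega> - fst \<omega>)\<bar> \<le> 1" "\<bar>snd (snd \<omega> - fst \<omega>)\<bar> \<le> 1"
        by (auto simp: abs_le_iff)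
      from E(1)[OF this] show ?case unfolding D_def v_def .
    qed
  qed fact
  finally show ?thesis .
qed

text \<open>Unlike in \<open>functional_average\<close>, each \<open>y\<close> can be treated
  separately: translation by \<open>c y\<close> preserves the square mean, and Cauchy-Schwarz
  against \<open>f\<close> gives the bound.\<close>

lemma functional_L2:
  fixes K :: "(real \<times> real) \<times> real \<Rightarrow> real \<times> real \<Rightarrow> real"
  assumes [measurable]: "(\<lambda>(y, x). K y x) \<in> borel_measurable (unif3 \<Otimes>\<^sub>M borel)" "c \<in> borel_measurable unif3"
      "g1 \<in> borel_measurable borel" "g2 \<in> borel_measurable borel"
    and K: "\<And>y x. 0 \<le> K y x" "\<And>y x. K y x \<le> f x"
    and g: "\<And>x. \<bar>g1 x\<bar> \<le> 1" "\<And>x. \<bar>g2 x\<bar> \<le> 1"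
    and L2: "integrable lborel (\<lambda>x. (g1 x - g2 x)\<^sup>2)" "(\<integral>x. (g1 x - g2 x)\<^sup>2 \<partial>lborel) \<le> \<kappa>\<^sup>2 * mass" and \<kappa>: "0 < \<kappa>"
  shows "\<bar>(\<integral>y. \<integral>x. K y x * g1 (x + c y) \<partial>lborel \<partial>unif3) - (\<integral>y. \<integral>x. K y x * g2 (x + c y) \<partial>lborel \<partial>unif3)\<bar> \<le> \<kappa> * mass"
proof (rule functional_close)
  show "AE y in unif3. \<bar>\<integral>x. K y x * (g1 (x + c y) - g2 (x + c y)) \<partial>lborel\<bar> \<le> \<kappa> * mass"
  proof (rule AE_I2)
    fix y
    have sq: "(f x)\<^sup>2 \<le> f x" for x using nonneg le1 by (simp add: power2_eq_square mult_left_le)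
    have i: "integrable lborel (\<lambda>x. (f x)\<^sup>2)"
      by (rule Bochner_Integration.integrable_bound[OF int]) (use sq nonneg in auto)
    have m: "(\<integral>x. (f x)\<^sup>2 \<partial>lborel) \<le> mass"
      unfolding mass_def using i int sq by (rule integral_mono)
    have "\<bar>\<integral>x. K y x * (g1 (x + c y) - g2 (x + c y)) \<partial>lborel\<bar> \<le> (\<kappa> * mass + (\<kappa>\<^sup>2 * mass) / \<kappa>) / 2"
    proof (rule integral_mult_le_amgm[OF i m])
      show "integrable lborel (\<lambda>x. (g1 (x + c y) - g2 (x + c y))\<^sup>2)"
        by (rule integrable_translate[OF L2(1)])
      show "(\<integral>x. (g1 (x + c y) - g2 (x + c y))\<^sup>2 \<partial>lborel) \<le> \<kappa>\<^sup>2 * mass"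
        using integrable_translate(2)[OF L2(1), of "c y"] L2(2) by simp
      show "\<bar>K y x * (g1 (x + c y) - g2 (x + c y))\<bar> \<le> \<bar>f x\<bar> * \<bar>g1 (x + c y) - g2 (x + c y)\<bar>" for x
        unfolding abs_mult using K[of y x] nonneg[of x] by (intro mult_right_mono) auto
    qed fact
    also have "\<dots> = \<kappa> * mass" using \<kappa> by (simp add: power2_eq_square)
    finally show "\<bar>\<integral>x. K y x * (g1 (x + c y) - g2 (x + c y)) \<partial>lborel\<bar> \<le> \<kappa> * mass" .
  qed
qed (use K g \<kappa> mass_nonneg in auto)

text \<open>The weight is free of \<open>y\<close>, so the parameter averages act directly on the
  translated \<open>f\<close> and Cauchy-Schwarz is avoided. The first coordinate of the shift is
  absorbed by \<open>\<beta>\<close>, the second by \<open>s\<close> through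
  \<open>sqrt_shift\<close>.\<close>

lemma linear_shift:
  assumes [measurable]: "k \<in> borel_measurable borel" and k: "\<And>x. 0 \<le> k x" "\<And>x. k x \<le> f x"
  shows "\<bar>\<integral>y. \<integral>x. k x * (f (x + lin T (1 + snd y + l * fst (fst y)) (snd (fst y)))
      - f (x + lin T (1 + snd y + l * fst (fst y)) (snd (fst y)) + (T * w1, T * w2))) \<partial>lborel \<partial>unif3\<bar>
    \<le> (2 * \<bar>w1\<bar> + 24 * \<bar>w2\<bar>) * mass"
proof -
  define \<Lambda> where "\<Lambda> x a b \<alpha> s \<beta> = f (x + (T * (1 + \<beta> + a + l * \<alpha>), T * (sqrt (1 + s) + b)))" for x a b \<alpha> s \<beta>
  have \<Lambda>m [measurable (raw)]: "(\<lambda>z. \<Lambda> (x' z) a b (p z) (q z) (r z)) \<in> borel_measurable M"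
    if [measurable]: "x' \<in> borel_measurable M" "p \<in> borel_measurable M" "q \<in> borel_measurable M" "r \<in> borel_measurable M"
    for M :: "'z measure" and x' p q r a b
    unfolding \<Lambda>_def by measurable
  have \<Lambda>1: "\<bar>\<Lambda> x a b \<alpha> s \<beta>\<bar> \<le> 1" for x a b \<alpha> s \<beta> unfolding \<Lambda>_def by (rule f_abs)
  define R where "R x = (\<integral>y. \<Lambda> x 0 0 (fst (fst y)) (snd (fst y)) (snd y) - \<Lambda> x w1 w2 (fst (fst y)) (snd (fst y)) (snd y) \<partial>unif3)" for x
  have [measurable]: "R \<in> borel_measurable borel" unfolding R_def[abs_def] by measurable
  have Rb: "\<bar>R x\<bar> \<le> 2 * \<bar>w1\<bar> + 24 * \<bar>w2\<bar>" for x
  proof -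
    define I where "I a b = (\<integral>y. \<Lambda> x a b (fst (fst y)) (snd (fst y)) (snd y) \<partial>unif3)" for a b
    have ii: "integrable unif3 (\<lambda>y. \<Lambda> x a b (fst (fst y)) (snd (fst y)) (snd y))" for a b
      using \<Lambda>1 by (intro unif3.integrable_bounded[where B = 1]) auto
    have RI: "R x = I 0 0 - I w1 w2"
      unfolding R_def I_def using ii by simp
    have it: "I a b = (\<integral>z. \<integral>\<beta>. \<Lambda> x a b (fst z) (snd z) \<beta> \<partial>unif \<partial>unif2)" for a b
      unfolding I_def using \<Lambda>1
      by (intro prob_iterated[where \<phi> = "\<lambda>z \<beta>. \<Lambda> x a b (fst z) (snd z) \<beta>" and B = 1] prob_space_unif prob_space_unif2) auto
    have it2: "I a b = (\<integral>\<beta>. \<integral>\<alpha>. \<integral>s. \<Lambda> x a b \<alpha> s \<beta> \<partial>unif \<partial>unif \<partial>unif)" for a b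
    proof -
      have "I a b = (\<integral>\<beta>. \<integral>z. \<Lambda> x a b (fst z) (snd z) \<beta> \<partial>unif2 \<partial>unif)"
        unfolding it using \<Lambda>1 by (intro prob_swap[where B = 1] prob_space_unif prob_space_unif2) auto
      also have "\<dots> = (\<integral>\<beta>. \<integral>\<alpha>. \<integral>s. \<Lambda> x a b \<alpha> s \<beta> \<partial>unif \<partial>unif \<partial>unif)"
        using \<Lambda>1 by (intro Bochner_Integration.integral_cong refl
          prob_iterated[where \<phi> = "\<lambda>\<alpha> s. \<Lambda> x a b \<alpha> s _" and B = 1] prob_space_unif) auto
      finally show ?thesis .
    qed
    have i1: "integrable unif2 (\<lambda>z. \<integral>\<beta>. \<Lambda> x a b (fst z) (snd z) \<beta> \<partial>unif)" for a b
      using \<Lambda>1 by (intro unif2.integrable_bounded[where B = 1] abs_integral_le_unif) auto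
    have "\<bar>I 0 0 - I w1 0\<bar> = \<bar>\<integral>z. (\<integral>\<beta>. \<Lambda> x 0 0 (fst z) (snd z) \<beta> \<partial>unif) - (\<integral>\<beta>. \<Lambda> x w1 0 (fst z) (snd z) \<beta> \<partial>unif) \<partial>unif2\<bar>"
      unfolding it using i1 by simp
    also have "\<dots> \<le> 2 * 1 * \<bar>w1\<bar>"
    proof (rule unif2.abs_integral_le)
      fix z
      have "\<Lambda> x w1 0 (fst z) (snd z) \<beta> = \<Lambda> x 0 0 (fst z) (snd z) (\<beta> + w1)" for \<beta>
        by (simp add: \<Lambda>_def algebra_simps)
      then show "\<bar>(\<integral>\<beta>. \<Lambda> x 0 0 (fst z) (snd z) \<beta> \<partial>unif) - (\<integral>\<beta>. \<Lambda> x w1 0 (fst z) (snd z) \<beta> \<partial>unif)\<bar> \<le> 2 * 1 * \<bar>w1\<bar>"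
        using integral_unif_shift[of "\<Lambda> x 0 0 (fst z) (snd z)" 1 w1] \<Lambda>1 by (simp add: abs_minus_commute)
    qed simp
    finally have 1: "\<bar>I 0 0 - I w1 0\<bar> \<le> 2 * \<bar>w1\<bar>" by simp
    have i2: "integrable unif (\<lambda>\<beta>. \<integral>\<alpha>. \<integral>s. \<Lambda> x a b \<alpha> s \<beta> \<partial>unif \<partial>unif)"
      "integrable unif (\<lambda>\<alpha>. \<integral>s. \<Lambda> x a b \<alpha> s \<beta> \<partial>unif)" "integrable unif (\<lambda>s. \<Lambda> x a b \<alpha> s \<beta>)" for a b \<alpha> \<beta>
      using \<Lambda>1 by (intro integrable_unif[where B = 1] abs_integral_le_unif; simp)+
    have "I w1 w2 - I w1 0 = (\<integral>\<beta>. \<integral>\<alpha>. \<integral>s. \<Lambda> x w1 w2 \<alpha> s \<beta> - \<Lambda> x w1 0 \<alpha> s \<beta> \<partial>unif \<partial>unif \<partial>unif)"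
      unfolding it2 using i2 by simp
    also have "\<bar>\<dots>\<bar> \<le> 24 * \<bar>w2\<bar>"
    proof (rule abs_integral_le_unif, rule abs_integral_le_unif)
      fix \<beta> \<alpha> :: real
      define G where "G k = f (x + (T * (1 + \<beta> + w1 + l * \<alpha>), T * k))" for k
      have "continuous_on UNIV G" unfolding G_def by (intro continuous_on_compose2[OF cont] continuous_intros) auto
      from sqrt_shift[OF this, of w2] show "\<bar>\<integral>s. \<Lambda> x w1 w2 \<alpha> s \<beta> - \<Lambda> x w1 0 \<alpha> s \<beta> \<partial>unif\<bar> \<le> 24 * \<bar>w2\<bar>"
        using f_abs by (simp add: G_def \<Lambda>_def)
    qed simp_all
    finally show ?thesis unfolding RI using 1 by linarith
  qed
  have "(\<integral>y. \<integral>x. k x * (\<Lambda> x 0 0 (fst (fst y)) (snd (fst y)) (snd y) - \<Lambda> x w1 w2 (fst (fst y)) (snd (fst y)) (snd y)) \<partial>lborel \<partial>unif3)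
      = (\<integral>x. \<integral>y. k x * (\<Lambda> x 0 0 (fst (fst y)) (snd (fst y)) (snd y) - \<Lambda> x w1 w2 (fst (fst y)) (snd (fst y)) (snd y)) \<partial>unif3 \<partial>lborel)"
  proof (rule dominated_fubini(3)[where h = f and a = "\<lambda>_. 0", OF prob_space_unif3 _ int, symmetric])
    show "\<bar>k x * (\<Lambda> x 0 0 (fst (fst y)) (snd (fst y)) (snd y) - \<Lambda> x w1 w2 (fst (fst y)) (snd (fst y)) (snd y))\<bar> \<le> f (x + 0)" for y x
    proof -
      have "\<bar>\<Lambda> x 0 0 (fst (fst y)) (snd (fst y)) (snd y) - \<Lambda> x w1 w2 (fst (fst y)) (snd (fst y)) (snd y)\<bar> \<le> 1"
        unfolding \<Lambda>_def using nonneg le1 by (smt (verit))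
      from mult_mono[OF k(2)[of x] this nonneg abs_ge_zero] show ?thesis using k(1)[of x] by (simp add: abs_mult)
    qed
  qed measurable
  also have "\<dots> = (\<integral>x. k x * R x \<partial>lborel)" by (simp add: R_def)
  also have "\<bar>\<dots>\<bar> \<le> (2 * \<bar>w1\<bar> + 24 * \<bar>w2\<bar>) * mass"
    by (rule weight_bound) (use k Rb in auto)
  finally show ?thesis
    by (simp add: \<Lambda>_def lin_def algebra_simps)
qed

end

section \<open>The main term\<close>

text \<open>The points \<open>(v + u) / 2\<close> fill a subinterval of the unit interval of length
  \<open>1/2\<close>, and \<open>\<phi>\<close> is nonnegative on the rest.\<close>

lemma integral_unif_half:
  fixes \<phi> :: "real \<Rightarrow> real"
  assumes [measurable]: "\<phi> \<in> borel_measurable borel" and \<phi>: "\<And>t. 0 \<le> \<phi> t" "\<And>t. \<phi> t \<le> B" and v: "v \<in> {0..1}"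
  shows "1 / 2 * (\<integral>u. \<phi> ((v + u) / 2) \<partial>unif) \<le> (\<integral>t. \<phi> t \<partial>unif)"
proof -
  have B: "0 \<le> B" using \<phi>[of 0] by linarith
  have i: "integrable lborel (\<lambda>t. indicator {a..b} t * \<phi> t)" for a b :: real
  proof (rule Bochner_Integration.integrable_bound)
    show "integrable lborel (\<lambda>t. B * indicator {a..b} t)" by simp
    show "AE t in lborel. norm (indicator {a..b} t * \<phi> t) \<le> norm (B * indicator {a..b} t)"
      using \<phi> B by (intro AE_I2) (simp add: indicator_def)
  qed simp
  have "(\<integral>u. \<phi> ((v + u) / 2) \<partial>unif) = (\<integral>u. indicator {0..1} u * \<phi> ((v + u) / 2) \<partial>lborel)"
    by (rule integral_unif) measurable
  also have "\<dots> = 2 * (\<integral>t. indicator {0..1} (- v + 2 * t) * \<phi> ((v + (- v + 2 * t)) / 2) \<partial>lborel)"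
    by (subst lborel_integral_real_affine[where c = 2 and t = "- v"]) auto
  also have "(\<integral>t. indicator {0..1} (- v + 2 * t) * \<phi> ((v + (- v + 2 * t)) / 2) \<partial>lborel)
      = (\<integral>t. indicator {v / 2..(1 + v) / 2} t * \<phi> t \<partial>lborel)"
    by (intro Bochner_Integration.integral_cong) (auto simp: indicator_def field_simps)
  also have "\<dots> \<le> (\<integral>t. indicator {0..1} t * \<phi> t \<partial>lborel)"
    using i[of 0 1] i[of "v / 2" "(1 + v) / 2"] v \<phi> by (intro integral_mono) (auto simp: indicator_def)
  also have "\<dots> = (\<integral>t. \<phi> t \<partial>unif)"
    by (rule integral_unif[symmetric]) measurable
  finally show ?thesis by simp
qed

lemma sets_unif2: "sets unif2 = sets (borel :: (real \<times> real) measure)"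
  using sets_pair_measure_cong[OF sets_unif sets_unif] unfolding borel_prod .

lemma integral_add3:
  fixes p q r :: "'a \<Rightarrow> real"
  assumes "integrable M p" "integrable M q" "integrable M r"
  shows "(\<integral>x. p x + q x + r x \<partial>M) = (\<integral>x. p x \<partial>M) + (\<integral>x. q x \<partial>M) + (\<integral>x. r x \<partial>M)"
  using assms by simp

lemma integral_unif2_half:
  fixes \<phi> :: "real \<times> real \<Rightarrow> real"
  assumes [measurable]: "\<phi> \<in> borel_measurable borel" and \<phi>: "\<And>t. 0 \<le> \<phi> t" "\<And>t. \<phi> t \<le> B"
    and v: "fst v \<in> {0..1}" "snd v \<in> {0..1}"
  shows "1 / 4 * (\<integral>u. \<phi> ((fst v + fst u) / 2, (snd v + snd u) / 2) \<partial>unif2) \<le> (\<integral>w. \<phi> (fst w, snd w) \<partial>unif2)"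
proof -
  have B: "0 \<le> B" using \<phi>[of 0] by linarith
  have ab: "\<bar>\<phi> t\<bar> \<le> B" for t using \<phi>[of t] by simp
  have \<phi>2: "\<phi> \<in> borel_measurable unif2"
    using assms(1) by (simp add: measurable_cong_sets[OF sets_unif2 refl])
  have "(\<integral>u. \<phi> ((fst v + fst u) / 2, (snd v + snd u) / 2) \<partial>unif2)
      = (\<integral>s. \<integral>t. \<phi> ((fst v + s) / 2, (snd v + t) / 2) \<partial>unif \<partial>unif)"
    using ab by (intro prob_iterated[where \<phi> = "\<lambda>s t. \<phi> ((fst v + s) / 2, (snd v + t) / 2)" and B = B] prob_space_unif) auto
  also have "\<dots> \<le> (\<integral>s. 2 * (\<integral>t. \<phi> ((fst v + s) / 2, t) \<partial>unif) \<partial>unif)"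
  proof (rule integral_mono)
    have b: "\<bar>\<integral>t. \<phi> (p, q t) \<partial>unif\<bar> \<le> B" for p q
      using ab B by (intro abs_integral_le_unif) auto
    show "integrable unif (\<lambda>s. \<integral>t. \<phi> ((fst v + s) / 2, (snd v + t) / 2) \<partial>unif)"
      by (rule integrable_unif[OF _ b]) measurable
    show "integrable unif (\<lambda>s. 2 * (\<integral>t. \<phi> ((fst v + s) / 2, t) \<partial>unif))"
      by (intro integrable_mult_right, rule integrable_unif[OF _ b]) measurable
    show "(\<integral>t. \<phi> ((fst v + s) / 2, (snd v + t) / 2) \<partial>unif) \<le> 2 * (\<integral>t. \<phi> ((fst v + s) / 2, t) \<partial>unif)" for s
      using integral_unif_half[of "\<lambda>t. \<phi> ((fst v + s) / 2, t)" B "snd v"] \<phi> v by simp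
  qed
  also have "\<dots> = 2 * (\<integral>s. \<integral>t. \<phi> ((fst v + s) / 2, t) \<partial>unif \<partial>unif)" by simp
  also have "(\<integral>s. \<integral>t. \<phi> ((fst v + s) / 2, t) \<partial>unif \<partial>unif) \<le> 2 * (\<integral>s. \<integral>t. \<phi> (s, t) \<partial>unif \<partial>unif)"
  proof -
    have n0: "0 \<le> (\<integral>t. \<phi> (s, t) \<partial>unif)" for s
      by (intro Bochner_Integration.integral_nonneg \<phi>(1))
    have up: "(\<integral>t. \<phi> (s, t) \<partial>unif) \<le> B" for s
      by (rule order_trans[OF abs_ge_self]) (intro abs_integral_le_unif ab B)
    have "1 / 2 * (\<integral>s. \<integral>t. \<phi> ((fst v + s) / 2, t) \<partial>unif \<partial>unif) \<le> (\<integral>s. \<integral>t. \<phi> (s, t) \<partial>unif \<partial>unif)"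
      by (rule integral_unif_half[where \<phi> = "\<lambda>s. \<integral>t. \<phi> (s, t) \<partial>unif", OF _ n0 up v(1)]) measurable
    then show ?thesis by linarith
  qed
  also have "(\<integral>s. \<integral>t. \<phi> (s, t) \<partial>unif \<partial>unif) = (\<integral>w. \<phi> (fst w, snd w) \<partial>unif2)"
    using ab \<phi>2 by (intro prob_iterated[where \<phi> = "\<lambda>s t. \<phi> (s, t)" and B = B, symmetric] prob_space_unif) auto
  finally show ?thesis by simp
qed

text \<open>The three terms have product 1. The last two are first replaced by twice their geometric
  mean \<open>r\<close>, and \<open>1 / r\<^sup>2 + 2 * r \<ge> 3\<close> follows from a
  factorization.\<close>

lemma amgm3:
  fixes u v B :: real
  assumes "0 < u" "0 < v" "0 < B"
  shows "3 \<le> u * v / B\<^sup>2 + B / u + B / v"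
proof -
  define p q r where "p = B / u" and "q = B / v" and "r = sqrt (p * q)"
  have pq: "0 < p" "0 < q" "0 < r" using assms by (auto simp: p_def q_def r_def)
  have r2: "r\<^sup>2 = p * q" using pq by (simp add: r_def)
  have "0 \<le> (p - q)\<^sup>2" by simp
  then have "4 * (p * q) \<le> (p + q)\<^sup>2" by (simp add: power2_eq_square algebra_simps)
  then have "(2 * r)\<^sup>2 \<le> (p + q)\<^sup>2" by (simp add: power_mult_distrib r2)
  then have s: "2 * r \<le> p + q"
    by (rule power2_le_imp_le) (use pq in linarith)
  have rp: "0 < r\<^sup>2" using pq(3) by simp
  have "0 \<le> (r - 1)\<^sup>2 * (2 * r + 1)"
    by (rule mult_nonneg_nonneg) (use pq(3) in auto)
  also have "\<dots> = 1 + 2 * r * r\<^sup>2 - 3 * r\<^sup>2" by (simp add: power2_eq_square algebra_simps)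
  finally have "3 * r\<^sup>2 \<le> 1 + 2 * r * r\<^sup>2" by linarith
  also have "\<dots> = (1 / r\<^sup>2 + 2 * r) * r\<^sup>2" using rp by (simp add: distrib_right)
  finally have "3 \<le> 1 / r\<^sup>2 + 2 * r" using rp by (rule mult_right_le_imp_le)
  moreover have "1 / r\<^sup>2 = u * v / B\<^sup>2" unfolding r2 p_def q_def using assms by (simp add: power2_eq_square)
  ultimately show ?thesis using s unfolding p_def q_def by linarith
qed

context density_profile
begin

text \<open>Restrict the outer average to the points \<open>(v + u) / 2\<close>. The full window
  starting at \<open>x - scl a b ((v + u) / 2)\<close> contains the half-size window starting at
  \<open>x - scl (a / 2) (b / 2) v\<close>. Each restriction loses a factor 4, and the lower bound
  does not depend on \<open>u\<close>.\<close>

lemma tav_ge_bav: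
  assumes v: "fst v \<in> {0..1}" "snd v \<in> {0..1}"
  shows "1 / 16 * bav (a / 2) (b / 2) (x - scl (a / 2) (b / 2) v) \<le> tav a b x"
proof -
  let ?h = "\<lambda>v u. ((fst v + fst u) / 2, (snd v + snd u) / 2) :: real \<times> real"
  have hs: "scl a b (?h v u) = scl (a / 2) (b / 2) v + scl (a / 2) (b / 2) u" for v u
    by (simp add: scl_def algebra_simps add_divide_distrib)
  have bm [measurable]: "(\<lambda>w. scl a b w) \<in> borel_measurable borel" unfolding scl_def
    by (intro borel_measurable_continuous_onI continuous_intros)
  have 1: "1 / 4 * bav (a / 2) (b / 2) (x - scl (a / 2) (b / 2) v) \<le> bav a b (x - scl a b (?h v u))"
    if u: "fst u \<in> {0..1}" "snd u \<in> {0..1}" for u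
  proof -
    have "1 / 4 * (\<integral>z. f (x - scl a b (?h v u) + scl a b (?h u z)) \<partial>unif2) \<le> bav a b (x - scl a b (?h v u))"
      using integral_unif2_half[of "\<lambda>w. f (x - scl a b (?h v u) + scl a b w)" 1 u] nonneg le1 u
      by (simp add: bav_def)
    moreover have "f (x - scl a b (?h v u) + scl a b (?h u z)) = f (x - scl (a / 2) (b / 2) v + scl (a / 2) (b / 2) z)" for z
      unfolding hs by (simp add: algebra_simps)
    ultimately show ?thesis by (simp add: bav_def)
  qed
  have "1 / 4 * bav (a / 2) (b / 2) (x - scl (a / 2) (b / 2) v) = (\<integral>u. 1 / 4 * bav (a / 2) (b / 2) (x - scl (a / 2) (b / 2) v) \<partial>unif2)"
    using unif2.prob_space by simp
  also have "\<dots> \<le> (\<integral>u. bav a b (x - scl a b (?h v u)) \<partial>unif2)"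
  proof (rule integral_mono_AE)
    show "AE u in unif2. 1 / 4 * bav (a / 2) (b / 2) (x - scl (a / 2) (b / 2) v) \<le> bav a b (x - scl a b (?h v u))"
      using AE_unif2 by eventually_elim (use 1 in auto)
    show "integrable unif2 (\<lambda>u. bav a b (x - scl a b (?h v u)))"
      unfolding hs using bav_bounds by (intro unif2.integrable_bounded[where B = 1]) auto
  qed simp
  also have "1 / 4 * \<dots> \<le> tav a b x"
    using integral_unif2_half[of "\<lambda>w. bav a b (x - scl a b w)" 1 v] bav_bounds v by (simp add: tav_def)
  finally show ?thesis by simp
qed

text \<open>
  Locally \<open>tav a b x\<close> dominates \<open>m (x - s v) / 16\<close> for the half-size box average \<open>m\<close>; after averaging in \<open>v\<close>
  and translating, the numerator \<open>f\<close> also becomes \<open>m\<close> and cancels the denominator.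
\<close>

lemma mass_over_tav:
  assumes supp: "\<And>x. f x \<noteq> 0 \<Longrightarrow> x \<in> {-X..2*X} \<times> {-Y..2*Y}"
    and a: "0 < a" "a \<le> X" and b: "0 < b" "b \<le> Y" and c: "0 < c"
  shows "integrable lborel (\<lambda>x. f x / (tav a b x + c))"
    and "(\<integral>x. f x / (tav a b x + c) \<partial>lborel) \<le> 256 * (X * Y)"
proof -
  define m where "m = bav (a / 2) (b / 2)"
  define s where "s = scl (a / 2) (b / 2)"
  have [measurable]: "m \<in> borel_measurable borel" unfolding m_def by measurable
  have sm [measurable]: "s \<in> borel_measurable unif2" unfolding s_def by measurable
  have m0: "0 \<le> m y" for y unfolding m_def by (rule bav_bounds)
  have ic: "integrable lborel (\<lambda>x. f x / c)" using int by simp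
  have le1: "f x / (tav a b x + c) \<le> f x / c" "16 * f x / (m y + 16 * c) \<le> f x / c" "0 \<le> 16 * f x / (m y + 16 * c)" for x y
  proof -
    show "f x / (tav a b x + c) \<le> f x / c"
      using nonneg[of x] tav_bounds(1)[of a b x] c by (intro divide_left_mono) auto
    have "16 * f x / (m y + 16 * c) \<le> 16 * f x / (16 * c)"
      using nonneg[of x] m0[of y] c by (intro divide_left_mono) auto
    then show "16 * f x / (m y + 16 * c) \<le> f x / c" by simp
    show "0 \<le> 16 * f x / (m y + 16 * c)" using nonneg[of x] m0[of y] c by simp
  qed
  show i: "integrable lborel (\<lambda>x. f x / (tav a b x + c))"
    by (rule Bochner_Integration.integrable_bound[OF ic])
       (use le1(1) nonneg tav_bounds(1) c in \<open>auto simp: abs_of_nonneg add_nonneg_pos less_imp_le intro!: AE_I2\<close>)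
  have b1: "\<bar>16 * f x / (m (x - s v) + 16 * c)\<bar> \<le> f (x + 0) / c"
    and b2: "\<bar>16 * f (x + s v) / (m x + 16 * c)\<bar> \<le> f (x + s v) / c" for x v
    using le1(2,3)[of x "x - s v"] le1(2,3)[of "x + s v" x] by (simp_all only: abs_of_nonneg add_0_right)
  note D1 = dominated_fubini[where M = unif2 and H = "\<lambda>v x. 16 * f x / (m (x - s v) + 16 * c)" and h = "\<lambda>x. f x / c" and a = "\<lambda>_. 0", OF prob_space_unif2 _ ic b1]
  note D2 = dominated_fubini[where M = unif2 and H = "\<lambda>v y. 16 * f (y + s v) / (m y + 16 * c)" and h = "\<lambda>x. f x / c" and a = s, OF prob_space_unif2 _ ic b2]
  have pw: "f x / (tav a b x + c) \<le> (\<integral>v. 16 * f x / (m (x - s v) + 16 * c) \<partial>unif2)" for x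
  proof -
    have "f x / (tav a b x + c) = (\<integral>v. f x / (tav a b x + c) \<partial>unif2)" using unif2.prob_space by simp
    also have "\<dots> \<le> (\<integral>v. 16 * f x / (m (x - s v) + 16 * c) \<partial>unif2)"
    proof (rule integral_mono_AE)
      show "AE v in unif2. f x / (tav a b x + c) \<le> 16 * f x / (m (x - s v) + 16 * c)"
        using AE_unif2
      proof eventually_elim
        case (elim v)
        have "1 / 16 * m (x - s v) \<le> tav a b x" unfolding m_def s_def using elim by (intro tav_ge_bav) auto
        then have "f x / (tav a b x + c) \<le> f x / (1 / 16 * m (x - s v) + c)"
          using nonneg[of x] m0[of "x - s v"] c by (intro divide_left_mono) (auto intro!: mult_pos_pos add_nonneg_pos)
        also have "1 / 16 * m (x - s v) + c = (m (x - s v) + 16 * c) / 16" by simp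
        finally show ?case by (simp add: mult.commute)
      qed
      show "integrable unif2 (\<lambda>v. 16 * f x / (m (x - s v) + 16 * c))"
      proof (rule unif2.integrable_bounded[where B = "f x / c"])
        show "\<bar>16 * f x / (m (x - s v) + 16 * c)\<bar> \<le> f x / c" for v
          using le1(2,3)[of x "x - s v"] by (simp only: abs_of_nonneg)
      qed measurable
    qed simp
    finally show ?thesis .
  qed
  have "(\<integral>x. f x / (tav a b x + c) \<partial>lborel) \<le> (\<integral>x. \<integral>v. 16 * f x / (m (x - s v) + 16 * c) \<partial>unif2 \<partial>lborel)"
    using i pw by (intro integral_mono D1(2)) auto
  also have "\<dots> = (\<integral>v. \<integral>x. 16 * f x / (m (x - s v) + 16 * c) \<partial>lborel \<partial>unif2)"
    by (rule D1(3)) simp_all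
  also have "\<dots> = (\<integral>v. \<integral>y. 16 * f (y + s v) / (m y + 16 * c) \<partial>lborel \<partial>unif2)"
  proof (rule Bochner_Integration.integral_cong[OF refl])
    fix v
    have "integrable lborel (\<lambda>x. 16 * f x / (m (x - s v) + 16 * c))"
      by (rule D1(1)) simp_all
    from integrable_translate(2)[OF this, of "s v"]
    show "(\<integral>x. 16 * f x / (m (x - s v) + 16 * c) \<partial>lborel) = (\<integral>y. 16 * f (y + s v) / (m y + 16 * c) \<partial>lborel)" by simp
  qed
  also have "\<dots> = (\<integral>y. \<integral>v. 16 * f (y + s v) / (m y + 16 * c) \<partial>unif2 \<partial>lborel)"
    by (rule D2(3)[symmetric]) simp_all
  also have "\<dots> = (\<integral>y. 16 * m y / (m y + 16 * c) \<partial>lborel)"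
    by (simp add: m_def bav_def s_def)
  \<comment> \<open>After the cancellation only the support of \<open>m\<close> counts. It lies in a
    box with sides \<open>4 * X\<close> and \<open>4 * Y\<close>, since the half-size windows have
    sides at most \<open>X / 2\<close> and \<open>Y / 2\<close>; hence
    \<open>256 = 16 * 16\<close>.\<close>
  also have "\<dots> \<le> (\<integral>y. 16 * indicator (cbox (-2*X, -2*Y) (2*X, 2*Y)) y \<partial>lborel)"
  proof (rule integral_mono)
    have "integrable lborel (\<lambda>y. \<integral>v. 16 * f (y + s v) / (m y + 16 * c) \<partial>unif2)"
      by (rule D2(2)) simp_all
    then show "integrable lborel (\<lambda>y. 16 * m y / (m y + 16 * c))"
      by (simp add: m_def bav_def s_def)
    show "integrable lborel (\<lambda>y. 16 * indicator (cbox (-2*X, -2*Y) (2*X, 2*Y)) y :: real)"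
      by (intro integrable_mult_right integrable_real_indicator emeasure_lborel_cbox_finite) simp
    show "16 * m y / (m y + 16 * c) \<le> 16 * indicator (cbox (-2*X, -2*Y) (2*X, 2*Y)) y" for y
    proof (cases "y \<in> cbox (-2*X, -2*Y) (2*X, 2*Y)")
      case True
      then show ?thesis using m0[of y] c by (simp add: divide_simps)
    next
      case False
      have "AE v in unif2. f (y + s v) = 0"
        using AE_unif2
      proof eventually_elim
        case (elim v)
        show ?case
        proof (rule ccontr)
          assume "f (y + s v) \<noteq> 0"
          then have "fst (y + s v) \<in> {-X..2*X}" "snd (y + s v) \<in> {-Y..2*Y}"
            using supp[of "y + s v"] by (auto simp: mem_Times_iff)
          moreover have "0 \<le> a / 2 * fst v" "0 \<le> b / 2 * snd v" using elim a b by auto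
          moreover have "a / 2 * fst v \<le> X / 2 * 1" by (rule mult_mono) (use elim a in auto)
          moreover have "b / 2 * snd v \<le> Y / 2 * 1" by (rule mult_mono) (use elim b in auto)
          ultimately have "-2 * X \<le> fst y" "fst y \<le> 2 * X" "-2 * Y \<le> snd y" "snd y \<le> 2 * Y"
            using a b by (auto simp: s_def scl_def)
          with False show False by (auto simp: cbox_Pair_eq mem_Times_iff)
        qed
      qed
      then have "m y = (\<integral>v. 0 \<partial>unif2)"
        unfolding m_def bav_def s_def[symmetric] by (intro integral_cong_AE) auto
      then show ?thesis by simp
    qed
  qed
  also have "\<dots> = 16 * measure lborel (cbox (-2*X, -2*Y) (2*X, 2*Y))" by simp
  also have "measure lborel (cbox (-2*X, -2*Y) (2*X, 2*Y)) = (4 * X) * (4 * Y)"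
    using a b by (simp add: content_Pair content_real)
  finally show "(\<integral>x. f x / (tav a b x + c) \<partial>lborel) \<le> 256 * (X * Y)" by simp
qed

text \<open>\<open>amgm3\<close> multiplied by \<open>f\<close> and integrated bounds
  \<open>mass\<close> by the wanted integral and two integrals of \<open>f\<close> over a local
  average, and \<open>mass_over_tav\<close> controls these by the area alone. Thus points of low
  local density cannot carry most of the mass.\<close>

lemma main_term:
  assumes supp: "\<And>x. f x \<noteq> 0 \<Longrightarrow> x \<in> {-X..2*X} \<times> {-Y..2*Y}"
    and a: "0 < a" "a \<le> X" "0 < a'" "a' \<le> X" and b: "0 < b" "b \<le> Y" "0 < b'" "b' \<le> Y"
    and \<epsilon>: "0 < \<epsilon>" "\<epsilon> \<le> 1" and m: "\<epsilon> * (X * Y) \<le> mass"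
  shows "\<epsilon>\<^sup>2 / 262144 * mass \<le> (\<integral>x. f x * tav a b x * tav a' b' x \<partial>lborel)"
proof -
  \<comment> \<open>Of the \<open>3 * mass\<close> on the left, the two quotient terms use up
    \<open>512 * B * (X * Y) \<le> mass\<close>, and the regularization
    \<open>c = B\<^sup>2 / 3\<close> of the denominators uses up another \<open>mass\<close>. One
    \<open>mass\<close> is left, and \<open>262144 = 512\<^sup>2\<close>.\<close>
  define B where "B = \<epsilon> / 512"
  have B: "0 < B" "B \<le> 1" using \<epsilon> by (auto simp: B_def)
  define c where "c = B\<^sup>2 / 3"
  have c: "0 < c" "c \<le> 1" using B power_le_one[of B 2] by (auto simp: c_def)
  define u v where "u x = tav a b x + c" and "v x = tav a' b' x + c" for x
  have pos: "0 < u x" "0 < v x" for x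
    unfolding u_def v_def by (rule add_nonneg_pos[OF tav_bounds(1) c(1)])+
  have [measurable]: "u \<in> borel_measurable borel" "v \<in> borel_measurable borel"
    unfolding u_def[abs_def] v_def[abs_def] by measurable
  note U = mass_over_tav[OF supp a(1,2) b(1,2) c(1), folded u_def]
  note V = mass_over_tav[OF supp a(3,4) b(3,4) c(1), folded v_def]
  have itt: "integrable lborel (\<lambda>x. f x * (tav a b x * tav a' b' x))"
    by (rule weight_bound[where C = 1]) (use nonneg tav_bounds in \<open>auto simp: abs_mult mult_le_one\<close>)
  have uv: "f x * (u x * v x) \<le> f x * (tav a b x * tav a' b' x) + 3 * c * f x" for x
  proof -
    have "u x * v x = tav a b x * tav a' b' x + c * tav a b x + c * tav a' b' x + c * c"
      by (simp add: u_def v_def algebra_simps)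
    moreover have "c * tav a b x \<le> c" "c * tav a' b' x \<le> c" "c * c \<le> c" using tav_bounds c by (auto simp: mult_left_le)
    ultimately have "u x * v x \<le> tav a b x * tav a' b' x + 3 * c" by linarith
    from mult_left_mono[OF this nonneg[of x]] show ?thesis by (simp add: algebra_simps)
  qed
  have pw: "3 * f x \<le> 1 / B\<^sup>2 * (f x * (tav a b x * tav a' b' x) + 3 * c * f x) + B * (f x / u x) + B * (f x / v x)" for x
  proof -
    have "f x * 3 \<le> f x * (u x * v x / B\<^sup>2 + B / u x + B / v x)"
      using nonneg by (intro mult_left_mono amgm3 pos B) auto
    also have "\<dots> = 1 / B\<^sup>2 * (f x * (u x * v x)) + B * (f x / u x) + B * (f x / v x)"
      by (simp add: algebra_simps)
    also have "\<dots> \<le> 1 / B\<^sup>2 * (f x * (tav a b x * tav a' b' x) + 3 * c * f x) + B * (f x / u x) + B * (f x / v x)"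
      using uv[of x] by (intro add_right_mono mult_left_mono) auto
    finally show ?thesis by simp
  qed
  define J where "J = (\<integral>x. f x * (tav a b x * tav a' b' x) \<partial>lborel)"
  have "(\<integral>x. 3 * f x \<partial>lborel) \<le> (\<integral>x. 1 / B\<^sup>2 * (f x * (tav a b x * tav a' b' x) + 3 * c * f x) + B * (f x / u x) + B * (f x / v x) \<partial>lborel)"
    by (intro integral_mono pw Bochner_Integration.integrable_add integrable_mult_right itt U(1) V(1) int)
  also have "\<dots> = 1 / B\<^sup>2 * (J + 3 * c * mass) + B * (\<integral>x. f x / u x \<partial>lborel) + B * (\<integral>x. f x / v x \<partial>lborel)"
  proof -
    have "(\<integral>x. f x * (tav a b x * tav a' b' x) + 3 * c * f x \<partial>lborel) = J + 3 * c * mass"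
      using int itt by (simp add: J_def mass_def)
    then show ?thesis
      by (subst integral_add3)
        (auto intro!: Bochner_Integration.integrable_add integrable_mult_right itt U(1) V(1) int
          simp only: integral_mult_right_zero)
  qed
  also have "\<dots> \<le> 1 / B\<^sup>2 * (J + 3 * c * mass) + B * (256 * (X * Y)) + B * (256 * (X * Y))"
    using mult_left_mono[OF U(2), of B] mult_left_mono[OF V(2), of B] B by linarith
  also have "\<dots> = J / B\<^sup>2 + mass + \<epsilon> * (X * Y)"
    using B by (simp add: c_def B_def field_simps)
  finally have "mass \<le> J / B\<^sup>2" using m by (simp add: mass_def)
  then have "B\<^sup>2 * mass \<le> J" using B by (simp add: field_simps)
  then show ?thesis
    by (simp add: B_def J_def power_divide mult.assoc)
qed

text \<open>Six replacements. The last factor goes from \<open>f\<close> to its short average, to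
  its long average, to that average at \<open>x\<close>; then the middle factor does the same. Four
  of them cost \<open>\<kappa> * mass\<close>, and the two removals of a displacement together one
  more.\<close>

lemma single_scale:
  fixes T \<kappa> \<eta> l \<rho> \<sigma> :: real
  assumes \<kappa>: "0 < \<kappa>" "\<kappa> \<le> 1" and \<eta>: "\<eta> = \<kappa>\<^sup>2 / 8" and l: "l = \<eta>^6 / 10^10"
    and \<rho>: "0 < \<rho>" "\<rho> \<le> \<eta>^9 * l^6 / 900000" "26 * \<rho> \<le> \<kappa>" and \<sigma>: "48 / \<kappa> \<le> \<sigma>" and T: "0 < T"
    and DP: "integrable lborel (\<lambda>x. (tav (\<rho> * T^2) (\<rho> * T^3) x - tav (\<sigma> * T^2) (\<sigma> * T^3) x)\<^sup>2)"
      "(\<integral>x. (tav (\<rho> * T^2) (\<rho> * T^3) x - tav (\<sigma> * T^2) (\<sigma> * T^3) x)\<^sup>2 \<partial>lborel) \<le> \<kappa>\<^sup>2 * mass"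
    and DL: "integrable lborel (\<lambda>x. (tav (\<rho> * T) (\<rho> * T) x - tav (\<sigma> * T) (\<sigma> * T) x)\<^sup>2)"
      "(\<integral>x. (tav (\<rho> * T) (\<rho> * T) x - tav (\<sigma> * T) (\<sigma> * T) x)\<^sup>2 \<partial>lborel) \<le> \<kappa>\<^sup>2 * mass"
  shows "(\<integral>x. f x * tav (\<sigma> * T^2) (\<sigma> * T^3) x * tav (\<sigma> * T) (\<sigma> * T) x \<partial>lborel) - 5 * \<kappa> * mass \<le> lam T l f"
proof -
  define cl where "cl y = lin T (1 + snd y + l * fst (fst y)) (snd (fst y))" for y :: "(real \<times> real) \<times> real"
  define cp where "cp y = gam T (1 + snd y + l * fst (fst y)) + sig T (snd (fst y))" for y :: "(real \<times> real) \<times> real"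
  have [measurable]: "cl \<in> borel_measurable unif3" "cp \<in> borel_measurable unif3"
    unfolding cl_def[abs_def] cp_def[abs_def] by measurable
  define Ac Lc where "Ac = tav (\<sigma> * T^2) (\<sigma> * T^3)" and "Lc = tav (\<sigma> * T) (\<sigma> * T)"
  define Af Lf where "Af = tav (\<rho> * T^2) (\<rho> * T^3)" and "Lf = tav (\<rho> * T) (\<rho> * T)"
  have [measurable]: "Ac \<in> borel_measurable borel" "Lc \<in> borel_measurable borel" "Af \<in> borel_measurable borel" "Lf \<in> borel_measurable borel"
    unfolding Ac_def Lc_def Af_def Lf_def by measurable
  have tb: "0 \<le> Ac x" "Ac x \<le> 1" "\<bar>Ac x\<bar> \<le> 1" "\<bar>Lc x\<bar> \<le> 1" "\<bar>Af x\<bar> \<le> 1" "\<bar>Lf x\<bar> \<le> 1" for x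
    unfolding Ac_def Lc_def Af_def Lf_def by (rule tav_bounds)+
  define K1 where "K1 y x = f x * f (x + cl y)" for y x
  define K2 where "K2 y x = f x * Ac x" for y :: "(real \<times> real) \<times> real" and x
  have [measurable]: "(\<lambda>(y, x). K1 y x) \<in> borel_measurable (unif3 \<Otimes>\<^sub>M borel)" "(\<lambda>(y, x). K2 y x) \<in> borel_measurable (unif3 \<Otimes>\<^sub>M borel)"
    unfolding K1_def K2_def by measurable
  have K1: "0 \<le> K1 y x" "K1 y x \<le> f x" and K2: "0 \<le> K2 y x" "K2 y x \<le> f x" for y x
    unfolding K1_def K2_def using nonneg le1 tb by (auto simp: mult_left_le)
  define \<Psi>1 where "\<Psi>1 g = (\<integral>y. \<integral>x. K1 y x * g (x + cp y) \<partial>lborel \<partial>unif3)" for g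
  define \<Psi>2 where "\<Psi>2 g = (\<integral>y. \<integral>x. K2 y x * g (x + cl y) \<partial>lborel \<partial>unif3)" for g
  have lam: "lam T l g = \<Psi>1 g" for g by (simp add: lam_def \<Psi>1_def K1_def cl_def cp_def)
  have \<sigma>0: "0 < \<sigma>" "48 \<le> \<kappa> * \<sigma>" using \<kappa> \<sigma> by (auto simp: pos_divide_le_eq mult.commute intro: less_le_trans[of 0 "48 / \<kappa>"])
  have dv: "\<bar>A / \<sigma>\<bar> \<le> C / \<sigma>" if "0 \<le> A" "A \<le> C" for A C
    using that \<sigma>0(1) by (simp add: divide_right_mono)
  have l01: "0 \<le> l" "l \<le> 1/10"
  proof -
    have "\<kappa>\<^sup>2 \<le> 1" using \<kappa> by (intro power_le_one) auto
    then have "0 \<le> \<eta>" "\<eta> \<le> 1" using \<kappa> by (auto simp: \<eta>)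
    then have "0 \<le> \<eta>^6" "\<eta>^6 \<le> 1" by (auto intro: power_le_one)
    then show "0 \<le> l" "l \<le> 1/10" unfolding l by auto
  qed
  have s1: "\<bar>\<Psi>1 f - \<Psi>1 Af\<bar> \<le> \<kappa> * mass"
    unfolding \<Psi>1_def Af_def
  proof (rule functional_average)
    fix w :: "real \<times> real" assume w: "\<bar>fst w\<bar> \<le> 1" "\<bar>snd w\<bar> \<le> 1"
    have r: "\<bar>\<rho> * t\<bar> \<le> \<eta>^9 * l^6 / 900000" if "\<bar>t\<bar> \<le> 1" for t
    proof -
      have "\<bar>\<rho> * t\<bar> \<le> \<rho>" using \<rho>(1) that by (simp add: abs_mult mult_left_le)
      then show ?thesis using \<rho>(2) by (rule order_trans)
    qed
    from lam_diff_translate[OF \<kappa> \<eta> l r[OF w(1)] r[OF w(2)], of T]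
    show "\<bar>\<integral>y. \<integral>x. K1 y x * (f (x + cp y) - f (x + cp y + scl (\<rho> * T\<^sup>2) (\<rho> * T ^ 3) w)) \<partial>lborel \<partial>unif3\<bar> \<le> \<kappa> * mass"
      unfolding lam \<Psi>1_def by (simp add: scl_def mult_ac)
  qed (use K1 \<kappa> mass_nonneg in auto)
  have s2: "\<bar>\<Psi>1 Af - \<Psi>1 Ac\<bar> \<le> \<kappa> * mass"
    unfolding \<Psi>1_def using DP tb K1 \<kappa> by (intro functional_L2) (auto simp: Af_def Ac_def)
  define b1 where "b1 y = (1 + snd y + l * fst (fst y))" for y :: "(real \<times> real) \<times> real"
  have rng: "AE y in unif3. 1 \<le> b1 y \<and> b1 y \<le> 21/10 \<and> 0 \<le> snd (fst y) \<and> snd (fst y) \<le> 1 \<and> 1 \<le> sqrt (1 + snd (fst y)) \<and> sqrt (1 + snd (fst y)) \<le> 3/2"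
    using AE_unif3
  proof eventually_elim
    case (elim y)
    have "0 \<le> l * fst (fst y)" "l * fst (fst y) \<le> 1/10 * 1"
      by (use elim l01 in simp) (rule mult_mono; use elim l01 in simp)
    moreover have "sqrt (1 + snd (fst y)) \<le> 3/2" using elim by (intro real_le_lsqrt) (auto simp: power2_eq_square)
    ultimately show ?case using elim unfolding b1_def by auto
  qed
  \<comment> \<open>In units of the long window the displacement \<open>P t\<close> has coordinates
    at most \<open>7 / \<sigma>\<close> and \<open>13 / \<sigma>\<close>. Together with the
    \<open>8 / \<sigma>\<close> for the linear displacement this explains the bound
    \<open>48 / \<kappa> \<le> \<sigma>\<close>.\<close>
  have s3: "\<bar>\<Psi>1 Ac - (\<integral>y. \<integral>x. K1 y x * Ac x \<partial>lborel \<partial>unif3)\<bar> \<le> 40 / \<sigma> * mass"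
    unfolding \<Psi>1_def
  proof (rule functional_close)
    show "AE y in unif3. \<bar>\<integral>x. K1 y x * (Ac (x + cp y) - Ac x) \<partial>lborel\<bar> \<le> 40 / \<sigma> * mass"
      using rng
    proof eventually_elim
      case (elim y)
      define q where "q = sqrt (1 + snd (fst y))"
      define h where "h = ((b1 y ^ 2 + (1 + snd (fst y))) / \<sigma>, (b1 y ^ 3 + (1 + snd (fst y)) * q) / \<sigma>)"
      have "scl (\<sigma> * T^2) (\<sigma> * T^3) h = (T^2 * (b1 y ^ 2 + (1 + snd (fst y))), T^3 * (b1 y ^ 3 + (1 + snd (fst y)) * q))"
        using \<sigma>0(1) by (simp add: h_def scl_def)
      then have hc: "scl (\<sigma> * T^2) (\<sigma> * T^3) h = cp y"
        by (simp add: cp_def gam_def sig_def b1_def q_def distrib_left)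
      have s: "0 \<le> snd (fst y)" "snd (fst y) \<le> 1" and b: "1 \<le> b1 y" "b1 y \<le> 21/10" and qq: "0 \<le> q" "q \<le> 3/2"
        using elim by (auto simp: q_def)
      have "b1 y ^ 2 \<le> (21/10) ^ 2" "b1 y ^ 3 \<le> (21/10) ^ 3" using b by (intro power_mono; simp)+
      moreover have "(21/10) ^ 2 \<le> (5::real)" "(21/10) ^ 3 \<le> (10::real)" by (simp_all add: power2_eq_square power3_eq_cube)
      ultimately have p: "b1 y ^ 2 \<le> 5" "b1 y ^ 3 \<le> 10" by linarith+
      have p0: "0 \<le> b1 y ^ 2" "0 \<le> b1 y ^ 3" using b by auto
      have q: "(1 + snd (fst y)) * q \<le> 2 * (3/2)" using s qq by (intro mult_mono) auto
      have q0: "0 \<le> (1 + snd (fst y)) * q" using s qq by simp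
      have "\<bar>fst h\<bar> \<le> 7 / \<sigma>" unfolding h_def fst_conv
        by (rule dv) (use p p0 s in linarith)+
      moreover have "\<bar>snd h\<bar> \<le> 13 / \<sigma>" unfolding h_def snd_conv
        by (rule dv) (use p p0 q q0 in linarith)+
      moreover have "2 * (7 / \<sigma>) + 2 * (13 / \<sigma>) = 40 / \<sigma>" by simp
      ultimately have "2 * \<bar>fst h\<bar> + 2 * \<bar>snd h\<bar> \<le> 40 / \<sigma>" by linarith
      then have "\<bar>Ac (x + cp y) - Ac x\<bar> \<le> 40 / \<sigma>" for x
        using tav_shift[of "\<sigma> * T^2" "\<sigma> * T^3" x h] unfolding hc Ac_def by linarith
      then show ?case by (intro weight_bound) (use K1 in auto)
    qed
  qed (use K1 tb \<sigma>0 mass_nonneg in auto)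
  \<comment> \<open>From here on the weight is \<open>f x * Ac x\<close>, independent of
    \<open>y\<close>, as \<open>linear_shift\<close> demands; this is why the last factor is treated
    before the middle one.\<close>
  have e3: "(\<integral>y. \<integral>x. K1 y x * Ac x \<partial>lborel \<partial>unif3) = \<Psi>2 f"
    unfolding \<Psi>2_def K1_def K2_def by (simp only: mult.assoc mult.commute[of "Ac _"])
  have s4: "\<bar>\<Psi>2 f - \<Psi>2 Lf\<bar> \<le> \<kappa> * mass"
    unfolding \<Psi>2_def Lf_def
  proof (rule functional_average)
    fix w :: "real \<times> real" assume w: "\<bar>fst w\<bar> \<le> 1" "\<bar>snd w\<bar> \<le> 1"
    have sc: "scl (\<rho> * T) (\<rho> * T) w = (T * (\<rho> * fst w), T * (\<rho> * snd w))" by (simp add: scl_def)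
    have "\<bar>\<integral>y. \<integral>x. K2 y x * (f (x + cl y) - f (x + cl y + scl (\<rho> * T) (\<rho> * T) w)) \<partial>lborel \<partial>unif3\<bar>
        \<le> (2 * \<bar>\<rho> * fst w\<bar> + 24 * \<bar>\<rho> * snd w\<bar>) * mass"
      unfolding K2_def cl_def sc
      by (rule linear_shift[where k = "\<lambda>x. f x * Ac x"]) (use K2[unfolded K2_def] in simp_all)
    also have "\<dots> \<le> \<kappa> * mass"
    proof (rule mult_right_mono)
      have "\<bar>\<rho> * fst w\<bar> \<le> \<rho>" "\<bar>\<rho> * snd w\<bar> \<le> \<rho>" unfolding abs_mult using \<rho> w by (auto intro: mult_left_le)
      then show "2 * \<bar>\<rho> * fst w\<bar> + 24 * \<bar>\<rho> * snd w\<bar> \<le> \<kappa>" using \<rho> by linarith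
    qed (rule mass_nonneg)
    finally show "\<bar>\<integral>y. \<integral>x. K2 y x * (f (x + cl y) - f (x + cl y + scl (\<rho> * T) (\<rho> * T) w)) \<partial>lborel \<partial>unif3\<bar> \<le> \<kappa> * mass" .
  qed (use K2 \<kappa> mass_nonneg in auto)
  have s5: "\<bar>\<Psi>2 Lf - \<Psi>2 Lc\<bar> \<le> \<kappa> * mass"
    unfolding \<Psi>2_def using DL tb K2 \<kappa> by (intro functional_L2) (auto simp: Lf_def Lc_def)
  have s6: "\<bar>\<Psi>2 Lc - (\<integral>y. \<integral>x. K2 y x * Lc x \<partial>lborel \<partial>unif3)\<bar> \<le> 8 / \<sigma> * mass"
    unfolding \<Psi>2_def
  proof (rule functional_close)
    show "AE y in unif3. \<bar>\<integral>x. K2 y x * (Lc (x + cl y) - Lc x) \<partial>lborel\<bar> \<le> 8 / \<sigma> * mass"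
      using rng
    proof eventually_elim
      case (elim y)
      define h where "h = (b1 y / \<sigma>, sqrt (1 + snd (fst y)) / \<sigma>)"
      have hc: "scl (\<sigma> * T) (\<sigma> * T) h = cl y"
        using \<sigma>0 by (simp add: h_def scl_def cl_def lin_def b1_def)
      have b: "1 \<le> b1 y" "b1 y \<le> 2.1" "0 \<le> sqrt (1 + snd (fst y))" "sqrt (1 + snd (fst y)) \<le> 1.5"
        using elim by auto
      have "\<bar>fst h\<bar> \<le> 2.1 / \<sigma>" unfolding h_def fst_conv by (rule dv) (use b in linarith)+
      moreover have "\<bar>snd h\<bar> \<le> 1.5 / \<sigma>" unfolding h_def snd_conv by (rule dv) (use b in linarith)+
      moreover have "\<bar>Lc (x + cl y) - Lc x\<bar> \<le> 8 / \<sigma>" if "\<bar>fst h\<bar> \<le> 2.1 / \<sigma>" "\<bar>snd h\<bar> \<le> 1.5 / \<sigma>" for x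
      proof -
        have "2 * (2.1 / \<sigma>) + 2 * (1.5 / \<sigma>) = 7.2 / \<sigma>" by (simp add: add_divide_distrib[symmetric])
        also have "\<dots> \<le> 8 / \<sigma>" using \<sigma>0 by (intro divide_right_mono) auto
        finally show ?thesis
          using tav_shift[of "\<sigma> * T" "\<sigma> * T" x h] that unfolding hc Lc_def by linarith
      qed
      ultimately have "\<bar>Lc (x + cl y) - Lc x\<bar> \<le> 8 / \<sigma>" for x by blast
      then show ?case by (intro weight_bound) (use K2 in auto)
    qed
  qed (use K2 tb \<sigma>0 mass_nonneg in auto)
  have e6: "(\<integral>y. \<integral>x. K2 y x * Lc x \<partial>lborel \<partial>unif3) = (\<integral>x. f x * Ac x * Lc x \<partial>lborel)"
    unfolding K2_def using unif3.prob_space by simp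
  have "40 / \<sigma> * mass + 8 / \<sigma> * mass \<le> \<kappa> * mass"
  proof -
    have "48 / \<sigma> \<le> \<kappa>" using \<sigma>0 by (simp add: pos_divide_le_eq)
    from mult_right_mono[OF this mass_nonneg] show ?thesis by (simp add: algebra_simps add_divide_distrib[symmetric])
  qed
  then show ?thesis
    using s1 s2 s3 s4 s5 s6 unfolding e3 e6 lam Ac_def[symmetric] Lc_def[symmetric] by linarith
qed

end

section \<open>Choice of the scale\<close>

text \<open>\<open>ec\<close> and \<open>ef\<close> are the energies of the long and the short
  window at scale \<open>k\<close>. The short window of one scale precedes the long window of the
  next, so the increments chain together, with a loss \<open>g\<close> at each comparison.\<close>

lemma telescoping_energy:
  fixes D ec ef :: "nat \<Rightarrow> real"
  assumes D: "\<And>k. D k \<le> ef k - ec k + g" and step: "\<And>k. ef k \<le> ec (Suc k) + g"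
  shows "(\<Sum>k<Suc n. D k) \<le> ef n - ec 0 + (2 * real n + 1) * g"
proof (induction n)
  case 0
  show ?case using D[of 0] by simp
next
  case (Suc n)
  have "(\<Sum>k<Suc (Suc n). D k) = (\<Sum>k<Suc n. D k) + D (Suc n)" by simp
  also have "\<dots> \<le> (ef n - ec 0 + (2 * real n + 1) * g) + (ef (Suc n) - ec (Suc n) + g)"
    using Suc.IH D by (intro add_mono) auto
  also have "\<dots> \<le> (ec (Suc n) + g - ec 0 + (2 * real n + 1) * g) + (ef (Suc n) - ec (Suc n) + g)"
    using step[of n] by linarith
  finally show ?case by (simp add: algebra_simps)
qed

text \<open>
  \<open>kap\<close> is the admissible relative error in each replacement, \<open>eta\<close>, \<open>ell\<close> and the bound on \<open>rho\<close> come from the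
  smoothing inequality, \<open>rho\<close> and \<open>sgm\<close> are the relative sizes of the short and the long averaging window, and
  \<open>tht\<close> is the ratio of consecutive scales, so small that long windows of one scale lie far inside short
  windows of the previous one.
\<close>

definition kap :: "real \<Rightarrow> real" where "kap \<epsilon> = \<epsilon>\<^sup>2 / 2000000"
definition eta :: "real \<Rightarrow> real" where "eta \<epsilon> = (kap \<epsilon>)\<^sup>2 / 8"
definition ell :: "real \<Rightarrow> real" where "ell \<epsilon> = (eta \<epsilon>)^6 / 10^10"
definition rho :: "real \<Rightarrow> real" where "rho \<epsilon> = (eta \<epsilon>)^9 * (ell \<epsilon>)^6 / 900000"
definition sgm :: "real \<Rightarrow> real" where "sgm \<epsilon> = 48 / kap \<epsilon>"
definition tht :: "real \<Rightarrow> real" where "tht \<epsilon> = (kap \<epsilon>)\<^sup>2 / 64 * rho \<epsilon> / sgm \<epsilon>"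

lemma parameter_bounds:
  assumes "0 < \<epsilon>" "\<epsilon> \<le> 1"
  shows "0 < kap \<epsilon>" "kap \<epsilon> \<le> 1" "5 * kap \<epsilon> < \<epsilon>\<^sup>2 / 262144" "0 < ell \<epsilon>" "ell \<epsilon> \<le> 1"
    "0 < rho \<epsilon>" "26 * rho \<epsilon> \<le> kap \<epsilon>" "48 \<le> sgm \<epsilon>" "0 < tht \<epsilon>" "tht \<epsilon> \<le> 1"
proof -
  have "\<epsilon>\<^sup>2 \<le> 1" "0 < \<epsilon>\<^sup>2" using assms by (auto intro: power_le_one)
  then show k: "0 < kap \<epsilon>" "kap \<epsilon> \<le> 1" and "5 * kap \<epsilon> < \<epsilon>\<^sup>2 / 262144" by (auto simp: kap_def)
  have k2: "0 < (kap \<epsilon>)\<^sup>2" "(kap \<epsilon>)\<^sup>2 \<le> 1" "(kap \<epsilon>)\<^sup>2 \<le> kap \<epsilon>"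
    using k power_le_one[of "kap \<epsilon>" 2] by (auto simp: power2_eq_square mult_left_le)
  then have e: "0 < eta \<epsilon>" "eta \<epsilon> \<le> 1" "8 * eta \<epsilon> \<le> kap \<epsilon>" by (auto simp: eta_def)
  have "0 < (eta \<epsilon>)^6" "(eta \<epsilon>)^6 \<le> 1" using e by (auto intro: power_le_one)
  then show l: "0 < ell \<epsilon>" "ell \<epsilon> \<le> 1" by (auto simp: ell_def)
  have e9: "0 < (eta \<epsilon>)^9" "(eta \<epsilon>)^9 \<le> eta \<epsilon>"
    using e power_decreasing[of 1 9 "eta \<epsilon>"] by auto
  have l6: "0 < (ell \<epsilon>)^6" "(ell \<epsilon>)^6 \<le> 1" using l by (auto intro: power_le_one)
  show r: "0 < rho \<epsilon>" unfolding rho_def using e9 l6 by simp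
  have "(eta \<epsilon>)^9 * (ell \<epsilon>)^6 \<le> eta \<epsilon> * 1" using e9 l6 e by (intro mult_mono) auto
  then have rr: "900000 * rho \<epsilon> \<le> eta \<epsilon>" by (simp add: rho_def)
  show r26: "26 * rho \<epsilon> \<le> kap \<epsilon>" using rr e r by linarith
  show s: "48 \<le> sgm \<epsilon>" using k by (simp add: sgm_def divide_simps)
  show "0 < tht \<epsilon>" unfolding tht_def using k2 r s by simp
  have "(kap \<epsilon>)\<^sup>2 / 64 * rho \<epsilon> \<le> 1 * 1" using k2 r r26 k by (intro mult_mono) auto
  also have "\<dots> \<le> sgm \<epsilon>" using s by simp
  finally show "tht \<epsilon> \<le> 1" unfolding tht_def using s by (simp add: divide_simps)
qed

text \<open>All parameters are monomials in \<open>\<epsilon>\<close>: \<open>kap\<^sup>2\<close>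
  contributes degree 4, \<open>rho\<close> degree \<open>9 * 4 + 6 * 24 = 180\<close>, and
  \<open>1 / sgm\<close> degree 2.\<close>

lemma tht_power: "tht \<epsilon> = tht 1 * \<epsilon>^186"
proof -
  have k: "kap \<epsilon> = kap 1 * \<epsilon>^2" by (simp add: kap_def)
  have e: "eta \<epsilon> = eta 1 * \<epsilon>^4" unfolding eta_def k by (simp add: power_mult_distrib power_mult[symmetric])
  have l: "ell \<epsilon> = ell 1 * \<epsilon>^24" unfolding ell_def e by (simp add: power_mult_distrib power_mult[symmetric])
  have r: "rho \<epsilon> = rho 1 * \<epsilon>^180"
    unfolding rho_def e l by (simp add: power_mult_distrib power_mult[symmetric] power_add[symmetric])
  have p: "\<epsilon>^186 = \<epsilon>^2 * \<epsilon>^2 * \<epsilon>^180 * \<epsilon>^2" by (simp add: power_add[symmetric])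
  show ?thesis
    unfolding tht_def sgm_def k r p by (simp add: power_mult_distrib power2_eq_square)
qed

context density_profile
begin

text \<open>Pigeonhole on energies bounded by \<open>mass\<close>: at some scale the short and long
  averages nearly agree for the windows of \<open>t\<close> and for those of \<open>P t\<close>
  simultaneously. There the main term exceeds the errors of \<open>single_scale\<close>.\<close>

lemma exists_scale:
  fixes N \<epsilon> :: real and K :: nat
  assumes N: "1 \<le> N" and \<epsilon>: "0 < \<epsilon>" "\<epsilon> \<le> 1"
    and supp: "\<And>x. f x \<noteq> 0 \<Longrightarrow> x \<in> {-(N^2)..2*N^2} \<times> {-(N^3)..2*N^3}"
    and m: "\<epsilon> * (N^2 * N^3) \<le> mass" and K: "4 / (kap \<epsilon>)\<^sup>2 \<le> real K"
  shows "\<exists>k<K. 0 < lam (N / sgm \<epsilon> * tht \<epsilon> ^ k) (ell \<epsilon>) f"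
proof -
  define \<kappa> \<rho> \<sigma> \<theta> \<theta>0 where "\<kappa> = kap \<epsilon>" and "\<rho> = rho \<epsilon>" and "\<sigma> = sgm \<epsilon>" and "\<theta> = tht \<epsilon>" and "\<theta>0 = \<kappa>\<^sup>2 / 64"
  note pb = parameter_bounds[OF \<epsilon>, folded \<kappa>_def \<rho>_def \<sigma>_def \<theta>_def]
  \<comment> \<open>Starting at \<open>N / \<sigma>\<close> keeps even the longest windows within
    \<open>N\<close>, \<open>N\<^sup>2\<close> and \<open>N\<^sup>3\<close>, as
    \<open>main_term\<close> needs.\<close>
  define T where "T k = N / \<sigma> * \<theta>^k" for k :: nat
  have \<sigma>0: "0 < \<sigma>" using pb(8) by linarith
  have \<kappa>2: "0 < \<kappa>\<^sup>2" "\<kappa>\<^sup>2 \<le> 1" using pb(1,2) by (auto intro: power_le_one)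
  have \<theta>0: "0 < \<theta>0" using \<kappa>2 by (simp add: \<theta>0_def)
  have \<theta>e: "\<theta> * \<sigma> = \<theta>0 * \<rho>"
    using \<sigma>0 by (simp add: \<theta>_def tht_def \<theta>0_def \<kappa>_def \<rho>_def \<sigma>_def)
  have T0: "0 < T k" for k using N \<sigma>0 pb(9) by (simp add: T_def)
  have Ts: "T (Suc k) = \<theta> * T k" for k by (simp add: T_def)
  have TN: "\<sigma> * T k \<le> N" for k
  proof -
    have "N * \<theta>^k \<le> N * 1" using pb(9,10) N by (intro mult_left_mono power_le_one) auto
    then show ?thesis using \<sigma>0 by (simp add: T_def)
  qed
  have TN1: "T k \<le> N" for k
  proof -
    have "1 * T k \<le> \<sigma> * T k" using pb(8) T0[of k] by (intro mult_right_mono) auto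
    then show ?thesis using TN[of k] by linarith
  qed
  have sT: "\<sigma> * T k ^ 2 \<le> N^2" "\<sigma> * T k ^ 3 \<le> N^3" for k
  proof -
    have "(\<sigma> * T k) * T k \<le> N * N" using TN TN1 T0[of k] N by (intro mult_mono) auto
    then show 2: "\<sigma> * T k ^ 2 \<le> N^2" by (simp add: power2_eq_square mult.assoc)
    have "(\<sigma> * T k ^ 2) * T k \<le> N^2 * N" using 2 TN1[of k] T0[of k] N by (intro mult_mono) auto
    then show "\<sigma> * T k ^ 3 \<le> N^3" by (simp add: power2_eq_square power3_eq_cube mult.assoc)
  qed
  have NN: "N \<le> N^2" "N \<le> N^3"
    using N power_increasing[of 1 2 N] power_increasing[of 1 3 N] by auto
  have mpos: "0 < mass"
  proof -
    have "0 < \<epsilon> * (N^2 * N^3)" using \<epsilon>(1) N by (intro mult_pos_pos zero_less_power) auto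
    then show ?thesis using m by linarith
  qed
  have \<rho>\<sigma>: "\<rho> \<le> \<theta>0 * \<sigma>"
  proof -
    have "\<rho> * 1 \<le> (\<kappa>/26) * 1" using pb(7) by simp
    also have "\<dots> \<le> \<theta>0 * \<sigma>"
    proof -
      have "\<theta>0 * \<sigma> = \<kappa> * (48 / 64)"
        using pb(1) by (simp add: \<theta>0_def \<sigma>_def sgm_def \<kappa>_def power2_eq_square)
      then show ?thesis using pb(1) by simp
    qed
    finally show ?thesis by simp
  qed
  have fine: "\<rho> * a \<le> \<theta>0 * (\<sigma> * a)" if "0 \<le> a" for a
    using mult_right_mono[OF \<rho>\<sigma> that] by (simp add: mult.assoc)
  \<comment> \<open>\<open>tht\<close> is chosen to make this an equality. For the windows of
    \<open>P t\<close> the additional factors \<open>T\<close> only shrink from one scale to the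
    next.\<close>
  have next1: "\<sigma> * T (Suc k) \<le> \<theta>0 * (\<rho> * T k)" for k
  proof -
    have "\<sigma> * T (Suc k) = (\<theta> * \<sigma>) * T k" by (simp add: Ts)
    then show ?thesis by (simp add: \<theta>e)
  qed
  have next2: "\<sigma> * T (Suc k) ^ 2 \<le> \<theta>0 * (\<rho> * T k ^ 2)" "\<sigma> * T (Suc k) ^ 3 \<le> \<theta>0 * (\<rho> * T k ^ 3)" for k
  proof -
    have le: "T (Suc k) \<le> T k" using mult_right_mono[OF pb(10), of "T k"] T0[of k] by (simp add: Ts)
    have "(\<sigma> * T (Suc k)) * T (Suc k) \<le> (\<theta>0 * (\<rho> * T k)) * T k"
      by (rule mult_mono[OF next1 le]) (use T0[of k] T0[of "Suc k"] \<theta>0 pb(6) in simp_all)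
    then show 2: "\<sigma> * T (Suc k) ^ 2 \<le> \<theta>0 * (\<rho> * T k ^ 2)" by (simp add: power2_eq_square mult.assoc)
    have "(\<sigma> * T (Suc k) ^ 2) * T (Suc k) \<le> (\<theta>0 * (\<rho> * T k ^ 2)) * T k"
      by (rule mult_mono[OF 2 le]) (use T0[of k] T0[of "Suc k"] \<theta>0 pb(6) in simp_all)
    then show "\<sigma> * T (Suc k) ^ 3 \<le> \<theta>0 * (\<rho> * T k ^ 3)" by (simp add: power2_eq_square power3_eq_cube mult.assoc)
  qed
  define DP where "DP k = (\<integral>x. (tav (\<rho> * T k^2) (\<rho> * T k^3) x - tav (\<sigma> * T k^2) (\<sigma> * T k^3) x)\<^sup>2 \<partial>lborel)" for k
  define DL where "DL k = (\<integral>x. (tav (\<rho> * T k) (\<rho> * T k) x - tav (\<sigma> * T k) (\<sigma> * T k) x)\<^sup>2 \<partial>lborel)" for k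
  define g where "g = 8 * \<theta>0 * mass"
  have nn: "0 \<le> \<rho> * T k ^ j" "0 < \<sigma> * T k ^ j" "0 < \<rho> * T k ^ j" "0 \<le> \<sigma> * T k ^ j" for k j
    using T0[of k] pb(6) \<sigma>0 by auto
  note nn1 = nn[where j = 1, unfolded power_one_right]
  have fineT: "\<rho> * T k ^ j \<le> \<theta>0 * (\<sigma> * T k ^ j)" for k j
    by (rule fine) (use T0[of k] in simp)
  note fineT1 = fineT[where j = 1, unfolded power_one_right]
  have P: "integrable lborel (\<lambda>x. (tav (\<rho> * T k^2) (\<rho> * T k^3) x - tav (\<sigma> * T k^2) (\<sigma> * T k^3) x)\<^sup>2)"
    "DP k \<le> energy (\<rho> * T k^2) (\<rho> * T k^3) - energy (\<sigma> * T k^2) (\<sigma> * T k^3) + g" for k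
    unfolding DP_def g_def
    by (rule tav_diff_energy[OF \<theta>0 nn(2) nn(1) fineT nn(2) nn(1) fineT])+
  have L: "integrable lborel (\<lambda>x. (tav (\<rho> * T k) (\<rho> * T k) x - tav (\<sigma> * T k) (\<sigma> * T k) x)\<^sup>2)"
    "DL k \<le> energy (\<rho> * T k) (\<rho> * T k) - energy (\<sigma> * T k) (\<sigma> * T k) + g" for k
    unfolding DL_def g_def
    by (rule tav_diff_energy[OF \<theta>0 nn1(2) nn1(1) fineT1 nn1(2) nn1(1) fineT1])+
  have sq0: "0 \<le> (\<integral>x. (h x)\<^sup>2 \<partial>lborel)" for h :: "real \<times> real \<Rightarrow> real" by (simp add: integral_nonneg_AE)
  have stepP: "energy (\<rho> * T k^2) (\<rho> * T k^3) \<le> energy (\<sigma> * T (Suc k)^2) (\<sigma> * T (Suc k)^3) + g" for k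
    using order_trans[OF sq0 tav_diff_energy(2)[OF \<theta>0 nn(3) nn(4) next2(1) nn(3) nn(4) next2(2)]] unfolding g_def by (simp add: algebra_simps)
  have stepL: "energy (\<rho> * T k) (\<rho> * T k) \<le> energy (\<sigma> * T (Suc k)) (\<sigma> * T (Suc k)) + g" for k
    using order_trans[OF sq0 tav_diff_energy(2)[OF \<theta>0 nn1(3) nn1(4) next1 nn1(3) nn1(4) next1]] unfolding g_def by (simp add: algebra_simps)
  have g0: "0 \<le> g" using \<theta>0 mpos by (simp add: g_def)
  have "0 < 4 / (kap \<epsilon>)\<^sup>2" using \<kappa>2 unfolding \<kappa>_def by simp
  then have K0: "0 < real K" using K by linarith
  then obtain n where n: "K = Suc n" by (cases K) auto
  have sumP: "(\<Sum>k<K. DP k) \<le> mass + 2 * real K * g"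
  proof -
    have "(\<Sum>k<K. DP k) \<le> energy (\<rho> * T n^2) (\<rho> * T n^3) - energy (\<sigma> * T 0^2) (\<sigma> * T 0^3) + (2 * real n + 1) * g"
      unfolding n by (rule telescoping_energy[where ef = "\<lambda>k. energy (\<rho> * T k^2) (\<rho> * T k^3)" and ec = "\<lambda>k. energy (\<sigma> * T k^2) (\<sigma> * T k^3)"])
        (use P stepP in auto)
    also have "\<dots> \<le> mass - 0 + 2 * real K * g"
      using energy_bounds g0 by (intro add_mono diff_mono mult_right_mono) (auto simp: n)
    finally show ?thesis by simp
  qed
  have sumL: "(\<Sum>k<K. DL k) \<le> mass + 2 * real K * g"
  proof -
    have "(\<Sum>k<K. DL k) \<le> energy (\<rho> * T n) (\<rho> * T n) - energy (\<sigma> * T 0) (\<sigma> * T 0) + (2 * real n + 1) * g"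
      unfolding n by (rule telescoping_energy[where ef = "\<lambda>k. energy (\<rho> * T k) (\<rho> * T k)" and ec = "\<lambda>k. energy (\<sigma> * T k) (\<sigma> * T k)"])
        (use L stepL in auto)
    also have "\<dots> \<le> mass - 0 + 2 * real K * g"
      using energy_bounds g0 by (intro add_mono diff_mono mult_right_mono) (auto simp: n)
    finally show ?thesis by simp
  qed
  \<comment> \<open>With \<open>g = \<kappa>\<^sup>2 * mass / 8\<close> the two sums together are at
    most \<open>2 * mass + real K * \<kappa>\<^sup>2 * mass / 2\<close>. If every scale failed,
    \<open>real K * \<kappa>\<^sup>2 < 4\<close> would follow, against the choice of
    \<open>K\<close>.\<close>
  have "\<exists>k<K. DP k + DL k \<le> \<kappa>\<^sup>2 * mass"
  proof (rule ccontr)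
    assume "\<not> ?thesis"
    then have "\<kappa>\<^sup>2 * mass < DP k + DL k" if "k < K" for k using that by force
    then have "(\<Sum>k<K. \<kappa>\<^sup>2 * mass) < (\<Sum>k<K. DP k + DL k)"
      using n by (intro sum_strict_mono) auto
    also have "\<dots> \<le> 2 * mass + 4 * real K * g"
      using sumP sumL by (simp add: sum.distrib)
    finally have "real K * (\<kappa>\<^sup>2 * mass) < 2 * mass + real K * (\<kappa>\<^sup>2 * mass) / 2"
      by (simp add: g_def \<theta>0_def mult_ac)
    then have "(real K * \<kappa>\<^sup>2) * mass < 4 * mass" by (simp add: mult.assoc)
    then have "real K * \<kappa>\<^sup>2 < 4" using mpos by simp
    moreover have "4 \<le> real K * \<kappa>\<^sup>2" using K \<kappa>2 unfolding \<kappa>_def by (simp add: pos_divide_le_eq)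
    ultimately show False by simp
  qed
  then obtain k where k: "k < K" "DP k + DL k \<le> \<kappa>\<^sup>2 * mass" by blast
  have D0: "0 \<le> DP k" "0 \<le> DL k" unfolding DP_def DL_def by (rule sq0)+
  have "(\<integral>x. f x * tav (\<sigma> * T k^2) (\<sigma> * T k^3) x * tav (\<sigma> * T k) (\<sigma> * T k) x \<partial>lborel) - 5 * \<kappa> * mass \<le> lam (T k) (ell \<epsilon>) f"
  proof (rule single_scale[where \<eta> = "eta \<epsilon>" and \<rho> = \<rho>])
    show "(\<integral>x. (tav (\<rho> * T k^2) (\<rho> * T k^3) x - tav (\<sigma> * T k^2) (\<sigma> * T k^3) x)\<^sup>2 \<partial>lborel) \<le> \<kappa>\<^sup>2 * mass"
      using k(2) D0 unfolding DP_def[symmetric] by linarith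
    show "(\<integral>x. (tav (\<rho> * T k) (\<rho> * T k) x - tav (\<sigma> * T k) (\<sigma> * T k) x)\<^sup>2 \<partial>lborel) \<le> \<kappa>\<^sup>2 * mass"
      using k(2) D0 unfolding DL_def[symmetric] by linarith
  qed (use pb P L T0 in \<open>simp_all add: eta_def ell_def rho_def sgm_def \<kappa>_def \<rho>_def \<sigma>_def\<close>)
  moreover have "\<epsilon>\<^sup>2 / 262144 * mass \<le> (\<integral>x. f x * tav (\<sigma> * T k^2) (\<sigma> * T k^3) x * tav (\<sigma> * T k) (\<sigma> * T k) x \<partial>lborel)"
    using nn(2) nn1(2) sT TN NN \<epsilon> m
    by (intro main_term[OF supp]) (auto intro: order_trans[OF TN])
  moreover have "5 * \<kappa> * mass < \<epsilon>\<^sup>2 / 262144 * mass"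
    using pb(3) mpos by (rule mult_strict_right_mono)
  ultimately have "0 < lam (T k) (ell \<epsilon>) f" by linarith
  then show ?thesis using k(1) by (auto simp: T_def \<sigma>_def \<theta>_def)
qed

lemma lam_pos_config:
  assumes "0 < lam T l f" and l: "0 \<le> l" "l \<le> 1"
  shows "\<exists>x \<tau> s. 1 \<le> \<tau> \<and> \<tau> \<le> 3 \<and> 0 \<le> s \<and> s \<le> 1 \<and> f x \<noteq> 0 \<and> f (x + lin T \<tau> s) \<noteq> 0 \<and> f (x + (gam T \<tau> + sig T s)) \<noteq> 0"
proof (rule ccontr)
  assume no: "\<not> ?thesis"
  have z: "AE y in unif3. (\<integral>x. f x * f (x + lin T (1 + snd y + l * fst (fst y)) (snd (fst y)))
      * f (x + (gam T (1 + snd y + l * fst (fst y)) + sig T (snd (fst y)))) \<partial>lborel) = 0"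
    using AE_unif3
  proof eventually_elim
    case (elim y)
    have b: "0 \<le> l * fst (fst y)" "l * fst (fst y) \<le> 1" using elim l by (auto intro: mult_le_one)
    have "f x * f (x + lin T (1 + snd y + l * fst (fst y)) (snd (fst y)))
      * f (x + (gam T (1 + snd y + l * fst (fst y)) + sig T (snd (fst y)))) = 0" for x
    proof (rule ccontr)
      assume "\<not> ?thesis"
      then have nz: "f x \<noteq> 0" "f (x + lin T (1 + snd y + l * fst (fst y)) (snd (fst y))) \<noteq> 0"
        "f (x + (gam T (1 + snd y + l * fst (fst y)) + sig T (snd (fst y)))) \<noteq> 0"
        by (simp_all only: mult_eq_0_iff) blast+
      have "1 \<le> 1 + snd y + l * fst (fst y)" "1 + snd y + l * fst (fst y) \<le> 3" "0 \<le> snd (fst y)" "snd (fst y) \<le> 1"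
        using elim b by auto
      with nz no show False by blast
    qed
    then show ?case by (simp only: Bochner_Integration.integral_zero)
  qed
  have "lam T l f = (\<integral>y. 0 \<partial>unif3)"
    unfolding lam_def using z by (intro integral_cong_AE) auto
  then show False using assms by simp
qed

end

section \<open>Return to \<open>P\<close> and the size of the gap\<close>

lemma P_lin: "0 \<le> s \<Longrightarrow> P (lin T \<tau> s) = gam T \<tau> + sig T s"
  by (simp add: P_def lin_def gam_def sig_def power_mult_distrib power3_eq_cube algebra_simps)

definition scales :: "real \<Rightarrow> nat" where
  "scales \<epsilon> = nat \<lceil>4 / (kap \<epsilon>)\<^sup>2\<rceil>"

text \<open>A lower bound for all scales used, divided by \<open>N\<close> and halved: a limit of
  configurations keeps only the weak inequality for \<open>t\<close>, and the factor 2 makes it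
  strict.\<close>

definition del :: "real \<Rightarrow> real" where
  "del \<epsilon> = tht \<epsilon> ^ scales \<epsilon> / (2 * sgm \<epsilon>)"

lemma del_pos:
  assumes "0 < \<epsilon>" "\<epsilon> \<le> 1"
  shows "0 < del \<epsilon>"
  unfolding del_def using parameter_bounds(8,9)[OF assms] by simp

lemma exp_ge_scaled_power:
  fixes C u :: real
  assumes "1 \<le> C" "0 < u" "0 < n"
  shows "C * u^n \<le> exp (real n * C * u)"
proof -
  have "C * u^n \<le> C^n * u^n"
    using assms power_increasing[of 1 n C] by (intro mult_right_mono) auto
  also have "\<dots> = (C * u)^n" by (simp add: power_mult_distrib)
  also have "\<dots> \<le> exp (C * u)^n"
  proof (rule power_mono)
    show "C * u \<le> exp (C * u)" using exp_ge_add_one_self[of "C * u"] by linarith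
  qed (use assms in simp)
  also have "\<dots> = exp (real n * C * u)" by (simp add: exp_of_nat_mult[symmetric] mult.assoc)
  finally show ?thesis .
qed

text \<open>\<open>- ln (del \<epsilon>)\<close> is polynomial in \<open>1 / \<epsilon>\<close>,
  even with the crude \<open>ln x \<le> x\<close>: \<open>sgm\<close> has degree 2, and
  \<open>scales\<close> and \<open>1 / tht\<close> have degrees 4 and 186. The exponential of a
  multiple of \<open>\<epsilon> powr (-3)\<close> exceeds this for every \<open>\<epsilon>\<close>
  at once.\<close>

lemma del_lower:
  "\<exists>c>0. \<forall>\<epsilon>. 0 < \<epsilon> \<and> \<epsilon> < 1 \<longrightarrow> exp (- exp (c * \<epsilon> powr (-3))) \<le> del \<epsilon>"
proof -
  define k1 where "k1 = kap 1"
  have k1: "0 < k1" "k1 \<le> 1" using parameter_bounds(1,2)[of 1] by (auto simp: k1_def)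
  have t1: "0 < tht 1" "tht 1 \<le> 1" using parameter_bounds(9,10)[of 1] by auto
  define C where "C = 2 * (48 / k1) + (4 / k1\<^sup>2 + 1) / tht 1"
  have C1: "1 \<le> C"
  proof -
    have "1 \<le> 2 * (48 / k1)" using k1 by (simp add: pos_le_divide_eq)
    moreover have "0 \<le> (4 / k1\<^sup>2 + 1) / tht 1" using k1 t1 by simp
    ultimately show ?thesis by (simp add: C_def)
  qed
  have "exp (- exp (64 * C * \<epsilon> powr (-3))) \<le> del \<epsilon>" if \<epsilon>: "0 < \<epsilon>" "\<epsilon> < 1" for \<epsilon>
  proof -
    define u where "u = 1 / \<epsilon>"
    have u: "1 < u" "0 < u" using \<epsilon> by (auto simp: u_def)
    note pb = parameter_bounds[of \<epsilon>]
    have th: "0 < tht \<epsilon>" "0 < sgm \<epsilon>" using pb(8,9) \<epsilon> by auto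
    have k: "kap \<epsilon> = k1 * \<epsilon>\<^sup>2" by (simp add: kap_def k1_def)
    have s: "sgm \<epsilon> = 48 / k1 * u^2" by (simp add: sgm_def k u_def power_divide)
    have ti: "1 / tht \<epsilon> = 1 / tht 1 * u^186" unfolding tht_power[of \<epsilon>] by (simp add: u_def power_divide)
    have "real (scales \<epsilon>) \<le> 4 / (kap \<epsilon>)\<^sup>2 + 1"
    proof -
      have "0 \<le> 4 / (kap \<epsilon>)\<^sup>2" by simp
      then show ?thesis unfolding scales_def by linarith
    qed
    also have "4 / (kap \<epsilon>)\<^sup>2 = 4 / k1\<^sup>2 * u^4"
      by (simp add: k u_def power_divide power_mult_distrib power_mult[symmetric])
    also have "4 / k1\<^sup>2 * u^4 + 1 \<le> (4 / k1\<^sup>2 + 1) * u^4"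
      using u by (simp add: distrib_right one_le_power)
    finally have sc: "real (scales \<epsilon>) \<le> (4 / k1\<^sup>2 + 1) * u^4" .
    have "- ln (del \<epsilon>) = ln (2 * sgm \<epsilon>) + real (scales \<epsilon>) * ln (1 / tht \<epsilon>)"
      unfolding del_def using th by (simp add: ln_div ln_realpow)
    also have "\<dots> \<le> 2 * sgm \<epsilon> + real (scales \<epsilon>) * (1 / tht \<epsilon>)"
      using th by (intro add_mono mult_left_mono ln_bound) auto
    also have "\<dots> \<le> 2 * (48 / k1 * u^2) + ((4 / k1\<^sup>2 + 1) * u^4) * (1 / tht 1 * u^186)"
      unfolding s ti using sc t1 u by (intro add_mono mult_right_mono order.refl) auto
    also have "\<dots> = 2 * (48 / k1) * u^2 + (4 / k1\<^sup>2 + 1) / tht 1 * u^190"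
      by (simp add: power_add[symmetric] mult_ac)
    \<comment> \<open>The degree 190 is rounded up to \<open>192 = 3 * 64\<close> to obtain a power
      of \<open>u^3\<close>; this produces the constant \<open>64 * C\<close>.\<close>
    also have "\<dots> \<le> 2 * (48 / k1) * u^192 + (4 / k1\<^sup>2 + 1) / tht 1 * u^192"
      using u k1 t1 by (intro add_mono mult_left_mono power_increasing) auto
    also have "\<dots> = C * (u^3)^64" by (simp add: C_def distrib_right power_mult[symmetric])
    also have "\<dots> \<le> exp (real 64 * C * u^3)" by (rule exp_ge_scaled_power) (use C1 u in auto)
    also have "u^3 = \<epsilon> powr (-3)"
      using \<epsilon> by (simp add: u_def powr_minus powr_numeral divide_inverse power_inverse)
    finally have "- exp (64 * C * \<epsilon> powr (-3)) \<le> ln (del \<epsilon>)" by simp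
    then have "exp (- exp (64 * C * \<epsilon> powr (-3))) \<le> exp (ln (del \<epsilon>))" by (simp only: exp_le_cancel_iff)
    then show ?thesis using del_pos[of \<epsilon>] \<epsilon> by simp
  qed
  then show ?thesis using C1 by (intro exI[of _ "64 * C"]) auto
qed

section \<open>From continuous densities to sets\<close>

lemma compact_bump:
  fixes Z :: "(real \<times> real) set" and N :: real and j :: nat
  assumes Z: "compact Z" "Z \<noteq> {}" "Z \<subseteq> {0..N^2} \<times> {0..N^3}" and N: "1 \<le> N"
  defines "f \<equiv> \<lambda>x. max 0 (1 - (real j + 1) * infdist x Z)"
  shows "density_profile f"
    and "f x \<noteq> 0 \<Longrightarrow> infdist x Z < 1 / (real j + 1)"
    and "f x \<noteq> 0 \<Longrightarrow> x \<in> {-(N^2)..2*N^2} \<times> {-(N^3)..2*N^3}"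
    and "measure lebesgue Z \<le> (\<integral>x. f x \<partial>lborel)"
proof -
  show near: "infdist x Z < 1 / (real j + 1)" if "f x \<noteq> 0" for x
  proof -
    have "(real j + 1) * infdist x Z < 1" using that by (auto simp: f_def max_def split: if_splits)
    then show ?thesis by (simp add: pos_less_divide_eq mult.commute)
  qed
  show supp: "x \<in> {-(N^2)..2*N^2} \<times> {-(N^3)..2*N^3}" if fx: "f x \<noteq> 0" for x
  proof -
    have "1 / (real j + 1) \<le> 1" by simp
    then have d1: "infdist x Z < 1" using near[OF fx] by linarith
    obtain z where z: "z \<in> Z" "infdist x Z = dist x z"
      using infdist_attains_inf[OF compact_imp_closed[OF Z(1)] Z(2)] by blast
    have "\<bar>fst x - fst z\<bar> \<le> dist x z" "\<bar>snd x - snd z\<bar> \<le> dist x z"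
      using dist_fst_le[of x z] dist_snd_le[of x z] by (simp_all add: dist_real_def)
    moreover have "fst z \<in> {0..N^2}" "snd z \<in> {0..N^3}" using z(1) Z(3) by (auto simp: mem_Times_iff)
    moreover have "1 \<le> N^2" "1 \<le> N^3" using N by (auto intro: one_le_power)
    ultimately show ?thesis using d1 z(2) by (auto simp: mem_Times_iff abs_le_iff)
  qed
  have cont: "continuous_on UNIV f" unfolding f_def by (intro continuous_intros)
  then have fm [measurable]: "f \<in> borel_measurable borel" by (rule borel_measurable_continuous_onI)
  have f01: "0 \<le> f x" "f x \<le> 1" for x unfolding f_def using infdist_nonneg[of x Z] by auto
  let ?B = "cbox (-(N^2), -(N^3)) (2*N^2, 2*N^3)"
  have int: "integrable lborel f"
  proof (rule Bochner_Integration.integrable_bound)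
    show "integrable lborel (indicator ?B :: _ \<Rightarrow> real)"
      by (intro integrable_real_indicator emeasure_lborel_cbox_finite) simp
    show "AE x in lborel. norm (f x) \<le> norm (indicator ?B x :: real)"
    proof (rule AE_I2)
      fix x show "norm (f x) \<le> norm (indicator ?B x :: real)"
        using f01[of x] supp[of x] by (cases "f x = 0") (auto simp: cbox_Pair_eq mem_Times_iff)
    qed
  qed simp
  show "density_profile f" by unfold_locales (use cont f01 int in auto)
  have Zb: "Z \<in> sets lborel" using Z(1) by (simp add: compact_imp_closed)
  have "measure lebesgue Z = measure lborel Z" using Zb by (simp add: measure_completion)
  also have "\<dots> = (\<integral>x. indicator Z x \<partial>lborel)" using Zb by simp
  also have "\<dots> \<le> (\<integral>x. f x \<partial>lborel)"
  proof (rule integral_mono[OF _ int])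
    show "integrable lborel (indicator Z :: _ \<Rightarrow> real)"
      using Zb emeasure_compact_finite[OF Z(1)] by (intro integrable_real_indicator) auto
    show "indicator Z x \<le> f x" for x
      using f01[of x] by (auto simp: indicator_def f_def)
  qed
  finally show "measure lebesgue Z \<le> (\<integral>x. f x \<partial>lborel)" .
qed

text \<open>The bumps dominate the indicator of \<open>Z\<close>, so each has mass at least
  \<open>\<epsilon> * N^5\<close> and yields a configuration within \<open>1 / (j + 1)\<close> of
  \<open>Z\<close>. The lower bound \<open>r\<close> on \<open>t\<close> is the same for all
  \<open>j\<close>, so a limit point has its three points in \<open>Z\<close> and does not
  degenerate.\<close>

lemma compact_config:
  fixes Z :: "(real \<times> real) set" and N \<epsilon> :: real
  assumes Z: "compact Z" "Z \<noteq> {}" "Z \<subseteq> {0..N^2} \<times> {0..N^3}" and N: "1 \<le> N" and \<epsilon>: "0 < \<epsilon>" "\<epsilon> < 1"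
    and m: "\<epsilon> * N^5 \<le> measure lebesgue Z"
  shows "\<exists>x t. del \<epsilon> * N < fst t \<and> del \<epsilon> * N < snd t \<and> x \<in> Z \<and> x + t \<in> Z \<and> x + P t \<in> Z"
proof -
  define f where "f j x = max 0 (1 - (real j + 1) * infdist x Z)" for j :: nat and x
  note bump = compact_bump[OF Z N, folded f_def]
  note pb = parameter_bounds[of \<epsilon>]
  have \<sigma>: "48 \<le> sgm \<epsilon>" and \<theta>: "0 < tht \<epsilon>" "tht \<epsilon> \<le> 1" and l: "0 < ell \<epsilon>" "ell \<epsilon> \<le> 1"
    using pb \<epsilon> by auto
  define T where "T k = N / sgm \<epsilon> * tht \<epsilon> ^ k" for k :: nat
  define r where "r = N / sgm \<epsilon> * tht \<epsilon> ^ scales \<epsilon>"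
  have Kb: "4 / (kap \<epsilon>)\<^sup>2 \<le> real (scales \<epsilon>)" unfolding scales_def by linarith
  \<comment> \<open>A compact set holding every pair \<open>(x, t)\<close> found: \<open>x\<close>
    lies in the enlarged box, and the components of \<open>t\<close> are at most
    \<open>3 * N\<close> because \<open>T k \<le> N\<close> and the factors are at most 3.\<close>
  let ?C = "({-(N^2)..2*N^2} \<times> {-(N^3)..2*N^3}) \<times> ({r..3*N} \<times> {r..3*N})"
  have ex: "\<exists>z. z \<in> ?C \<and> infdist (fst z) Z < 1 / (real j + 1) \<and> infdist (fst z + snd z) Z < 1 / (real j + 1)
      \<and> infdist (fst z + P (snd z)) Z < 1 / (real j + 1)" for j
  proof -
    interpret density_profile "f j" by (rule bump(1))
    have "\<epsilon> * (N^2 * N^3) \<le> mass"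
      using m bump(4)[of j] unfolding mass_def by (simp add: power_add[symmetric])
    then obtain k where k: "k < scales \<epsilon>" "0 < lam (T k) (ell \<epsilon>) (f j)"
      using exists_scale[OF N, of \<epsilon> "scales \<epsilon>"] \<epsilon> bump(3) Kb unfolding T_def by auto
    obtain x \<tau> s where c: "1 \<le> \<tau>" "\<tau> \<le> 3" "0 \<le> s" "s \<le> 1" "f j x \<noteq> 0" "f j (x + lin (T k) \<tau> s) \<noteq> 0"
        "f j (x + (gam (T k) \<tau> + sig (T k) s)) \<noteq> 0"
      using lam_pos_config[OF k(2)] l by auto
    have Nn: "0 \<le> N / sgm \<epsilon>" "N / sgm \<epsilon> \<le> N" using N \<sigma> by (auto simp: divide_simps mult_left_le)
    have rT: "r \<le> T k" unfolding r_def T_def using k(1) \<theta> Nn by (intro mult_left_mono power_decreasing) auto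
    have TN: "0 \<le> T k" "T k \<le> N"
    proof -
      show "0 \<le> T k" unfolding T_def by (rule mult_nonneg_nonneg[OF Nn(1)]) (use \<theta> in simp)
      have "T k \<le> N / sgm \<epsilon> * 1" unfolding T_def using Nn \<theta> by (intro mult_left_mono power_le_one) auto
      then show "T k \<le> N" using Nn by linarith
    qed
    have sq: "1 \<le> sqrt (1 + s)" "sqrt (1 + s) \<le> 3" using c by (auto intro!: real_le_lsqrt)
    have bd: "r \<le> T k * a \<and> T k * a \<le> 3 * N" if "1 \<le> a" "a \<le> 3" for a
    proof -
      have "T k * 1 \<le> T k * a" "T k * a \<le> N * 3" using that TN by (intro mult_mono; simp)+
      then show ?thesis using rT by simp
    qed
    have "(x, lin (T k) \<tau> s) \<in> ?C"
      using bump(3)[OF c(5)] bd[OF c(1,2)] bd[OF sq] by (auto simp: lin_def)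
    moreover have "x + P (lin (T k) \<tau> s) = x + (gam (T k) \<tau> + sig (T k) s)" by (simp add: P_lin c(3))
    ultimately show ?thesis
      using bump(2)[OF c(5)] bump(2)[OF c(6)] bump(2)[OF c(7)] by (intro exI[of _ "(x, lin (T k) \<tau> s)"]) simp
  qed
  then obtain z where z: "\<And>j. z j \<in> ?C" "\<And>j. infdist (fst (z j)) Z < 1 / (real j + 1)"
      "\<And>j. infdist (fst (z j) + snd (z j)) Z < 1 / (real j + 1)"
      "\<And>j. infdist (fst (z j) + P (snd (z j))) Z < 1 / (real j + 1)"
    by metis
  have "compact ?C" by (intro compact_Times compact_Icc)
  then obtain q \<phi> where q: "q \<in> ?C" "strict_mono \<phi>" "(z \<circ> \<phi>) \<longlonglongrightarrow> q"
    using z(1) unfolding compact_def by blast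
  have lim0: "(\<lambda>j. 1 / (real (\<phi> j) + 1)) \<longlonglongrightarrow> 0"
  proof -
    have "(\<lambda>j. 1 / (real j + 1)) \<longlonglongrightarrow> 0" using LIMSEQ_inverse_real_of_nat by (simp add: inverse_eq_divide add.commute)
    from LIMSEQ_subseq_LIMSEQ[OF this q(2)] show ?thesis by (simp add: o_def)
  qed
  have closedZ: "closed Z" by (rule compact_imp_closed[OF Z(1)])
  have mem: "h q \<in> Z" if h: "continuous_on UNIV h" and d: "\<And>j. infdist (h (z j)) Z < 1 / (real j + 1)" for h
  proof -
    have "continuous_on UNIV (\<lambda>p. infdist (h p) Z)" using h by (intro continuous_intros)
    then have "(\<lambda>j. infdist (h ((z \<circ> \<phi>) j)) Z) \<longlonglongrightarrow> infdist (h q) Z"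
      using q(3) by (rule continuous_on_tendsto_compose) auto
    moreover have "infdist (h ((z \<circ> \<phi>) j)) Z \<le> 1 / (real (\<phi> j) + 1)" for j
      using d[of "\<phi> j"] by simp
    ultimately have "infdist (h q) Z \<le> 0"
      using lim0 by (intro LIMSEQ_le) auto
    then have "infdist (h q) Z = 0" using infdist_nonneg[of "h q" Z] by linarith
    then show ?thesis using in_closed_iff_infdist_zero[OF closedZ Z(2)] by simp
  qed
  have Pc: "continuous_on UNIV (\<lambda>p :: (real \<times> real) \<times> (real \<times> real). fst p + P (snd p))"
    unfolding P_def by (intro continuous_intros)
  have "fst q \<in> Z" "fst q + snd q \<in> Z" "fst q + P (snd q) \<in> Z"
    by (rule mem; use z Pc in \<open>simp add: continuous_intros\<close>)+
  moreover have "del \<epsilon> * N < r"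
  proof -
    have "del \<epsilon> * N = r / 2" by (simp add: del_def r_def mult_ac)
    moreover have "0 < r" unfolding r_def using N \<sigma> \<theta> by simp
    ultimately show ?thesis by simp
  qed
  moreover have "r \<le> fst (snd q)" "r \<le> snd (snd q)" using q(1) by (auto simp: mem_Times_iff)
  ultimately show ?thesis by (intro exI[of _ "fst q"] exI[of _ "snd q"]) auto
qed

theorem theorem1:
  "\<exists>c c' :: real. c > 0 \<and> c' > 0 \<and>
    (\<forall>\<epsilon> :: real. 0 < \<epsilon> \<and> \<epsilon> < 1 / 2 \<longrightarrow>
      (\<exists>\<delta> :: real. \<delta> > 0 \<and> \<delta> \<ge> c' * exp (- exp (c * \<epsilon> powr (-3))) \<and>
        (\<forall>N :: real. N \<ge> 1 \<longrightarrow>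
          (\<forall>E :: (real \<times> real) set.
            E \<in> sets lebesgue \<and> E \<subseteq> {0..N^2} \<times> {0..N^3} \<and> measure lebesgue E > \<epsilon> * N^5 \<longrightarrow>
            (\<exists>x t :: real \<times> real. fst t > \<delta> * N \<and> snd t > \<delta> * N \<and>
              x \<in> E \<and> x + t \<in> E \<and> x + P t \<in> E)))))"
proof -
  obtain c where c: "0 < c" "\<And>\<epsilon>. 0 < \<epsilon> \<Longrightarrow> \<epsilon> < 1 \<Longrightarrow> exp (- exp (c * \<epsilon> powr (-3))) \<le> del \<epsilon>"
    using del_lower by blast
  have "\<exists>x t :: real \<times> real. fst t > del \<epsilon> * N \<and> snd t > del \<epsilon> * N \<and> x \<in> E \<and> x + t \<in> E \<and> x + P t \<in> E"
    if \<epsilon>: "0 < \<epsilon>" "\<epsilon> < 1 / 2" and N: "1 \<le> N" and E: "E \<in> sets lebesgue" "E \<subseteq> {0..N^2} \<times> {0..N^3}" "\<epsilon> * N^5 < measure lebesgue E"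
    for \<epsilon> N :: real and E
  proof -
    have bE: "bounded E" using E(2) by (rule bounded_subset[rotated]) (intro bounded_Times bounded_closed_interval)
    have lE: "E \<in> lmeasurable" using E(1) bE by (rule bounded_set_imp_lmeasurable[rotated])
    \<comment> \<open>The surplus granted by the strict inequality; a closed subset missing less
      than this still has measure at least \<open>\<epsilon> * N^5\<close>.\<close>
    define e where "e = measure lebesgue E - \<epsilon> * N^5"
    have e: "0 < e" using E(3) by (simp add: e_def)
    obtain Z where Z: "closed Z" "Z \<subseteq> E" "E - Z \<in> lmeasurable" "emeasure lebesgue (E - Z) < ennreal e"
      using sets_lebesgue_inner_closed[OF E(1) e] by blast
    have cZ: "compact Z" using Z(1,2) bE bounded_subset compact_eq_bounded_closed by blast
    have lZ: "Z \<in> lmeasurable" using cZ by (rule lmeasurable_compact)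
    have "measure lebesgue (E - Z) < e"
      using Z(3,4) e by (simp add: emeasure_eq_measure2 ennreal_less_iff)
    moreover have "measure lebesgue (E - Z) = measure lebesgue E - measure lebesgue Z"
      using measurable_measure_Diff[OF lE _ Z(2)] lZ by auto
    ultimately have mZ: "\<epsilon> * N^5 \<le> measure lebesgue Z" by (simp add: e_def)
    have "0 < \<epsilon> * N^5" using \<epsilon> N by simp
    then have "Z \<noteq> {}" using mZ by auto
    obtain x t where "del \<epsilon> * N < fst t" "del \<epsilon> * N < snd t" "x \<in> Z" "x + t \<in> Z" "x + P t \<in> Z"
      using compact_config[OF cZ \<open>Z \<noteq> {}\<close> subset_trans[OF Z(2) E(2)] N \<epsilon>(1) _ mZ] \<epsilon>(2) by auto
    then show ?thesis
      using Z(2) by blast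
  qed
  note config = this
  show ?thesis
  proof (rule exI[of _ c], rule exI[of _ 1], intro conjI allI impI)
    fix \<epsilon> :: real assume \<epsilon>: "0 < \<epsilon> \<and> \<epsilon> < 1 / 2"
    show "\<exists>\<delta> :: real. \<delta> > 0 \<and> \<delta> \<ge> 1 * exp (- exp (c * \<epsilon> powr (-3))) \<and>
        (\<forall>N :: real. N \<ge> 1 \<longrightarrow>
          (\<forall>E :: (real \<times> real) set.
            E \<in> sets lebesgue \<and> E \<subseteq> {0..N^2} \<times> {0..N^3} \<and> measure lebesgue E > \<epsilon> * N^5 \<longrightarrow>
            (\<exists>x t :: real \<times> real. fst t > \<delta> * N \<and> snd t > \<delta> * N \<and>
              x \<in> E \<and> x + t \<in> E \<and> x + P t \<in> E)))"
    proof (intro exI[of _ "del \<epsilon>"] conjI allI impI)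
      show "0 < del \<epsilon>" using del_pos[of \<epsilon>] \<epsilon> by simp
      show "1 * exp (- exp (c * \<epsilon> powr (-3))) \<le> del \<epsilon>" using c(2)[of \<epsilon>] \<epsilon> by simp
    qed (use config \<epsilon> in blast)
  qed (use c(1) in simp_all)
qed

end
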